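(* There exist universal constants $0<c\le C<\infty$ such that for every integer $N\ge 2$ and every $\beta>0$, $$c\,\mathsf P(\beta)\ \le\ \frac{\beta}{N}\,\mathcal F_\beta(X^{(N)};\mathsf u^{(N)})\ \le\ C\,\mathsf P(\beta),$$ where $X^{(N)}$ is the Sherrington--Kirkpatrick Hamiltonian on $\{-1,1\}^N$, $\mathsf u^{(N)}$ is the uniform probability measure on $\{-1,1\}^N$, and $\mathsf P(\beta)$ is the minimum of the Parisi functional.
   Context: Let $(G_{ij})_{1\le i,j\le N}$ be i.i.d. standard Gaussian random variables. The SK Hamiltonian is the Gaussian process $X^{(N)}=(X_t)_{t\in\{-1,1\}^N}$, $$X_t=\frac{1}{\sqrt N}\sum_{1\le i,j\le N}G_{ij}t_it_j .$$ The quenched free energy is $$\mathcal F_\beta(X^{(N)};\mathsf u^{(N)})=\mathbf E\Big[\frac1\beta\log\Big(2^{-N}\sum_{t\in\{-1,1\}^N}e^{\beta X_t}\Big)\Big].$$ Let $\mathscr D$ be the set of cumulative distribution functions of probability measures on $[0,1]$, i.e. nondecreasing right-continuous functions $\alpha:[0,1]\to[0,1]$ with $\alpha(1)=1$. For $\alpha\in\mathscr D$ and $\beta\ge 0$ let $f_{\alpha,\beta}$ be the (weak) solution of the Parisi PDE $$\partial_u f_{\alpha,\beta}(u,x)=-\beta^2\Big(\partial_{xx}f_{\alpha,\beta}(u,x)+\alpha(u)\big(\partial_x f_{\alpha,\beta}(u,x)\big)^2\Big),\qquad (u,x)\in[0,1]\times\mathbb R,$$ with terminal condition $f_{\alpha,\beta}(1,x)=\log\cosh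 x$. The Parisi functional is $$\mathsf P(\alpha,\beta)=f_{\alpha,\beta}(0,0)-\beta^2\int_0^1\alpha(u)\,u\,du,$$ and $\mathsf P(\beta)=\min_{\alpha\in\mathscr D}\mathsf P(\alpha,\beta)$ (the minimum is attained at a unique $\alpha$). *)

theory Defs
  imports "HOL-Probability.Probability"
begin

section \<open>The Sherrington--Kirkpatrick model\<close>

definition sk_disorder :: "nat \<Rightarrow> (nat \<times> nat \<Rightarrow> real) measure" where
  "sk_disorder N =
    (\<Pi>\<^sub>M p \<in> {1..N} \<times> {1..N}. density lborel (\<lambda>x. ennreal (std_normal_density x)))"

definition sk_configs :: "nat \<Rightarrow> (nat \<Rightarrow> real) set" where
  "sk_configs N = {1..N} \<rightarrow>\<^sub>E {-1, 1}"

definition sk_hamiltonian :: "nat \<Rightarrow> (nat \<times> nat \<Rightarrow> real) \<Rightarrow> (nat \<Rightarrow> real) \<Rightarrow> real" where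
  "sk_hamiltonian N G t = (1 / sqrt (real N)) * (\<Sum>i = 1..N. \<Sum>j = 1..N. G (i, j) * t i * t j)"

definition sk_free_energy :: "nat \<Rightarrow> real \<Rightarrow> real" where
  "sk_free_energy N \<beta> =
    (LINT G|sk_disorder N.
      (1 / \<beta>) * ln ((1 / 2 ^ N) * (\<Sum>t \<in> sk_configs N. exp (\<beta> * sk_hamiltonian N G t))))"

section \<open>The Parisi functional\<close>

text \<open>Only the values of \<open>\<alpha>\<close> on \<open>[0,1]\<close> matter, here and below.\<close>

definition cdf_unit_interval :: "(real \<Rightarrow> real) \<Rightarrow> bool" where
  "cdf_unit_interval \<alpha> \<longleftrightarrow>
     mono_on {0..1} \<alpha> \<and>
     (\<forall>u \<in> {0..1}. \<alpha> u \<in> {0..1}) \<and>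
     (\<forall>u \<in> {0..<1}. continuous (at_right u) \<alpha>) \<and>
     \<alpha> 1 = 1"

text \<open>
  A smooth function \<open>\<phi>\<close> on the plane is given together with all its partial derivatives:
  \<open>D i j\<close> is \<open>\<partial>\<^sub>u\<^sup>i \<partial>\<^sub>x\<^sup>j \<phi>\<close> and \<open>\<phi> = D 0 0\<close>.
\<close>

definition smooth_jet :: "(nat \<Rightarrow> nat \<Rightarrow> real \<times> real \<Rightarrow> real) \<Rightarrow> bool" where
  "smooth_jet D \<longleftrightarrow>
     (\<forall>i j. continuous_on UNIV (D i j) \<and>
       (\<forall>u x.
         ((\<lambda>v. D i j (v, x)) has_real_derivative D (Suc i) j (u, x)) (at u) \<and>
         ((\<lambda>y. D i j (u, y)) has_real_derivative D i (Suc j) (u, x)) (at x)))"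

definition test_jet :: "real set \<Rightarrow> (nat \<Rightarrow> nat \<Rightarrow> real \<times> real \<Rightarrow> real) \<Rightarrow> bool" where
  "test_jet T D \<longleftrightarrow>
     smooth_jet D \<and>
     (\<exists>K. compact K \<and> K \<subseteq> T \<times> UNIV \<and> (\<forall>z. z \<notin> K \<longrightarrow> D 0 0 z = 0))"

text \<open>The function \<open>g\<close> is a weak derivative \<open>\<partial>\<^sub>x f\<close> on \<open>(0,1) \<times> \<real>\<close> and lies in \<open>L\<^sup>\<infinity>\<close>.\<close>

definition bounded_weak_dx :: "(real \<times> real \<Rightarrow> real) \<Rightarrow> (real \<times> real \<Rightarrow> real) \<Rightarrow> bool" where
  "bounded_weak_dx f g \<longleftrightarrow>
     g \<in> borel_measurable borel \<and>
     (\<exists>B. AE z in lborel. \<bar>g z\<bar> \<le> B) \<and>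
     (\<forall>D. test_jet {0<..<1} D \<longrightarrow>
       (LINT z:{0..1} \<times> UNIV|lborel. f z * D 0 1 z) =
       - (LINT z:{0..1} \<times> UNIV|lborel. g z * D 0 0 z))"

text \<open>
  Weak solutions of
  \<open>\<partial>\<^sub>u f = - \<beta>\<^sup>2 (\<partial>\<^sub>x\<^sub>x f + \<alpha>(u) (\<partial>\<^sub>x f)\<^sup>2)\<close>, \<open>f(1,x) = log cosh x\<close>: continuous on
  \<open>[0,1] \<times> \<real>\<close>, with essentially bounded weak derivative \<open>\<partial>\<^sub>x f\<close>, and satisfying the equation
  integrated against test functions in \<open>C\<^sub>c\<^sup>\<infinity>((0,1] \<times> \<real>)\<close>. These are the restrictions to
  \<open>u \<le> 1\<close> of test functions on \<open>(0,\<infinity>) \<times> \<real>\<close>; they need not vanish at \<open>u = 1\<close>, whence the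
  boundary term. Such a solution exists and is unique on \<open>[0,1] \<times> \<real>\<close>; the values of \<open>f\<close>
  elsewhere are irrelevant.
\<close>

definition parisi_solution :: "(real \<Rightarrow> real) \<Rightarrow> real \<Rightarrow> (real \<times> real \<Rightarrow> real) \<Rightarrow> bool" where
  "parisi_solution \<alpha> \<beta> f \<longleftrightarrow>
     continuous_on ({0..1} \<times> UNIV) f \<and>
     (\<forall>x. f (1, x) = ln (cosh x)) \<and>
     (\<exists>g. bounded_weak_dx f g \<and>
       (\<forall>D. test_jet {0<..} D \<longrightarrow>
         (LINT z:{0..1} \<times> UNIV|lborel.
            - f z * D 1 0 z
            + \<beta>\<^sup>2 * (f z * D 0 2 z + \<alpha> (fst z) * (g z)\<^sup>2 * D 0 0 z))
         + (LINT x|lborel. ln (cosh x) * D 0 0 (1, x)) = 0))"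

text \<open>
  The Parisi functional \<open>P(\<alpha>,\<beta>)\<close>, evaluated with \<open>f = f\<^sub>\<alpha>\<^sub>,\<^sub>\<beta>\<close>.
\<close>

definition parisi_functional ::
    "(real \<Rightarrow> real) \<Rightarrow> real \<Rightarrow> (real \<times> real \<Rightarrow> real) \<Rightarrow> real" where
  "parisi_functional \<alpha> \<beta> f = f (0, 0) - \<beta>\<^sup>2 * (LINT u:{0..1}|lborel. \<alpha> u * u)"

text \<open>
  The infimum is attained. Since each \<open>\<alpha>\<close> has exactly one solution on the strip, it runs over
  the values \<open>P(\<alpha>,\<beta>)\<close> of the Parisi functional, one for each \<open>\<alpha>\<close>.
\<close>

definition parisi_min :: "real \<Rightarrow> real" where
  "parisi_min \<beta> =
    Inf {parisi_functional \<alpha> \<beta> f | \<alpha> f. cdf_unit_interval \<alpha> \<and> parisi_solution \<alpha> \<beta> f}"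

end

theory Submission
  imports Defs "HOL-Real_Asymp.Real_Asymp"
begin

text \<open>
  Both sides are of the order of \<open>m = min \<beta> \<beta>\<^sup>2\<close>, uniformly in \<open>N \<ge> 2\<close>, and this is proved for
  each side separately. The common yardstick is \<open>L(s) = E ln (cosh (s * g))\<close> with \<open>g\<close> standard
  Gaussian (\<open>heat_lncosh s 0\<close> below). Since \<open>ln (cosh y)\<close> is comparable to \<open>min \<bar>y\<bar> y\<^sup>2\<close>, \<open>L(s)\<close> is
  comparable to \<open>min s s\<^sup>2\<close>.

  Free energy, from above: Jensen's inequality for the logarithm gives the annealed bound, of order
  \<open>\<beta>\<^sup>2\<close>. Moreover every energy is at most the logarithm of the partition function at
  temperature one, so the free energy grows at most linearly in \<open>\<beta>\<close>.

  Free energy, from below (\<open>partial_free_energy_Suc\<close>): spins are added one at a time. Summing over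
  the spin number \<open>n + 1\<close> turns the partition function into a Gibbs average over the first \<open>n\<close> spins
  of \<open>cosh\<close> of a local field. By concavity of the logarithm one may average \<open>ln cosh\<close> instead. The
  local field involves only new couplings, so it is independent of the Gibbs weights, and for
  each configuration it is a centred Gaussian of variance \<open>2 * n / N\<close>. Hence this spin
  contributes at least \<open>L(\<beta> * sqrt (2 * n / N))\<close>. For the spins in the second half this is at least
  \<open>L(\<beta>)\<close>, and these are at least a third of all spins.

  Parisi functional, from above (\<open>parisi_solution_heat\<close>): for the point mass at \<open>u = 1\<close> the
  nonlinearity is invisible to the weak formulation, the solution is the heat flow of \<open>ln cosh\<close>,
  and the value of the functional is \<open>L(sqrt 2 * \<beta>)\<close>.

  Parisi functional, from below (\<open>parisi_functional_lower\<close>): let \<open>f\<close> be a weak solution for an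
  arbitrary \<open>\<alpha>\<close>. Two explicit subsolutions of the Parisi equation lie below \<open>f\<close>, and they show
  \<open>f(0,0) \<ge> \<beta>\<^sup>2 \<integral>\<^sub>0\<^sup>1 \<alpha>\<close> and \<open>f(0,0) \<ge> L(\<beta>) + \<beta>\<^sup>2 \<integral>\<^sub>1\<^sub>/\<^sub>2\<^sup>1 \<alpha>\<close>. The sum of the two is at least
  \<open>L(\<beta>) + 2 \<beta>\<^sup>2 \<integral>\<^sub>0\<^sup>1 \<alpha>(u) u du\<close>, because the weights \<open>1 - 2 u\<close> on \<open>[0,1/2]\<close> and \<open>2 - 2 u\<close> on
  \<open>[1/2,1]\<close> are nonnegative. Thus the functional is at least \<open>L(\<beta>) / 2\<close>, whatever \<open>\<alpha>\<close> is.

  The comparison \<open>parisi_comparison\<close> of \<open>f\<close> with a subsolution has to cope with \<open>f\<close> being merely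
  continuous with a bounded weak gradient \<open>g\<close>. Averaging \<open>f\<close> against a smooth kernel of radius \<open>\<epsilon>\<close>
  in both variables commutes with the linear part of the equation. In the nonlinear part,
  \<open>g\<^sup>2 \<ge> 2 c g - c\<^sup>2\<close> for every constant \<open>c\<close>, and \<open>\<alpha>\<close> is at least \<open>\<alpha>(u - \<epsilon>)\<close> on the support of the
  kernel because it is nondecreasing. So the average is a classical supersolution of the equation
  with \<open>\<alpha>\<close> delayed by \<open>\<epsilon>\<close>, to which the maximum principle applies against the subsolution delayed
  by \<open>\<epsilon>\<close>.
\<close>

section \<open>Differentiation under the integral sign\<close>

text \<open>
  The dominating function may depend on the range of the parameter. This is what moving kernels of
  compact support need: they are dominated on bounded parameter sets only.
\<close>

lemma has_real_derivative_integral: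
  fixes F F' :: "real \<Rightarrow> 'a \<Rightarrow> real"
  assumes int: "\<And>p. integrable M (F p)"
    and deriv: "\<And>p y. ((\<lambda>p. F p y) has_real_derivative F' p y) (at p)"
    and bound: "\<And>r. \<exists>w. integrable M w \<and> (\<forall>p y. \<bar>p\<bar> \<le> r \<longrightarrow> \<bar>F' p y\<bar> \<le> w y)"
    and meas: "F' p0 \<in> borel_measurable M"
  shows "((\<lambda>p. LINT y|M. F p y) has_real_derivative (LINT y|M. F' p0 y)) (at p0)"
proof -
  have "((\<lambda>h. ((LINT y|M. F (p0 + h) y) - (LINT y|M. F p0 y)) / h) \<longlongrightarrow> (LINT y|M. F' p0 y)) (at 0)"
    unfolding tendsto_at_iff_sequentially
  proof (intro allI impI)
    fix X :: "nat \<Rightarrow> real"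
    assume X: "\<forall>i. X i \<in> UNIV - {0}" and lim: "X \<longlonglongrightarrow> 0"
    obtain K where K: "\<And>n. \<bar>X n\<bar> \<le> K"
      using convergent_imp_Bseq[OF convergentI[OF lim]] by (auto simp: Bseq_def)
    obtain w where w: "integrable M w" "\<And>p y. \<bar>p\<bar> \<le> \<bar>p0\<bar> + K \<Longrightarrow> \<bar>F' p y\<bar> \<le> w y"
      using bound by blast
    have lip: "\<bar>F (p0 + X i) y - F p0 y\<bar> \<le> w y * \<bar>X i\<bar>" for i y
    proof -
      have "norm (F (p0 + X i) y - F p0 y) \<le> w y * norm (p0 + X i - p0)"
      proof (rule field_differentiable_bound[where S = "{- (\<bar>p0\<bar> + K)..\<bar>p0\<bar> + K}" and f' = "\<lambda>p. F' p y"])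
        show "norm (F' z y) \<le> w y" if "z \<in> {- (\<bar>p0\<bar> + K)..\<bar>p0\<bar> + K}" for z
          using w(2)[of z y] that by (simp add: abs_le_iff)
      qed (use K[of i] in \<open>auto intro: has_field_derivative_at_within deriv\<close>)
      thus ?thesis by simp
    qed
    have "(\<lambda>i. LINT y|M. (F (p0 + X i) y - F p0 y) / X i) \<longlonglongrightarrow> (LINT y|M. F' p0 y)"
    proof (rule integral_dominated_convergence[where w = w])
      show "AE y in M. (\<lambda>i. (F (p0 + X i) y - F p0 y) / X i) \<longlonglongrightarrow> F' p0 y"
      proof (rule AE_I2)
        fix y
        have "((\<lambda>h. (F (p0 + h) y - F p0 y) / h) \<longlongrightarrow> F' p0 y) (at 0)"
          using deriv[of y p0] by (simp add: DERIV_def)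
        from this[unfolded tendsto_at_iff_sequentially] X lim
        show "(\<lambda>i. (F (p0 + X i) y - F p0 y) / X i) \<longlonglongrightarrow> F' p0 y"
          by (auto simp: comp_def)
      qed
      show "AE y in M. norm ((F (p0 + X i) y - F p0 y) / X i) \<le> w y" for i
        using lip[of i] X by (intro AE_I2) (auto simp: field_simps)
    qed (use int w meas in auto)
    moreover have "(LINT y|M. (F (p0 + X i) y - F p0 y) / X i) =
        ((LINT y|M. F (p0 + X i) y) - (LINT y|M. F p0 y)) / X i" for i
      using Bochner_Integration.integral_diff[OF int int, of "p0 + X i" p0] by simp
    ultimately show "((\<lambda>h. ((LINT y|M. F (p0 + h) y) - (LINT y|M. F p0 y)) / h) \<circ> X)
        \<longlonglongrightarrow> (LINT y|M. F' p0 y)"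
      by (simp only: comp_def)
  qed
  thus ?thesis by (simp add: DERIV_def)
qed

section \<open>Elementary estimates for log cosh\<close>

lemma lncosh_deriv:
  "((\<lambda>y. ln (cosh y)) has_real_derivative tanh y) (at (y::real))"
  by (auto intro!: derivative_eq_intros simp: tanh_def)

lemma tanh_alt: "sinh y / cosh y = tanh (y::real)" "sinh y * z / cosh y = z * tanh y"
  by (auto simp: tanh_def)

lemma tanh_deriv: "(tanh has_real_derivative 1 - (tanh y)\<^sup>2) (at (y::real))"
  by (auto intro!: derivative_eq_intros)

lemma abs_tanh_le_1: "\<bar>tanh (y::real)\<bar> \<le> 1"
  using tanh_real_bounds[of y] by auto

lemma sech2_bounds: "0 \<le> 1 - (tanh (y::real))\<^sup>2" "1 - (tanh (y::real))\<^sup>2 \<le> 1"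
  using abs_tanh_le_1[of y] by (auto simp: abs_square_le_1)

lemma abs_sech2_le_1: "\<bar>1 - (tanh (y::real))\<^sup>2\<bar> \<le> 1"
  using sech2_bounds[of y] by linarith

lemma abs_tanh_le_abs: "\<bar>tanh (y::real)\<bar> \<le> \<bar>y\<bar>"
proof -
  have "norm (tanh y - tanh 0) \<le> 1 * norm (y - 0)"
    by (rule field_differentiable_bound[OF convex_UNIV, where f' = "\<lambda>y. 1 - (tanh y)\<^sup>2"])
      (use tanh_deriv sech2_bounds in \<open>auto\<close>)
  thus ?thesis by simp
qed

lemma lncosh_nonneg: "0 \<le> ln (cosh (y::real))"
  using cosh_real_ge_1[of y] by simp

lemma lncosh_le_abs: "ln (cosh (y::real)) \<le> \<bar>y\<bar>"
proof -
  have "cosh y \<le> exp \<bar>y\<bar>"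
    by (auto simp: cosh_field_def abs_if)
  thus ?thesis by (simp add: ln_le_cancel_iff[of _ "exp \<bar>y\<bar>", simplified])
qed

lemma abs_le_lncosh: "\<bar>y\<bar> - ln 2 \<le> ln (cosh (y::real))"
proof -
  have "exp \<bar>y\<bar> / 2 \<le> cosh y"
    by (auto simp: cosh_field_def abs_if)
  hence "ln (exp \<bar>y\<bar> / 2) \<le> ln (cosh y)" by (subst ln_le_cancel_iff) auto
  thus ?thesis by (simp add: ln_div)
qed

lemma lncosh_le_square: "ln (cosh (y::real)) \<le> y\<^sup>2"
proof -
  have "norm (ln (cosh y) - ln (cosh 0)) \<le> \<bar>y\<bar> * norm (y - 0)"
  proof (rule field_differentiable_bound[where S = "cball 0 \<bar>y\<bar>" and f' = tanh])
    fix z :: real assume "z \<in> cball 0 \<bar>y\<bar>"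
    thus "norm (tanh z) \<le> \<bar>y\<bar>" using abs_tanh_le_abs[of z] by simp
  qed (auto intro: has_field_derivative_at_within lncosh_deriv)
  thus ?thesis using lncosh_nonneg[of y] by (simp add: power2_eq_square)
qed

lemma cosh_ge_quadratic: "1 + y\<^sup>2 / 2 \<le> cosh (y::real)"
proof -
  have "\<bar>y / 2\<bar> \<le> \<bar>sinh (y / 2)\<bar>"
  proof -
    have *: "z \<le> sinh z" if "z \<ge> 0" for z :: real
    proof -
      have "sinh 0 - 0 \<le> sinh z - z"
      proof (rule DERIV_nonneg_imp_nondecreasing[OF that])
        fix x :: real assume "0 \<le> x" "x \<le> z"
        show "\<exists>y. ((\<lambda>z. sinh z - z) has_real_derivative y) (at x) \<and> 0 \<le> y"
          by (rule exI[of _ "cosh x - 1"])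
            (auto intro!: derivative_eq_intros cosh_real_ge_1)
      qed
      thus ?thesis by simp
    qed
    show ?thesis using *[of "\<bar>y/2\<bar>"] *[of "y/2"] *[of "-(y/2)"] by (cases "y \<ge> 0") auto
  qed
  hence "(y/2)\<^sup>2 \<le> (sinh (y/2))\<^sup>2" by (rule abs_le_square_iff[THEN iffD1])
  moreover have "cosh y = 1 + 2 * (sinh (y/2))\<^sup>2"
    using cosh_double[of "y/2"] cosh_square_eq[of "y/2"] by simp
  ultimately show ?thesis by (simp add: power2_eq_square)
qed

text \<open>
  Near the origin \<open>cosh y \<ge> 1 + y\<^sup>2 / 2\<close> is sharp enough; away from it \<open>\<bar>y\<bar> - ln 2\<close> is, as \<open>ln 2 \<le> 3/4\<close>.
\<close>

lemma lncosh_ge_min: "min \<bar>y\<bar> (y\<^sup>2) / 4 \<le> ln (cosh (y::real))"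
proof (cases "\<bar>y\<bar> \<le> 1")
  case True
  hence y2: "y\<^sup>2 \<le> 1" by (simp add: abs_square_le_1)
  have "ln (1 + y\<^sup>2/2) \<le> ln (cosh y)"
    using cosh_ge_quadratic[of y] by (subst ln_le_cancel_iff) (auto simp: add_pos_nonneg)
  moreover have "(y\<^sup>2/2) - (y\<^sup>2/2)\<^sup>2 \<le> ln (1 + y\<^sup>2/2)"
    by (rule ln_one_plus_pos_lower_bound) (use y2 in auto)
  moreover have "(y\<^sup>2/2)\<^sup>2 \<le> y\<^sup>2 / 4 * 1"
    unfolding power2_eq_square[of "y\<^sup>2/2"] using mult_left_mono[OF y2, of "y\<^sup>2"] by simp
  ultimately have "y\<^sup>2 / 4 \<le> ln (cosh y)" by linarith
  thus ?thesis by (meson divide_right_mono min.cobounded2 order_trans zero_le_numeral)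
next
  case False
  have "ln 2 \<le> (3/4 :: real)" using ln2_le_25_over_36 by simp
  with False abs_le_lncosh[of y] show ?thesis by (auto simp: min_def split: if_splits)
qed

lemma borel_measurable_tanh [measurable]: "(tanh :: real \<Rightarrow> real) \<in> borel_measurable borel"
  by (intro borel_measurable_continuous_onI continuous_intros) auto

lemma borel_measurable_cosh [measurable]: "(cosh :: real \<Rightarrow> real) \<in> borel_measurable borel"
  by (intro borel_measurable_continuous_onI continuous_intros)

section \<open>Gaussian averages\<close>

lemma std_normal_prob: "prob_space std_normal_distribution"
  by (rule prob_space_normal_density) simp

interpretation gauss: prob_space std_normal_distribution
  by (rule std_normal_prob)

lemma gauss_prob_UNIV [simp]: "measure std_normal_distribution UNIV = 1"
  using gauss.prob_space by simp

lemma gauss_integrable_iff: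
  "f \<in> borel_measurable borel \<Longrightarrow>
    integrable std_normal_distribution f \<longleftrightarrow> integrable lborel (\<lambda>x. std_normal_density x * f x)"
  for f :: "real \<Rightarrow> real"
  by (subst integrable_density) auto

lemma gauss_integral:
  "f \<in> borel_measurable borel \<Longrightarrow>
    (LINT x|std_normal_distribution. f x) = (LINT x|lborel. std_normal_density x * f x)"
  for f :: "real \<Rightarrow> real"
  by (subst integral_density) auto

lemma gauss_integrable_abs: "integrable std_normal_distribution (\<lambda>x. \<bar>x\<bar>)"
  using integrable_std_normal_moment_abs[of 1] by (subst gauss_integrable_iff) auto

lemma gauss_integrable_square: "integrable std_normal_distribution (\<lambda>x. x\<^sup>2)"
  using integrable_std_normal_moment[of 2] by (subst gauss_integrable_iff) auto

lemma gauss_integral_square: "(LINT x|std_normal_distribution. x\<^sup>2) = 1"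
  using std_normal_moment_even[of 1]
  by (subst gauss_integral) (auto simp: has_bochner_integral_iff)

lemma gauss_integral_abs_le: "(LINT x|std_normal_distribution. \<bar>x\<bar>) \<le> 1"
proof -
  have "(LINT x|std_normal_distribution. \<bar>x\<bar>) \<le> (LINT x|std_normal_distribution. (1 + x\<^sup>2) / 2)"
  proof (rule integral_mono)
    show "\<bar>x\<bar> \<le> (1 + x\<^sup>2) / 2" for x :: real
      using zero_le_power2[of "\<bar>x\<bar> - 1"] by (simp add: power2_diff)
  qed (use gauss_integrable_abs gauss_integrable_square in auto)
  also have "\<dots> = 1"
    using gauss_integrable_square by (simp add: gauss_integral_square gauss.prob_space)
  finally show ?thesis .
qed

lemma gauss_integrable_bounded:
  fixes u :: "real \<Rightarrow> real"
  assumes "u \<in> borel_measurable borel" "\<And>x. \<bar>u x\<bar> \<le> B"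
  shows "integrable std_normal_distribution u"
  by (rule gauss.integrable_const_bound[where B = B]) (use assms in auto)

lemma std_normal_density_deriv:
  "(std_normal_density has_real_derivative - x * std_normal_density x) (at x)"
  unfolding std_normal_density_def
  by (auto intro!: derivative_eq_intros simp: power2_eq_square field_simps)

lemma std_normal_density_lim:
  "(std_normal_density \<longlongrightarrow> 0) at_top" "(std_normal_density \<longlongrightarrow> 0) at_bot"
  unfolding std_normal_density_def by real_asymp+

text \<open>
  The Gaussian density \<open>\<phi>\<close> satisfies \<open>\<phi>' = - x \<phi>\<close>, so the difference of the two integrands is the
  derivative of \<open>- \<phi> u\<close>, which vanishes at both ends of the line.
\<close>

lemma gauss_integration_by_parts:
  fixes u u' :: "real \<Rightarrow> real"
  assumes deriv: "\<And>x. (u has_real_derivative u' x) (at x)"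
    and cont: "continuous_on UNIV u'"
    and bound: "\<And>x. \<bar>u x\<bar> \<le> B" "\<And>x. \<bar>u' x\<bar> \<le> B"
  shows "(LINT x|std_normal_distribution. x * u x) = (LINT x|std_normal_distribution. u' x)"
proof -
  have cu: "continuous_on UNIV u"
    using deriv by (auto simp: continuous_on_eq_continuous_at intro: DERIV_isCont)
  have mu[measurable]: "u \<in> borel_measurable borel" "u' \<in> borel_measurable borel"
    using cu cont by (auto intro: borel_measurable_continuous_onI)
  have i1: "integrable std_normal_distribution (\<lambda>x. x * u x)"
  proof (rule Bochner_Integration.integrable_bound)
    show "integrable std_normal_distribution (\<lambda>x. B * \<bar>x\<bar>)" using gauss_integrable_abs by simp
    show "AE x in std_normal_distribution. norm (x * u x) \<le> norm (B * \<bar>x\<bar>)"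
    proof (rule AE_I2)
      fix x
      have "\<bar>u x\<bar> \<le> \<bar>B\<bar>" using bound(1)[of x] by linarith
      thus "norm (x * u x) \<le> norm (B * \<bar>x\<bar>)"
        by (simp add: abs_mult mult.commute[of "\<bar>x\<bar>"] mult_right_mono)
    qed
  qed simp
  have i2: "integrable std_normal_distribution u'"
    by (rule gauss_integrable_bounded[OF mu(2) bound(2)])
  let ?d = "\<lambda>x. std_normal_density x * u' x - std_normal_density x * (x * u x)"
  have id: "integrable lborel ?d"
    using i1 i2 by (simp add: gauss_integrable_iff)
  have lim: "((\<lambda>x. std_normal_density x * u x) \<longlongrightarrow> 0) F"
    if "(std_normal_density \<longlongrightarrow> 0) F" for F
  proof (rule Lim_null_comparison)
    show "\<forall>\<^sub>F x in F. norm (std_normal_density x * u x) \<le> std_normal_density x * B"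
      using bound(1) by (auto simp: abs_mult intro!: always_eventually mult_left_mono)
    show "((\<lambda>x. std_normal_density x * B) \<longlongrightarrow> 0) F"
      using tendsto_mult[OF that tendsto_const[of B]] by simp
  qed
  have "(LBINT x=-\<infinity>..\<infinity>. ?d x) = 0 - 0"
  proof (rule interval_integral_FTC_integrable)
    show "((\<lambda>x. std_normal_density x * u x) has_vector_derivative ?d x) (at x)" for x
      using DERIV_mult[OF std_normal_density_deriv deriv, of x]
      by (auto simp: has_real_derivative_iff_has_vector_derivative[symmetric] algebra_simps)
    show "isCont ?d x" for x
      using cu cont unfolding std_normal_density_def
      by (auto intro!: continuous_intros simp: continuous_on_eq_continuous_at)
    show "set_integrable lborel (einterval (- \<infinity>) \<infinity>) ?d"
      using id by (simp add: set_integrable_def)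
    show "(((\<lambda>x. std_normal_density x * u x) \<circ> real_of_ereal) \<longlongrightarrow> 0) (at_right (- \<infinity>))"
      using lim[OF std_normal_density_lim(2)]
      by (simp add: ereal_tendsto_simps)
    show "(((\<lambda>x. std_normal_density x * u x) \<circ> real_of_ereal) \<longlongrightarrow> 0) (at_left \<infinity>)"
      using lim[OF std_normal_density_lim(1)] by (simp add: ereal_tendsto_simps)
  qed simp
  hence "(LINT x|lborel. ?d x) = 0"
    by (simp add: interval_lebesgue_integral_def set_lebesgue_integral_def)
  thus ?thesis
    using i1 i2 by (simp add: gauss_integral gauss_integrable_iff)
qed

section \<open>The heat flow of log cosh\<close>

definition heat_lncosh :: "real \<Rightarrow> real \<Rightarrow> real" where
  "heat_lncosh s x = (LINT g|std_normal_distribution. ln (cosh (x + s * g)))"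

definition heat_tanh :: "real \<Rightarrow> real \<Rightarrow> real" where
  "heat_tanh s x = (LINT g|std_normal_distribution. tanh (x + s * g))"

definition heat_sech2 :: "real \<Rightarrow> real \<Rightarrow> real" where
  "heat_sech2 s x = (LINT g|std_normal_distribution. 1 - (tanh (x + s * g))\<^sup>2)"

lemma integrable_lncosh: "integrable std_normal_distribution (\<lambda>g. ln (cosh (x + s * g)))"
proof (rule Bochner_Integration.integrable_bound)
  show "integrable std_normal_distribution (\<lambda>g. \<bar>x\<bar> + \<bar>s\<bar> * \<bar>g\<bar>)"
    using gauss_integrable_abs by simp
  have "\<bar>ln (cosh (x + s * g))\<bar> \<le> \<bar>x\<bar> + \<bar>s\<bar> * \<bar>g\<bar>" for g
    using lncosh_le_abs[of "x + s * g"] lncosh_nonneg[of "x + s * g"]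
      abs_triangle_ineq[of x "s * g"] by (simp add: abs_mult)
  thus "AE g in std_normal_distribution. norm (ln (cosh (x + s * g))) \<le> norm (\<bar>x\<bar> + \<bar>s\<bar> * \<bar>g\<bar>)"
    by (intro AE_I2) (simp add: order_trans[OF _ abs_ge_self])
qed simp

lemma integrable_tanh: "integrable std_normal_distribution (\<lambda>g. tanh (x + s * g))"
  by (rule gauss_integrable_bounded[where B = 1]) (auto simp: abs_tanh_le_1)

lemma integrable_sech2: "integrable std_normal_distribution (\<lambda>g. 1 - (tanh (x + s * g))\<^sup>2)"
  by (rule gauss_integrable_bounded[where B = 1]) (auto intro: abs_sech2_le_1)

lemma heat_lncosh_0: "heat_lncosh 0 x = ln (cosh x)"
  by (simp add: heat_lncosh_def gauss.prob_space)

lemma heat_tanh_0: "heat_tanh 0 x = tanh x"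
  by (simp add: heat_tanh_def gauss.prob_space)

lemma heat_sech2_0: "heat_sech2 0 x = 1 - (tanh x)\<^sup>2"
  by (simp add: heat_sech2_def gauss.prob_space)

lemma abs_heat_tanh_le_1: "\<bar>heat_tanh s x\<bar> \<le> 1"
proof -
  have "\<bar>heat_tanh s x\<bar> \<le> (LINT g|std_normal_distribution. \<bar>tanh (x + s * g)\<bar>)"
    unfolding heat_tanh_def by (rule integral_abs_bound)
  also have "\<dots> \<le> (LINT g|std_normal_distribution. 1)"
    by (rule integral_mono) (use integrable_tanh abs_tanh_le_1 in auto)
  finally show ?thesis by (simp add: gauss.prob_space)
qed

lemma heat_lncosh_dx: "(heat_lncosh s has_real_derivative heat_tanh s x) (at x)"
proof -
  have "((\<lambda>x. LINT g|std_normal_distribution. ln (cosh (x + s * g))) has_real_derivative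
      (LINT g|std_normal_distribution. tanh (x + s * g))) (at x)"
    by (rule has_real_derivative_integral[OF integrable_lncosh])
      (auto intro!: exI[of _ "\<lambda>_. 1"] derivative_eq_intros simp: abs_tanh_le_1 tanh_alt simp del: tanh_real_abs)
  thus ?thesis by (simp add: heat_lncosh_def[abs_def] heat_tanh_def)
qed

lemma heat_tanh_dx: "(heat_tanh s has_real_derivative heat_sech2 s x) (at x)"
proof -
  have "((\<lambda>x. LINT g|std_normal_distribution. tanh (x + s * g)) has_real_derivative
      (LINT g|std_normal_distribution. 1 - (tanh (x + s * g))\<^sup>2)) (at x)"
    by (rule has_real_derivative_integral[OF integrable_tanh])
      (auto intro!: exI[of _ "\<lambda>_. 1"] derivative_eq_intros abs_sech2_le_1)
  thus ?thesis by (simp add: heat_tanh_def[abs_def] heat_sech2_def)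
qed

text \<open>
  This is the heat equation in the variable \<open>s\<^sup>2 / 2\<close>: differentiation produces a factor \<open>g\<close>, which
  Gaussian integration by parts trades for a derivative of \<open>tanh\<close> and a factor \<open>s\<close>. In this
  form there is no singularity at \<open>s = 0\<close>.
\<close>

lemma heat_lncosh_ds:
  "((\<lambda>s. heat_lncosh s x) has_real_derivative s * heat_sech2 s x) (at s)"
proof -
  have "((\<lambda>s. LINT g|std_normal_distribution. ln (cosh (x + s * g))) has_real_derivative
      (LINT g|std_normal_distribution. g * tanh (x + s * g))) (at s)"
    by (rule has_real_derivative_integral[OF integrable_lncosh])
      (auto intro!: exI[of _ "\<lambda>g. \<bar>g\<bar>"] derivative_eq_intros gauss_integrable_abs mult_right_le_one_le
        simp: abs_tanh_le_1 abs_mult tanh_alt simp del: tanh_real_abs)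
  also have "(LINT g|std_normal_distribution. g * tanh (x + s * g)) =
      (LINT g|std_normal_distribution. s * (1 - (tanh (x + s * g))\<^sup>2))"
  proof (rule gauss_integration_by_parts[where B = "max 1 \<bar>s\<bar>"])
    show "((\<lambda>g. tanh (x + s * g)) has_real_derivative s * (1 - (tanh (x + s * g))\<^sup>2)) (at g)" for g
      by (auto intro!: derivative_eq_intros)
    show "\<bar>tanh (x + s * g)\<bar> \<le> max 1 \<bar>s\<bar>" for g
      using abs_tanh_le_1[of "x + s * g"] by linarith
    have "\<bar>s * (1 - (tanh (x + s * g))\<^sup>2)\<bar> \<le> \<bar>s\<bar>" for g
      unfolding abs_mult
      by (rule mult_right_le_one_le) (use sech2_bounds[of "x + s * g"] in auto)
    thus "\<bar>s * (1 - (tanh (x + s * g))\<^sup>2)\<bar> \<le> max 1 \<bar>s\<bar>" for g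
      by (meson max.coboundedI2)
  qed (auto intro!: continuous_intros)
  finally show ?thesis by (simp add: heat_lncosh_def[abs_def] heat_sech2_def)
qed

lemma continuous_on_heat:
  fixes \<phi> :: "real \<Rightarrow> real"
  assumes "continuous_on UNIV \<phi>" "\<And>y. \<bar>\<phi> y\<bar> \<le> 1 + \<bar>y\<bar>"
  shows "continuous_on UNIV (\<lambda>z. LINT g|std_normal_distribution. \<phi> (snd z + fst z * g))"
proof (rule continuous_on_sequentiallyI)
  fix u :: "nat \<Rightarrow> real \<times> real" and a
  assume u: "u \<longlonglongrightarrow> a"
  have [measurable]: "\<phi> \<in> borel_measurable borel"
    using assms(1) by (rule borel_measurable_continuous_onI)
  have "Bseq u" using u by (rule convergent_imp_Bseq[OF convergentI])
  then obtain K where K: "\<And>n. norm (u n) \<le> K" by (auto simp: Bseq_def)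
  show "(\<lambda>n. LINT g|std_normal_distribution. \<phi> (snd (u n) + fst (u n) * g)) \<longlonglongrightarrow>
      (LINT g|std_normal_distribution. \<phi> (snd a + fst a * g))"
  proof (rule integral_dominated_convergence[where w = "\<lambda>g. 1 + (K + K * \<bar>g\<bar>)"])
    show "integrable std_normal_distribution (\<lambda>g. 1 + (K + K * \<bar>g\<bar>))"
      using gauss_integrable_abs by simp
    show "AE g in std_normal_distribution. (\<lambda>n. \<phi> (snd (u n) + fst (u n) * g)) \<longlonglongrightarrow> \<phi> (snd a + fst a * g)"
      using assms(1) u
      by (intro AE_I2 continuous_on_tendsto_compose[of UNIV \<phi>] tendsto_intros) auto
    show "AE g in std_normal_distribution. norm (\<phi> (snd (u n) + fst (u n) * g)) \<le> 1 + (K + K * \<bar>g\<bar>)" for n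
    proof (rule AE_I2)
      fix g :: real
      have "\<bar>snd (u n) + fst (u n) * g\<bar> \<le> \<bar>snd (u n)\<bar> + \<bar>fst (u n)\<bar> * \<bar>g\<bar>"
        using abs_triangle_ineq[of "snd (u n)" "fst (u n) * g"] by (simp add: abs_mult)
      also have "\<dots> \<le> K + K * \<bar>g\<bar>"
        using norm_fst_le[of "fst (u n)" "snd (u n)"] norm_snd_le[of "snd (u n)" "fst (u n)"] K[of n]
        by (intro add_mono mult_right_mono) (auto intro: order_trans)
      finally show "norm (\<phi> (snd (u n) + fst (u n) * g)) \<le> 1 + (K + K * \<bar>g\<bar>)"
        using assms(2)[of "snd (u n) + fst (u n) * g"] by simp
    qed
  qed auto
qed

lemma continuous_on_heat_lncosh:
  "continuous_on UNIV (\<lambda>z. heat_lncosh (fst z) (snd z))"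
  unfolding heat_lncosh_def
proof (rule continuous_on_heat)
  show "\<bar>ln (cosh y)\<bar> \<le> 1 + \<bar>y\<bar>" for y :: real
    using lncosh_le_abs[of y] lncosh_nonneg[of y] by linarith
qed (auto intro!: continuous_intros)

lemma continuous_on_heat_tanh:
  "continuous_on UNIV (\<lambda>z. heat_tanh (fst z) (snd z))"
  unfolding heat_tanh_def
proof (rule continuous_on_heat)
  show "\<bar>tanh y\<bar> \<le> 1 + \<bar>y\<bar>" for y :: real
    using abs_tanh_le_1[of y] by linarith
qed (auto intro!: continuous_intros)

lemma continuous_on_heat_sech2:
  "continuous_on UNIV (\<lambda>z. heat_sech2 (fst z) (snd z))"
  unfolding heat_sech2_def
proof (rule continuous_on_heat)
  show "\<bar>1 - (tanh y)\<^sup>2\<bar> \<le> 1 + \<bar>y\<bar>" for y :: real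
    using sech2_bounds[of y] by linarith
qed (auto intro!: continuous_intros)

lemma heat_lncosh_nonneg: "0 \<le> heat_lncosh s x"
  unfolding heat_lncosh_def
  by (rule Bochner_Integration.integral_nonneg) (use lncosh_nonneg in auto)

lemma heat_lncosh_le_linear: "heat_lncosh s x \<le> \<bar>x\<bar> + \<bar>s\<bar>"
proof -
  have "heat_lncosh s x \<le> (LINT g|std_normal_distribution. \<bar>x\<bar> + \<bar>s\<bar> * \<bar>g\<bar>)"
    unfolding heat_lncosh_def
  proof (rule integral_mono[OF integrable_lncosh])
    show "integrable std_normal_distribution (\<lambda>g. \<bar>x\<bar> + \<bar>s\<bar> * \<bar>g\<bar>)"
      using gauss_integrable_abs by simp
    show "ln (cosh (x + s * g)) \<le> \<bar>x\<bar> + \<bar>s\<bar> * \<bar>g\<bar>" for g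
      using lncosh_le_abs[of "x + s * g"] abs_triangle_ineq[of x "s * g"] by (simp add: abs_mult)
  qed
  also have "\<dots> = \<bar>x\<bar> + \<bar>s\<bar> * (LINT g|std_normal_distribution. \<bar>g\<bar>)"
    using gauss_integrable_abs by (simp add: gauss.prob_space)
  also have "\<dots> \<le> \<bar>x\<bar> + \<bar>s\<bar>"
    using gauss_integral_abs_le by (simp add: mult_right_le_one_le)
  finally show ?thesis .
qed

lemma heat_lncosh_le_square: "heat_lncosh s 0 \<le> s\<^sup>2"
proof -
  have "heat_lncosh s 0 \<le> (LINT g|std_normal_distribution. s\<^sup>2 * g\<^sup>2)"
    unfolding heat_lncosh_def
  proof (rule integral_mono[OF integrable_lncosh])
    show "integrable std_normal_distribution (\<lambda>g. s\<^sup>2 * g\<^sup>2)"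
      using gauss_integrable_square by simp
    show "ln (cosh (0 + s * g)) \<le> s\<^sup>2 * g\<^sup>2" for g
      using lncosh_le_square[of "s * g"] by (simp add: power_mult_distrib)
  qed
  thus ?thesis by (simp add: gauss_integral_square)
qed

definition gauss_min_moment :: real where
  "gauss_min_moment = (LINT g|std_normal_distribution. min \<bar>g\<bar> (g\<^sup>2)) / 4"

lemma integrable_min_moment: "integrable std_normal_distribution (\<lambda>g. min \<bar>g\<bar> (g\<^sup>2))"
  by (rule Bochner_Integration.integrable_bound[OF gauss_integrable_abs]) auto

lemma gauss_min_moment_pos: "0 < gauss_min_moment"
proof -
  have "0 \<le> (LINT g|std_normal_distribution. min \<bar>g\<bar> (g\<^sup>2))"
    by (rule Bochner_Integration.integral_nonneg) auto
  moreover have "(LINT g|std_normal_distribution. min \<bar>g\<bar> (g\<^sup>2)) \<noteq> 0"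
  proof
    assume "(LINT g|std_normal_distribution. min \<bar>g\<bar> (g\<^sup>2)) = 0"
    hence "AE g in std_normal_distribution. min \<bar>g\<bar> (g\<^sup>2) = 0"
      using integral_nonneg_eq_0_iff_AE[OF integrable_min_moment] by auto
    hence "AE g in std_normal_distribution. g\<^sup>2 = 0"
      by eventually_elim (auto simp: min_def split: if_splits)
    hence "(LINT g|std_normal_distribution. g\<^sup>2) = (LINT g|std_normal_distribution. 0)"
      by (intro integral_cong_AE) auto
    thus False by (simp add: gauss_integral_square)
  qed
  ultimately show ?thesis unfolding gauss_min_moment_def by linarith
qed

text \<open>
  The scale \<open>s\<close> can be taken out of the lower bound for \<open>ln cosh\<close>, because
  \<open>min s s\<^sup>2 * min \<bar>g\<bar> g\<^sup>2 \<le> min \<bar>s g\<bar> (s g)\<^sup>2\<close>.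
\<close>

lemma heat_lncosh_lower:
  assumes "0 \<le> s"
  shows "gauss_min_moment * min s (s\<^sup>2) \<le> heat_lncosh s 0"
proof -
  have "gauss_min_moment * min s (s\<^sup>2) =
      (LINT g|std_normal_distribution. min s (s\<^sup>2) / 4 * min \<bar>g\<bar> (g\<^sup>2))"
    by (simp add: gauss_min_moment_def)
  also have "\<dots> \<le> heat_lncosh s 0"
    unfolding heat_lncosh_def
  proof (rule integral_mono[OF _ integrable_lncosh])
    show "integrable std_normal_distribution (\<lambda>g. min s (s\<^sup>2) / 4 * min \<bar>g\<bar> (g\<^sup>2))"
      using integrable_min_moment by simp
    fix g :: real
    have "min s (s\<^sup>2) * min \<bar>g\<bar> (g\<^sup>2) \<le> s * \<bar>g\<bar>"
      using assms by (intro mult_mono) (auto simp: min_def)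
    moreover have "min s (s\<^sup>2) * min \<bar>g\<bar> (g\<^sup>2) \<le> s\<^sup>2 * g\<^sup>2"
      using assms by (intro mult_mono) (auto simp: min_def)
    ultimately have "min s (s\<^sup>2) * min \<bar>g\<bar> (g\<^sup>2) \<le> min \<bar>s * g\<bar> ((s * g)\<^sup>2)"
      using assms by (simp add: abs_mult power_mult_distrib)
    also have "\<dots> / 4 \<le> ln (cosh (s * g))" by (rule lncosh_ge_min)
    finally show "min s (s\<^sup>2) / 4 * min \<bar>g\<bar> (g\<^sup>2) \<le> ln (cosh (0 + s * g))" by simp
  qed
  finally show ?thesis .
qed

lemma heat_lncosh_mono: assumes "0 \<le> s" "s \<le> s'" shows "heat_lncosh s 0 \<le> heat_lncosh s' 0"
  unfolding heat_lncosh_def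
proof (rule integral_mono[OF integrable_lncosh integrable_lncosh])
  fix g :: real
  have "cosh \<bar>s * g\<bar> \<le> cosh \<bar>s' * g\<bar>"
    using assms mult_right_mono[of s s' "\<bar>g\<bar>"]
    by (subst cosh_real_nonneg_le_iff) (simp_all add: abs_mult)
  thus "ln (cosh (0 + s * g)) \<le> ln (cosh (0 + s' * g))" by simp
qed

section \<open>Smooth bump functions\<close>

text \<open>
  Smoothness is handled through \<open>n\<close>-fold differentiability for all \<open>n\<close>, which passes to products by
  induction, without the Leibniz formula for iterated derivatives.
\<close>

primrec n_times_diff :: "nat \<Rightarrow> (real \<Rightarrow> real) \<Rightarrow> bool" where
  "n_times_diff 0 f = True"
| "n_times_diff (Suc n) f \<longleftrightarrow>
    (\<exists>f'. (\<forall>x. (f has_real_derivative f' x) (at x)) \<and> n_times_diff n f')"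

lemma n_times_diff_Suc_D: "n_times_diff (Suc n) f \<Longrightarrow> n_times_diff n f"
proof (induction n arbitrary: f)
  case (Suc n)
  then obtain f' where "\<forall>x. (f has_real_derivative f' x) (at x)" "n_times_diff (Suc n) f'"
    unfolding n_times_diff.simps(2)[of "Suc n"] by blast
  thus ?case using Suc.IH[of f'] by auto
qed simp

lemma n_times_diff_add:
  "n_times_diff n f \<Longrightarrow> n_times_diff n g \<Longrightarrow> n_times_diff n (\<lambda>x. f x + g x)"
proof (induction n arbitrary: f g)
  case (Suc n)
  then obtain f' g' where "\<forall>x. (f has_real_derivative f' x) (at x)" "n_times_diff n f'"
    "\<forall>x. (g has_real_derivative g' x) (at x)" "n_times_diff n g'"
    by auto
  thus ?case using Suc.IH[of f' g']
    by (auto intro!: exI[of _ "\<lambda>x. f' x + g' x"] derivative_eq_intros)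
qed simp

lemma n_times_diff_mult:
  "n_times_diff n f \<Longrightarrow> n_times_diff n g \<Longrightarrow> n_times_diff n (\<lambda>x. f x * g x)"
proof (induction n arbitrary: f g)
  case (Suc n)
  then obtain f' g' where *: "\<And>x. (f has_real_derivative f' x) (at x)" "n_times_diff n f'"
    "\<And>x. (g has_real_derivative g' x) (at x)" "n_times_diff n g'"
    by auto
  have "n_times_diff n (\<lambda>x. f' x * g x + g' x * f x)"
    by (rule n_times_diff_add[OF Suc.IH[OF *(2) n_times_diff_Suc_D[OF Suc.prems(2)]]
          Suc.IH[OF *(4) n_times_diff_Suc_D[OF Suc.prems(1)]]])
  moreover have "((\<lambda>x. f x * g x) has_real_derivative f' x * g x + g' x * f x) (at x)" for x
    by (rule DERIV_mult[OF *(1,3)])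
  ultimately show ?case by (auto intro!: exI[of _ "\<lambda>x. f' x * g x + g' x * f x"])
qed simp

lemma n_times_diff_affine:
  "n_times_diff n f \<Longrightarrow> n_times_diff n (\<lambda>x. c * f (a * x + b))"
proof (induction n arbitrary: f c)
  case (Suc n)
  then obtain f' where *: "\<And>x. (f has_real_derivative f' x) (at x)" "n_times_diff n f'" by auto
  have "((\<lambda>x. c * f (a * x + b)) has_real_derivative (c * a) * f' (a * x + b)) (at x)" for x
    by (auto intro!: derivative_eq_intros DERIV_chain2[OF *(1)])
  thus ?case using Suc.IH[OF *(2), of "c * a"]
    by (auto intro!: exI[of _ "\<lambda>x. (c * a) * f' (a * x + b)"])
qed simp

lemma n_times_diff_deriv: "n_times_diff (Suc n) f \<Longrightarrow> n_times_diff n (deriv f)"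
proof -
  assume "n_times_diff (Suc n) f"
  then obtain f' where *: "\<And>x. (f has_real_derivative f' x) (at x)" "n_times_diff n f'" by auto
  have "deriv f = f'" using *(1) by (auto intro: DERIV_imp_deriv)
  thus ?thesis using *(2) by simp
qed

lemma smooth_iterated_deriv:
  assumes "\<And>n. n_times_diff n f"
  shows "((deriv ^^ n) f has_real_derivative (deriv ^^ Suc n) f x) (at x)"
proof -
  have *: "n_times_diff m ((deriv ^^ n) f)" for m n
    using assms by (induction n arbitrary: m) (auto intro: n_times_diff_deriv simp del: n_times_diff.simps)
  from *[of "Suc 0" n] have "\<exists>f'. \<forall>x. ((deriv ^^ n) f has_real_derivative f' x) (at x)" by auto
  then obtain f' where f': "\<And>x. ((deriv ^^ n) f has_real_derivative f' x) (at x)" by blast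
  hence "deriv ((deriv ^^ n) f) = f'" by (auto intro: DERIV_imp_deriv)
  thus ?thesis using f' by simp
qed

text \<open>
  The function \<open>exp (- 1 / x)\<close> on the positive half line, extended by zero, times a polynomial in
  \<open>1 / x\<close>. With the polynomial factor the family is closed under differentiation.
\<close>

definition flat_poly_exp :: "real poly \<Rightarrow> real \<Rightarrow> real" where
  "flat_poly_exp p x = (if x \<le> 0 then 0 else poly p (inverse x) * exp (- inverse x))"

lemma poly_times_exp_minus_at_top: "((\<lambda>y. poly p y * exp (- y)) \<longlongrightarrow> (0::real)) at_top"
proof -
  have "((\<lambda>y. \<Sum>i\<le>degree p. coeff p i * (y ^ i / exp y)) \<longlongrightarrow> (\<Sum>i\<le>degree p. coeff p i * 0)) at_top"
    by (intro tendsto_sum tendsto_mult tendsto_const tendsto_power_div_exp_0)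
  moreover have "(\<lambda>y. \<Sum>i\<le>degree p. coeff p i * (y ^ i / exp y)) = (\<lambda>y. poly p y * exp (- y))"
    by (simp add: fun_eq_iff poly_altdef sum_divide_distrib exp_minus divide_inverse sum_distrib_right mult.assoc)
  ultimately show ?thesis by simp
qed

lemma flat_poly_exp_deriv:
  "(flat_poly_exp p has_real_derivative flat_poly_exp ([:0,0,1:] * (p - pderiv p)) x) (at x)"
proof -
  consider "x > 0" | "x < 0" | "x = 0" by linarith
  thus ?thesis
  proof cases
    case 1
    have "((\<lambda>x. poly p (inverse x) * exp (- inverse x)) has_real_derivative
        flat_poly_exp ([:0,0,1:] * (p - pderiv p)) x) (at x)"
      using 1
      by (auto intro!: derivative_eq_intros DERIV_chain2[OF poly_DERIV]
          simp: flat_poly_exp_def power2_eq_square algebra_simps)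
    thus ?thesis
      by (rule has_field_derivative_transform_within_open[where S = "{0<..}"])
        (use 1 in \<open>auto simp: flat_poly_exp_def\<close>)
  next
    case 2
    have "((\<lambda>x. 0) has_real_derivative flat_poly_exp ([:0,0,1:] * (p - pderiv p)) x) (at x)"
      using 2 by (auto simp: flat_poly_exp_def)
    thus ?thesis
      by (rule has_field_derivative_transform_within_open[where S = "{..<0}"])
        (use 2 in \<open>auto simp: flat_poly_exp_def\<close>)
  next
    case 3
    have "((\<lambda>h. flat_poly_exp p h / h) \<longlongrightarrow> 0) (at 0)"
    proof (rule filterlim_split_at_real)
      show "((\<lambda>h. flat_poly_exp p h / h) \<longlongrightarrow> 0) (at_left 0)"
        by (rule tendsto_eventually)
          (auto simp: flat_poly_exp_def eventually_at_left_field intro!: exI[of _ "-1"])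
      have "((\<lambda>h. poly ([:0,1:] * p) (inverse h) * exp (- inverse h)) \<longlongrightarrow> 0) (at_right (0::real))"
        by (rule filterlim_compose[OF poly_times_exp_minus_at_top filterlim_inverse_at_top_right])
      moreover have "\<forall>\<^sub>F h in at_right 0. poly ([:0,1:] * p) (inverse h) * exp (- inverse h)
          = flat_poly_exp p h / h"
        by (auto simp: flat_poly_exp_def eventually_at_right_field field_simps intro!: exI[of _ 1])
      ultimately show "((\<lambda>h. flat_poly_exp p h / h) \<longlongrightarrow> 0) (at_right 0)"
        by (rule Lim_transform_eventually)
    qed
    thus ?thesis using 3 by (simp add: DERIV_def flat_poly_exp_def)
  qed
qed

lemma n_times_diff_flat: "n_times_diff n (flat_poly_exp p)"
proof (induction n arbitrary: p)
  case (Suc n)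
  thus ?case using flat_poly_exp_deriv[of p]
    by (auto intro!: exI[of _ "flat_poly_exp ([:0,0,1:] * (p - pderiv p))"] simp del: mult_pCons_left)
qed simp

text \<open>
  A nonnegative smooth kernel of total mass one with support in \<open>[-\<epsilon>, \<epsilon>]\<close>, given together with all
  its derivatives \<open>k n\<close>, to match the format of the jets of test functions.
\<close>

definition mollifier :: "real \<Rightarrow> (nat \<Rightarrow> real \<Rightarrow> real) \<Rightarrow> bool" where
  "mollifier \<epsilon> k \<longleftrightarrow>
     (\<forall>n t. (k n has_real_derivative k (Suc n) t) (at t)) \<and>
     (\<forall>t. 0 \<le> k 0 t) \<and>
     (\<forall>n t. \<epsilon> < \<bar>t\<bar> \<longrightarrow> k n t = 0) \<and>
     (LINT t|lborel. k 0 t) = 1"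

lemma derivs_vanish_outside:
  fixes k :: "nat \<Rightarrow> real \<Rightarrow> real"
  assumes "\<And>n t. (k n has_real_derivative k (Suc n) t) (at t)" "open S" "\<And>t. t \<in> S \<Longrightarrow> k 0 t = 0" "t \<in> S"
  shows "k n t = 0"
  using assms(4)
proof (induction n arbitrary: t)
  case (Suc n)
  have "(k n has_real_derivative 0) (at t)"
    by (rule has_field_derivative_transform_within_open[OF DERIV_const[of 0] assms(2) Suc.prems])
      (use Suc.IH in auto)
  thus ?case using DERIV_unique assms(1) by blast
qed (use assms in auto)

lemma integrable_compact_support:
  fixes h :: "'a::euclidean_space \<Rightarrow> real"
  assumes "continuous_on UNIV h" "compact K" "\<And>z. z \<notin> K \<Longrightarrow> h z = 0"
  shows "integrable lborel h"
proof -
  have "integrable lborel (\<lambda>z. indicator K z *\<^sub>R h z)"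
    by (rule borel_integrable_compact[OF assms(2)]) (use assms(1) continuous_on_subset in blast)
  moreover have "(\<lambda>z. indicator K z *\<^sub>R h z) = h"
    using assms(3) by (auto simp: indicator_def fun_eq_iff)
  ultimately show ?thesis by simp
qed

text \<open>
  The product of two reflected copies of the flat exponential is a bump on \<open>[-\<epsilon>, \<epsilon>]\<close>; it remains to
  normalise its mass.
\<close>

lemma mollifier_exists:
  assumes "0 < \<epsilon>"
  shows "\<exists>k. mollifier \<epsilon> k"
proof -
  define b where "b = (\<lambda>t. flat_poly_exp 1 (1 * t + \<epsilon>) * flat_poly_exp 1 ((-1) * t + \<epsilon>))"
  have b_smooth: "n_times_diff n b" for n
    unfolding b_def
    using n_times_diff_mult[OF n_times_diff_affine[OF n_times_diff_flat, where c = 1]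
        n_times_diff_affine[OF n_times_diff_flat, where c = 1], of n 1 1 \<epsilon> 1 "-1" \<epsilon>]
    by simp
  have b0: "b t = 0" if "\<epsilon> \<le> \<bar>t\<bar>" for t
    using that by (auto simp: b_def flat_poly_exp_def)
  have b_nonneg: "0 \<le> b t" for t by (auto simp: b_def flat_poly_exp_def)
  have b_pos: "0 < b t" if "\<bar>t\<bar> < \<epsilon>" for t using that by (auto simp: b_def flat_poly_exp_def)
  have "\<exists>b'. \<forall>t. (b has_real_derivative b' t) (at t)" using b_smooth[of "Suc 0"] by auto
  hence b_cont: "continuous_on UNIV b"
    by (auto simp: continuous_on_eq_continuous_at intro: DERIV_isCont)
  have b_int: "integrable lborel b"
    by (rule integrable_compact_support[OF b_cont, of "{-\<epsilon>..\<epsilon>}"]) (use b0 in auto)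
  define c where "c = (LINT t|lborel. b t)"
  have "c \<noteq> 0"
  proof
    assume "c = 0"
    hence "AE t in lborel. b t = 0"
      using integral_nonneg_eq_0_iff_AE[OF b_int] b_nonneg by (auto simp: c_def)
    hence "emeasure lborel {t. b t \<noteq> 0} = 0"
      using b_cont borel_measurable_continuous_onI[OF b_cont]
      by (subst (asm) AE_iff_measurable[OF _ refl]) auto
    moreover have "emeasure lborel {-\<epsilon><..<\<epsilon>} \<le> emeasure lborel {t. b t \<noteq> 0}"
    proof (rule emeasure_mono)
      have "b t \<noteq> 0" if "\<bar>t\<bar> < \<epsilon>" for t using b_pos[OF that] by simp
      thus "{-\<epsilon><..<\<epsilon>} \<subseteq> {t. b t \<noteq> 0}" by (auto simp: abs_less_iff)
      have [measurable]: "b \<in> borel_measurable borel"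
        by (rule borel_measurable_continuous_onI[OF b_cont])
      show "{t. b t \<noteq> 0} \<in> sets lborel" by measurable
    qed
    ultimately show False using assms by simp
  qed
  moreover have "0 \<le> c" unfolding c_def using b_nonneg by simp
  ultimately have c: "0 < c" by simp
  define k0 where "k0 = (\<lambda>t. inverse c * b (1 * t + 0))"
  have k0_smooth: "\<And>n. n_times_diff n k0"
    unfolding k0_def using n_times_diff_affine[OF b_smooth] by blast
  define k where "k = (\<lambda>n. (deriv ^^ n) k0)"
  have kd: "(k n has_real_derivative k (Suc n) t) (at t)" for n t
    unfolding k_def by (rule smooth_iterated_deriv[OF k0_smooth])
  have "mollifier \<epsilon> k"
    unfolding mollifier_def
  proof (intro conjI allI impI)
    fix n t assume t: "\<epsilon> < \<bar>t\<bar>"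
    have "open {t :: real. \<epsilon> < \<bar>t\<bar>}" by (intro open_Collect_less continuous_intros)
    from derivs_vanish_outside[of k, OF kd this, of t n] t show "k n t = 0"
      by (auto simp: k_def k0_def b0)
  qed (use kd c in \<open>auto simp: k_def k0_def b_nonneg c_def[symmetric]\<close>)
  thus ?thesis by blast
qed

lemma mollifierD:
  assumes "mollifier \<epsilon> k"
  shows mollifier_deriv: "(k n has_real_derivative k (Suc n) t) (at t)"
    and mollifier_nonneg: "0 \<le> k 0 t"
    and mollifier_zero: "\<epsilon> < \<bar>t\<bar> \<Longrightarrow> k n t = 0"
    and mollifier_integral: "(LINT t|lborel. k 0 t) = 1"
    and mollifier_continuous: "continuous_on UNIV (k n)"
  using assms unfolding mollifier_def
  by (auto simp: continuous_on_eq_continuous_at intro: DERIV_isCont)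

lemma mollifier_deriv_minus:
  assumes "mollifier \<epsilon> k"
  shows "((\<lambda>x. k n (y - x)) has_real_derivative - k (Suc n) (y - x)) (at x)"
proof -
  have "((\<lambda>x. y - x) has_real_derivative -1) (at x)" by (auto intro!: derivative_eq_intros)
  from DERIV_chain2[OF mollifier_deriv[OF assms, of n "y - x"] this] show ?thesis by simp
qed

lemma mollifier_bounded:
  assumes "mollifier \<epsilon> k"
  shows "\<exists>C. \<forall>t. \<bar>k n t\<bar> \<le> C"
proof -
  have "bounded (k n ` {-\<epsilon>..\<epsilon>})"
    by (intro compact_imp_bounded compact_continuous_image)
      (auto intro: continuous_on_subset[OF mollifier_continuous[OF assms]])
  then obtain C where "\<And>t. t \<in> {-\<epsilon>..\<epsilon>} \<Longrightarrow> \<bar>k n t\<bar> \<le> C"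
    unfolding bounded_iff by (auto simp del: atLeastAtMost_iff)
  hence "\<bar>k n t\<bar> \<le> max 0 C" for t
  proof (cases "\<epsilon> < \<bar>t\<bar>")
    case False
    hence "\<bar>k n t\<bar> \<le> C" using \<open>\<And>t. t \<in> {-\<epsilon>..\<epsilon>} \<Longrightarrow> \<bar>k n t\<bar> \<le> C\<close>[of t] False
      by (auto simp: not_less abs_le_iff minus_le_iff)
    thus ?thesis by simp
  qed (simp add: mollifier_zero[OF assms])
  thus ?thesis by blast
qed

section \<open>Jets of test functions\<close>

text \<open>
  The complement of a closed set is open along each axis, so derivatives inherit zeros there; first
  along the first variable for \<open>D i 0\<close>, then along the second.
\<close>

lemma jet_vanish:
  assumes D: "smooth_jet D" and K: "closed K" "\<And>z. z \<notin> K \<Longrightarrow> D 0 0 z = 0" and z: "z \<notin> K"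
  shows "D i j z = 0"
proof -
  have op: "open {x. (u, x) \<notin> K}" "open {v. (v, x) \<notin> K}" for u x
  proof -
    have "open (Pair u -` (- K))" "open ((\<lambda>v. (v, x)) -` (- K))"
      using K(1) by (auto intro!: open_vimage continuous_intros)
    thus "open {x. (u, x) \<notin> K}" "open {v. (v, x) \<notin> K}" by (auto simp: vimage_def)
  qed
  have row: "D i 0 (u, x) = 0" if "(u, x) \<notin> K" for u x
    by (rule derivs_vanish_outside[of "\<lambda>i v. D i 0 (v, x)", OF _ op(2)])
      (use D K(2) that in \<open>auto simp: smooth_jet_def\<close>)
  obtain u x where ux: "z = (u, x)" by (cases z)
  have "D i j (u, x) = 0"
    by (rule derivs_vanish_outside[of "\<lambda>j y. D i j (u, y)", OF _ op(1)])
      (use D z ux row in \<open>auto simp: smooth_jet_def\<close>)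
  thus ?thesis using ux by simp
qed

definition product_jet :: "(nat \<Rightarrow> real \<Rightarrow> real) \<Rightarrow> real \<Rightarrow> real \<Rightarrow> nat \<Rightarrow> nat \<Rightarrow> real \<times> real \<Rightarrow> real" where
  "product_jet k u x i j z = k i (fst z - u) * k j (snd z - x)"

lemma product_jet_zero:
  assumes "mollifier \<epsilon> k" "z \<notin> {u-\<epsilon>..u+\<epsilon>} \<times> {x-\<epsilon>..x+\<epsilon>}"
  shows "product_jet k u x i j z = 0"
proof -
  have "\<epsilon> < \<bar>fst z - u\<bar> \<or> \<epsilon> < \<bar>snd z - x\<bar>" using assms(2) by (cases z) auto
  thus ?thesis using mollifier_zero[OF assms(1)] by (auto simp: product_jet_def)
qed

lemma product_jet_continuous:
  assumes "mollifier \<epsilon> k"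
  shows "continuous_on UNIV (product_jet k u x i j)"
  unfolding product_jet_def
  by (intro continuous_intros continuous_on_compose2[OF mollifier_continuous[OF assms]]) auto

lemma test_jet_product_jet:
  assumes k: "mollifier \<epsilon> k" and u: "\<epsilon> < u" "u < 1 - \<epsilon>"
  shows "test_jet {0<..<1} (product_jet k u x)" "test_jet {0<..} (product_jet k u x)"
proof -
  have "((\<lambda>v. k i (v - u)) has_real_derivative k (Suc i) (v - u)) (at v)" for i u v
    using mollifier_deriv[OF k, of i "v - u"] DERIV_shift[of "k i" _ v "- u"] by simp
  hence sm: "smooth_jet (product_jet k u x)"
    unfolding smooth_jet_def
    using product_jet_continuous[OF k, of u x]
    by (auto simp: product_jet_def intro!: DERIV_cmult DERIV_cmult_right)
  let ?K = "{u-\<epsilon>..u+\<epsilon>} \<times> {x-\<epsilon>..x+\<epsilon>}"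
  have "compact ?K" "?K \<subseteq> {0<..<1} \<times> UNIV" "?K \<subseteq> {0<..} \<times> UNIV"
    using u by (auto intro!: compact_Times)
  with sm product_jet_zero[OF k]
  show "test_jet {0<..<1} (product_jet k u x)" "test_jet {0<..} (product_jet k u x)"
    unfolding test_jet_def by meson+
qed

section \<open>Mollification\<close>

text \<open>
  \<open>mollify k f i j u x\<close> integrates \<open>f\<close> against the derivative of order \<open>(i, j)\<close> of the kernel centred
  at \<open>(u, x)\<close>. Differentiating in the centre costs a sign for each order, so the mollified
  function \<open>mollify k f 0 0\<close> has the partial derivatives \<open>(-1)\<^sup>i\<^sup>+\<^sup>j mollify k f i j\<close>.
\<close>

definition mollify ::
  "(nat \<Rightarrow> real \<Rightarrow> real) \<Rightarrow> (real \<times> real \<Rightarrow> real) \<Rightarrow> nat \<Rightarrow> nat \<Rightarrow> real \<Rightarrow> real \<Rightarrow> real" where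
  "mollify k f i j u x = (LINT z|lborel. f z * product_jet k u x i j z)"

lemma mollify_integrable:
  assumes k: "mollifier \<epsilon> k" and f: "continuous_on UNIV f"
  shows "integrable lborel (\<lambda>z. f z * product_jet k u x i j z)"
  by (rule integrable_compact_support[of _ "{u-\<epsilon>..u+\<epsilon>} \<times> {x-\<epsilon>..x+\<epsilon>}"])
    (auto intro!: continuous_intros f product_jet_continuous[OF k] compact_Times
      product_jet_zero[OF k, unfolded mem_Times_iff])

lemma product_jet_dominated:
  assumes k: "mollifier \<epsilon> k" and f: "continuous_on UNIV (f :: real \<times> real \<Rightarrow> real)"
  shows "\<exists>w. integrable lborel w \<and>
    (\<forall>u x z. \<bar>u\<bar> \<le> r \<longrightarrow> \<bar>x\<bar> \<le> r \<longrightarrow> \<bar>f z * product_jet k u x i j z\<bar> \<le> w z)"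
proof -
  obtain Ci where Ci: "\<And>t. \<bar>k i t\<bar> \<le> Ci" using mollifier_bounded[OF k] by blast
  obtain Cj where Cj: "\<And>t. \<bar>k j t\<bar> \<le> Cj" using mollifier_bounded[OF k] by blast
  have C0: "0 \<le> Ci" using Ci[of 0] by linarith
  let ?K = "{-(r+\<epsilon>)..r+\<epsilon>} \<times> {-(r+\<epsilon>)..r+\<epsilon>}"
  define w where "w = (\<lambda>z. indicator ?K z *\<^sub>R (\<bar>f z\<bar> * (Ci * Cj)))"
  have "integrable lborel w"
    unfolding w_def
    by (intro borel_integrable_compact compact_Times continuous_intros continuous_on_subset[OF f]) auto
  moreover have "\<bar>f z * product_jet k u x i j z\<bar> \<le> w z" if "\<bar>u\<bar> \<le> r" "\<bar>x\<bar> \<le> r" for u x z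
  proof (cases "z \<in> ?K")
    case True
    have "\<bar>k i (fst z - u) * k j (snd z - x)\<bar> \<le> Ci * Cj"
      unfolding abs_mult using Ci Cj C0 by (intro mult_mono) auto
    thus ?thesis using True by (simp add: w_def product_jet_def abs_mult mult_left_mono)
  next
    case False
    hence "z \<notin> {u-\<epsilon>..u+\<epsilon>} \<times> {x-\<epsilon>..x+\<epsilon>}" using that by auto
    from product_jet_zero[OF k this] show ?thesis using False by (simp add: w_def)
  qed
  ultimately show ?thesis by blast
qed

lemma mollify_dx:
  assumes k: "mollifier \<epsilon> k" and f: "continuous_on UNIV f"
  shows "(mollify k f i j u has_real_derivative - mollify k f i (Suc j) u x) (at x)"
proof -
  have "((\<lambda>x. LINT z|lborel. f z * product_jet k u x i j z) has_real_derivative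
      (LINT z|lborel. - (f z * product_jet k u x i (Suc j) z))) (at x)"
  proof (rule has_real_derivative_integral[OF mollify_integrable[OF k f]])
    show "((\<lambda>x. f z * product_jet k u x i j z) has_real_derivative
        - (f z * product_jet k u x i (Suc j) z)) (at x)" for x z
      using mollifier_deriv_minus[OF k, of j "snd z" x, THEN DERIV_cmult, of "f z * k i (fst z - u)"]
      by (simp add: product_jet_def mult_ac)
    show "\<exists>w. integrable lborel w \<and>
        (\<forall>x z. \<bar>x\<bar> \<le> r \<longrightarrow> \<bar>- (f z * product_jet k u x i (Suc j) z)\<bar> \<le> w z)" for r
    proof -
      obtain w where "integrable lborel w" "\<And>u' x z. \<bar>u'\<bar> \<le> max r \<bar>u\<bar> \<Longrightarrow> \<bar>x\<bar> \<le> max r \<bar>u\<bar> \<Longrightarrow>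
          \<bar>f z * product_jet k u' x i (Suc j) z\<bar> \<le> w z"
        using product_jet_dominated[OF k f, of "max r \<bar>u\<bar>" i "Suc j"] by blast
      thus ?thesis by (intro exI[of _ w]) auto
    qed
  qed (use mollify_integrable[OF k f] in auto)
  thus ?thesis by (simp add: mollify_def[abs_def])
qed

lemma mollify_du:
  assumes k: "mollifier \<epsilon> k" and f: "continuous_on UNIV f"
  shows "((\<lambda>u. mollify k f i j u x) has_real_derivative - mollify k f (Suc i) j u x) (at u)"
proof -
  have "((\<lambda>u. LINT z|lborel. f z * product_jet k u x i j z) has_real_derivative
      (LINT z|lborel. - (f z * product_jet k u x (Suc i) j z))) (at u)"
  proof (rule has_real_derivative_integral[OF mollify_integrable[OF k f]])
    show "((\<lambda>u. f z * product_jet k u x i j z) has_real_derivative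
        - (f z * product_jet k u x (Suc i) j z)) (at u)" for u z
      using mollifier_deriv_minus[OF k, of i "fst z" u, THEN DERIV_cmult, of "f z * k j (snd z - x)"]
      by (simp add: product_jet_def mult_ac)
    show "\<exists>w. integrable lborel w \<and>
        (\<forall>u z. \<bar>u\<bar> \<le> r \<longrightarrow> \<bar>- (f z * product_jet k u x (Suc i) j z)\<bar> \<le> w z)" for r
    proof -
      obtain w where "integrable lborel w" "\<And>u x' z. \<bar>u\<bar> \<le> max r \<bar>x\<bar> \<Longrightarrow> \<bar>x'\<bar> \<le> max r \<bar>x\<bar> \<Longrightarrow>
          \<bar>f z * product_jet k u x' (Suc i) j z\<bar> \<le> w z"
        using product_jet_dominated[OF k f, of "max r \<bar>x\<bar>" "Suc i" j] by blast
      thus ?thesis by (intro exI[of _ w]) auto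
    qed
  qed (use mollify_integrable[OF k f] in auto)
  thus ?thesis by (simp add: mollify_def[abs_def])
qed

lemma mollify_continuous:
  assumes k: "mollifier \<epsilon> k" and f: "continuous_on UNIV f"
  shows "continuous_on UNIV (\<lambda>p. mollify k f i j (fst p) (snd p))"
proof (rule continuous_on_sequentiallyI)
  fix p :: "nat \<Rightarrow> real \<times> real" and a
  assume p: "p \<longlonglongrightarrow> a"
  obtain r where r: "\<And>n. norm (p n) \<le> r"
    using convergent_imp_Bseq[OF convergentI[OF p]] by (auto simp: Bseq_def)
  obtain w where w: "integrable lborel w" "\<And>u x z. \<bar>u\<bar> \<le> r \<Longrightarrow> \<bar>x\<bar> \<le> r \<Longrightarrow>
      \<bar>f z * product_jet k u x i j z\<bar> \<le> w z"
    using product_jet_dominated[OF k f] by blast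
  have pr: "\<bar>fst (p n)\<bar> \<le> r" "\<bar>snd (p n)\<bar> \<le> r" for n
    using norm_fst_le[of "fst (p n)" "snd (p n)"] norm_snd_le[of "snd (p n)" "fst (p n)"] r[of n]
    by auto
  show "(\<lambda>n. mollify k f i j (fst (p n)) (snd (p n))) \<longlonglongrightarrow> mollify k f i j (fst a) (snd a)"
    unfolding mollify_def
  proof (rule integral_dominated_convergence[where w = w])
    have "isCont (k i) t" for i t
      using mollifier_continuous[OF k] by (auto simp: continuous_on_eq_continuous_at)
    hence *: "(\<lambda>n. k i (c - q n)) \<longlonglongrightarrow> k i (c - b)" if "q \<longlonglongrightarrow> b" for i c b q
      by (rule isCont_tendsto_compose) (intro tendsto_diff tendsto_const that)
    show "AE z in lborel. (\<lambda>n. f z * product_jet k (fst (p n)) (snd (p n)) i j z) \<longlonglongrightarrow>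
        f z * product_jet k (fst a) (snd a) i j z"
      unfolding product_jet_def
      by (intro AE_I2 tendsto_mult tendsto_const * tendsto_fst tendsto_snd p)
    show "AE z in lborel. norm (f z * product_jet k (fst (p n)) (snd (p n)) i j z) \<le> w z" for n
      using w(2) pr by auto
  qed (use mollify_integrable[OF k f] w in auto)
qed

lemma product_jet_integral:
  assumes k: "mollifier \<epsilon> k"
  shows "(LINT z|lborel. product_jet k u x 0 0 z) = 1"
proof -
  have i: "integrable lborel (\<lambda>z. product_jet k u x 0 0 z)"
    using mollify_integrable[OF k, of "\<lambda>_. 1" u x 0 0] by simp
  have s: "(LINT t|lborel. k 0 (t - u)) = 1" for u
    using lborel_integral_real_affine[of 1 "\<lambda>t. k 0 t" "-u"] mollifier_integral[OF k]
    by simp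
  have "(LINT z|lborel. product_jet k u x 0 0 z) =
      (LINT z|(lborel \<Otimes>\<^sub>M lborel). product_jet k u x 0 0 z)"
    by (simp add: lborel_prod)
  also have "\<dots> = (LINT v|lborel. LINT y|lborel. product_jet k u x 0 0 (v, y))"
    using i by (subst lborel_pair.integral_fst') (auto simp: lborel_prod)
  also have "\<dots> = 1" by (simp add: product_jet_def s)
  finally show ?thesis .
qed

lemma product_jet_nonneg: "mollifier \<epsilon> k \<Longrightarrow> 0 \<le> product_jet k u x 0 0 z"
  unfolding product_jet_def by (simp add: mollifier_nonneg)

lemma mollify_close:
  assumes k: "mollifier \<epsilon> k" and f: "continuous_on UNIV f"
    and close: "\<And>v y. \<bar>v - u\<bar> \<le> \<epsilon> \<Longrightarrow> \<bar>y - x\<bar> \<le> \<epsilon> \<Longrightarrow> \<bar>f (v, y) - c\<bar> \<le> \<eta>"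
  shows "\<bar>mollify k f 0 0 u x - c\<bar> \<le> \<eta>"
proof -
  let ?p = "product_jet k u x 0 0"
  have ip: "integrable lborel ?p" using mollify_integrable[OF k, of "\<lambda>_. 1" u x 0 0] by simp
  have ifp: "integrable lborel (\<lambda>z. f z * ?p z)" by (rule mollify_integrable[OF k f])
  have "mollify k f 0 0 u x - c = (LINT z|lborel. f z * ?p z - c * ?p z)"
    using ip ifp by (simp add: mollify_def product_jet_integral[OF k])
  also have "\<bar>\<dots>\<bar> \<le> (LINT z|lborel. \<bar>f z * ?p z - c * ?p z\<bar>)"
    by (rule integral_abs_bound)
  also have "\<dots> \<le> (LINT z|lborel. \<eta> * ?p z)"
  proof (rule integral_mono)
    show "\<bar>f z * ?p z - c * ?p z\<bar> \<le> \<eta> * ?p z" for z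
    proof (cases "z \<in> {u-\<epsilon>..u+\<epsilon>} \<times> {x-\<epsilon>..x+\<epsilon>}")
      case True
      hence "\<bar>f z - c\<bar> \<le> \<eta>" using close[of "fst z" "snd z"] by (auto simp: abs_le_iff)
      thus ?thesis using product_jet_nonneg[OF k, of u x z]
        by (simp add: left_diff_distrib[symmetric] abs_mult mult_right_mono)
    next
      case False
      thus ?thesis using product_jet_zero[OF k] by simp
    qed
  qed (use ip ifp in auto)
  also have "\<dots> = \<eta>" by (simp add: product_jet_integral[OF k])
  finally show ?thesis .
qed

section \<open>A maximum principle\<close>

text \<open>
  Suppose the supremum exceeds \<open>m\<close>. By the conditions at \<open>u = b\<close> and for large \<open>\<bar>x\<bar>\<close> it is attained at
  a point with \<open>u < b\<close>. There the spatial gradient vanishes, the second derivative is not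
  positive, and by maximality the right derivative in \<open>u\<close> is not positive either, against the last
  hypothesis on the derivatives. Time runs backwards, from the terminal value at \<open>b\<close>, and only right
  derivatives are required because \<open>\<alpha>\<close> is only right-continuous.
\<close>

lemma parabolic_maximum_principle:
  fixes W Wx Wxx Wu :: "real \<Rightarrow> real \<Rightarrow> real"
  assumes cont: "continuous_on ({a..b} \<times> UNIV) (\<lambda>z. W (fst z) (snd z))"
    and top: "\<And>x. W b x \<le> m"
    and far: "\<And>u x. u \<in> {a..b} \<Longrightarrow> R \<le> \<bar>x\<bar> \<Longrightarrow> W u x \<le> m"
    and Wx: "\<And>u x. a \<le> u \<Longrightarrow> u < b \<Longrightarrow> (W u has_real_derivative Wx u x) (at x)"
    and Wxx: "\<And>u x. a \<le> u \<Longrightarrow> u < b \<Longrightarrow> (Wx u has_real_derivative Wxx u x) (at x)"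
    and Wu: "\<And>u x. a \<le> u \<Longrightarrow> u < b \<Longrightarrow> ((\<lambda>v. W v x) has_real_derivative Wu u x) (at_right u)"
    and strict: "\<And>u x. a \<le> u \<Longrightarrow> u < b \<Longrightarrow> Wx u x = 0 \<Longrightarrow> Wxx u x \<le> 0 \<Longrightarrow> 0 < Wu u x"
    and u: "u \<in> {a..b}"
  shows "W u x \<le> m"
proof (rule ccontr)
  assume "\<not> W u x \<le> m"
  hence gt: "m < W u x" by simp
  let ?K = "{a..b} \<times> {-R..R}"
  have "(u, x) \<in> ?K" using far[OF u, of x] gt u by (cases "R \<le> \<bar>x\<bar>") auto
  moreover have "compact ?K" by (intro compact_Times) auto
  moreover have "continuous_on ?K (\<lambda>z. W (fst z) (snd z))"
    by (rule continuous_on_subset[OF cont]) auto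
  ultimately obtain z where z: "z \<in> ?K" "\<And>y. y \<in> ?K \<Longrightarrow> W (fst y) (snd y) \<le> W (fst z) (snd z)"
    using continuous_attains_sup[of ?K "\<lambda>z. W (fst z) (snd z)"] by blast
  obtain v y where vy: "z = (v, y)" by (cases z)
  have v: "v \<in> {a..b}" using z(1) vy by auto
  have max: "W v' y' \<le> W v y" if "v' \<in> {a..b}" "y' \<in> {-R..R}" for v' y'
    using z(2)[of "(v', y')"] that vy by simp
  have gt': "m < W v y" using gt max[of u x] \<open>(u, x) \<in> ?K\<close> by auto
  have "v \<noteq> b" using gt' top[of y] by auto
  hence vb: "a \<le> v" "v < b" using v by auto
  have max': "W v y' \<le> W v y" for y'
  proof (cases "R \<le> \<bar>y'\<bar>")
    case True thus ?thesis using far[OF v True] gt' by simp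
  next
    case False thus ?thesis using max[OF v, of y'] by (auto simp: not_le abs_less_iff minus_less_iff)
  qed
  have dx: "Wx v y = 0"
    by (rule DERIV_local_max[OF Wx[OF vb], of 1]) (use max' in auto)
  have "Wxx v y \<le> 0"
  proof (rule ccontr)
    assume "\<not> Wxx v y \<le> 0"
    with DERIV_pos_inc_right[OF Wxx[OF vb, of y]] obtain d where
      d: "d > 0" "\<And>h. h > 0 \<Longrightarrow> h < d \<Longrightarrow> Wx v y < Wx v (y + h)" by auto
    obtain t where t: "y < t" "t < y + d/2" "W v (y + d/2) - W v y = (y + d/2 - y) * Wx v t"
      using MVT2[of y "y + d/2" "W v" "Wx v"] Wx[OF vb] d(1) by auto
    have "0 < Wx v t" using d(2)[of "t - y"] t d(1) dx by auto
    hence "0 < (y + d/2 - y) * Wx v t" using d(1) by (intro mult_pos_pos) auto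
    hence "0 < W v (y + d/2) - W v y" unfolding t(3) .
    thus False using max'[of "y + d/2"] by simp
  qed
  from strict[OF vb dx this] have "0 < Wu v y" .
  from has_real_derivative_pos_inc_right[OF Wu[OF vb, of y] this] obtain d where
    d: "d > 0" "\<And>h. h > 0 \<Longrightarrow> v + h \<in> {v<..} \<Longrightarrow> h < d \<Longrightarrow> W v y < W (v + h) y" by blast
  define h where "h = min (d/2) (b - v)"
  have "h > 0" "h < d" "v + h \<le> b" using d(1) vb by (auto simp: h_def)
  hence "W v y < W (v + h) y" using d(2) by auto
  moreover have "W (v + h) y \<le> W v y"
    using max[of "v + h" y] z(1) vy \<open>h > 0\<close> \<open>v + h \<le> b\<close> vb by auto
  ultimately show False by simp
qed

section \<open>Mollified weak solutions are supersolutions\<close>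

text \<open>
  The data of the problem are only controlled for \<open>u \<in> [0,1]\<close>. Composing with the projection to
  \<open>[0,1]\<close> extends \<open>f\<close> continuously and \<open>\<alpha>\<close> monotonically, hence measurably, to the whole line.
\<close>

definition clamp_unit :: "real \<Rightarrow> real" where
  "clamp_unit u = max 0 (min 1 u)"

lemma clamp_unit_bounds: "0 \<le> clamp_unit u" "clamp_unit u \<le> 1"
  by (auto simp: clamp_unit_def)

lemma clamp_unit_id: "u \<in> {0..1} \<Longrightarrow> clamp_unit u = u"
  by (auto simp: clamp_unit_def)

lemma clamp_unit_mono: "u \<le> v \<Longrightarrow> clamp_unit u \<le> clamp_unit v"
  by (auto simp: clamp_unit_def)

lemma clamped_cdf_measurable:
  assumes "cdf_unit_interval \<alpha>"
  shows "(\<lambda>u. \<alpha> (clamp_unit u)) \<in> borel_measurable borel"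
proof (rule borel_measurable_mono, rule monoI)
  fix u v :: real assume "u \<le> v"
  thus "\<alpha> (clamp_unit u) \<le> \<alpha> (clamp_unit v)"
    using assms clamp_unit_bounds clamp_unit_mono
    unfolding cdf_unit_interval_def mono_on_def by auto
qed

text \<open>
  Testing the weak equation with the kernel centred at \<open>(u, x)\<close>, which is supported inside the open
  strip, expresses \<open>mollify k F 1 0\<close>, the negative time derivative of the mollified solution, through
  \<open>mollify k F 0 2\<close> and the kernel average of \<open>\<alpha> g\<^sup>2\<close>. On the support of the kernel,
  \<open>\<alpha> \<ge> \<alpha>(u - \<epsilon>)\<close> and \<open>g\<^sup>2 \<ge> 2 c g - c\<^sup>2\<close>, and the average of \<open>g\<close> is the gradient of the mollified
  solution. The free constant \<open>c\<close> allows linearising at the gradient of a subsolution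
  later. The bound on \<open>g\<close> gives the uniform Lipschitz bound.
\<close>

lemma parisi_solution_mollified:
  assumes sol: "parisi_solution \<alpha> \<beta> f" and cdf: "cdf_unit_interval \<alpha>"
  obtains F B where "continuous_on UNIV F" "\<And>u x. u \<in> {0..1} \<Longrightarrow> F (u, x) = f (u, x)"
    "\<And>\<epsilon> k u x c. mollifier \<epsilon> k \<Longrightarrow> 0 < \<epsilon> \<Longrightarrow> \<epsilon> < u \<Longrightarrow> u < 1 - \<epsilon> \<Longrightarrow>
      \<beta>\<^sup>2 * (mollify k F 0 2 u x + \<alpha> (u - \<epsilon>) * (2 * c * (- mollify k F 0 1 u x) - c\<^sup>2))
        \<le> mollify k F 1 0 u x"
    "\<And>\<epsilon> k u x. mollifier \<epsilon> k \<Longrightarrow> 0 < \<epsilon> \<Longrightarrow> \<epsilon> < u \<Longrightarrow> u < 1 - \<epsilon> \<Longrightarrow>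
      \<bar>mollify k F 0 1 u x\<bar> \<le> B"
proof -
  from sol obtain g where contf: "continuous_on ({0..1} \<times> UNIV) f"
    and g: "bounded_weak_dx f g"
    and weak: "\<And>D. test_jet {0<..} D \<Longrightarrow>
         (LINT z:{0..1} \<times> UNIV|lborel.
            - f z * D 1 0 z
            + \<beta>\<^sup>2 * (f z * D 0 2 z + \<alpha> (fst z) * (g z)\<^sup>2 * D 0 0 z))
         + (LINT x|lborel. ln (cosh x) * D 0 0 (1, x)) = 0"
    unfolding parisi_solution_def by blast
  from g obtain B where [measurable]: "g \<in> borel_measurable borel"
    and B: "AE z in lborel. \<bar>g z\<bar> \<le> B"
    and wdx: "\<And>D. test_jet {0<..<1} D \<Longrightarrow>
       (LINT z:{0..1} \<times> UNIV|lborel. f z * D 0 1 z) =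
       - (LINT z:{0..1} \<times> UNIV|lborel. g z * D 0 0 z)"
    unfolding bounded_weak_dx_def by blast
  define F where "F = (\<lambda>z. f (clamp_unit (fst z), snd z))"
  have cF: "continuous_on UNIV F"
    unfolding F_def
    by (rule continuous_on_compose2[OF contf])
      (auto simp: clamp_unit_def intro!: continuous_intros)
  have Ff: "F (u, x) = f (u, x)" if "u \<in> {0..1}" for u x
    using that by (simp add: F_def clamp_unit_id)
  define a where "a = (\<lambda>z::real \<times> real. \<alpha> (clamp_unit (fst z)))"
  have a_meas[measurable]: "a \<in> borel_measurable borel"
    unfolding a_def
    by (rule measurable_compose[OF borel_measurable_continuous_onI clamped_cdf_measurable[OF cdf]])
      (intro continuous_intros)
  have a01: "0 \<le> a z" "a z \<le> 1" for z
    using cdf clamp_unit_bounds[of "fst z"] unfolding cdf_unit_interval_def a_def by auto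
  have key: "\<beta>\<^sup>2 * (mollify k F 0 2 u x + \<alpha> (u - \<epsilon>) * (2 * c * (- mollify k F 0 1 u x) - c\<^sup>2))
        \<le> mollify k F 1 0 u x \<and> \<bar>mollify k F 0 1 u x\<bar> \<le> B"
    if k: "mollifier \<epsilon> k" and e: "0 < \<epsilon>" "\<epsilon> < u" "u < 1 - \<epsilon>" for k \<epsilon> u x c
  proof -
    let ?D = "product_jet k u x"
    have D0: "?D i j z = 0" if "z \<notin> {u-\<epsilon>..u+\<epsilon>} \<times> {x-\<epsilon>..x+\<epsilon>}" for i j z
      by (rule product_jet_zero[OF k that])
    have strip: "indicator ({0..1} \<times> UNIV) z *\<^sub>R (p * ?D i j z) = p * ?D i j z" for p i j z
      using D0[of z i j] e by (cases "z \<in> {0..1} \<times> UNIV") (auto simp: mem_Times_iff)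
    have stripF: "f z * ?D i j z = F z * ?D i j z" for z i j
    proof (cases "z \<in> {0..1} \<times> UNIV")
      case True
      thus ?thesis using Ff[of "fst z" "snd z"] by (simp add: mem_Times_iff)
    next
      case False
      hence "?D i j z = 0" using e by (intro D0) (auto simp: mem_Times_iff)
      thus ?thesis by simp
    qed
    have stripa: "\<alpha> (fst z) * p * ?D 0 0 z = a z * p * ?D 0 0 z" for z p
    proof (cases "z \<in> {0..1} \<times> UNIV")
      case True
      thus ?thesis by (simp add: a_def clamp_unit_id mem_Times_iff)
    next
      case False
      hence "?D 0 0 z = 0" using e by (intro D0) (auto simp: mem_Times_iff)
      thus ?thesis by simp
    qed
    have Dnn: "0 \<le> ?D 0 0 z" for z by (rule product_jet_nonneg[OF k])
    have iD: "integrable lborel (?D 0 0)"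
      using mollify_integrable[OF k, of "\<lambda>_. 1" u x 0 0] by simp
    have mD[measurable]: "?D 0 0 \<in> borel_measurable borel"
      by (intro borel_measurable_continuous_onI product_jet_continuous[OF k])
    have igD: "integrable lborel (\<lambda>z. g z * ?D 0 0 z)"
    proof (rule Bochner_Integration.integrable_bound)
      show "integrable lborel (\<lambda>z. B * ?D 0 0 z)" using iD by simp
      show "AE z in lborel. norm (g z * ?D 0 0 z) \<le> norm (B * ?D 0 0 z)"
        using B
      proof eventually_elim
        case (elim z)
        hence "\<bar>g z\<bar> \<le> \<bar>B\<bar>" by linarith
        thus ?case by (simp add: abs_mult mult_right_mono)
      qed
    qed measurable
    have ig2D: "integrable lborel (\<lambda>z. a z * (g z)\<^sup>2 * ?D 0 0 z)"
    proof (rule Bochner_Integration.integrable_bound)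
      show "integrable lborel (\<lambda>z. B\<^sup>2 * ?D 0 0 z)" using iD by simp
      show "AE z in lborel. norm (a z * (g z)\<^sup>2 * ?D 0 0 z) \<le> norm (B\<^sup>2 * ?D 0 0 z)"
        using B
      proof eventually_elim
        case (elim z)
        hence "(g z)\<^sup>2 \<le> B\<^sup>2" by (metis abs_ge_zero power2_abs power_mono)
        hence "a z * (g z)\<^sup>2 \<le> 1 * B\<^sup>2" using a01[of z] by (intro mult_mono) auto
        thus ?case using a01[of z] Dnn[of z] by (simp add: abs_mult mult_right_mono)
      qed
    qed measurable
    have iF: "integrable lborel (\<lambda>z. F z * ?D i j z)" for i j
      by (rule mollify_integrable[OF k cF])
    have gD: "mollify k F 0 1 u x = - (LINT z|lborel. g z * ?D 0 0 z)"
      using wdx[OF test_jet_product_jet(1)[OF k e(2,3), of x]]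
      unfolding set_lebesgue_integral_def strip by (simp add: stripF mollify_def)
    have "(LINT z|lborel. - (F z * ?D 1 0 z) + (\<beta>\<^sup>2 * (F z * ?D 0 2 z) + \<beta>\<^sup>2 * (a z * (g z)\<^sup>2 * ?D 0 0 z))) = 0"
    proof -
      have "(LINT z:{0..1} \<times> UNIV|lborel.
            - f z * ?D 1 0 z + \<beta>\<^sup>2 * (f z * ?D 0 2 z + \<alpha> (fst z) * (g z)\<^sup>2 * ?D 0 0 z)) = 
         (LINT z|lborel. - (F z * ?D 1 0 z) + (\<beta>\<^sup>2 * (F z * ?D 0 2 z) + \<beta>\<^sup>2 * (a z * (g z)\<^sup>2 * ?D 0 0 z)))"
        unfolding set_lebesgue_integral_def
      proof (rule Bochner_Integration.integral_cong)
        fix z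
        have "indicator ({0..1} \<times> UNIV) z *\<^sub>R (- f z * ?D 1 0 z + \<beta>\<^sup>2 * (f z * ?D 0 2 z + \<alpha> (fst z) * (g z)\<^sup>2 * ?D 0 0 z))
          = indicator ({0..1} \<times> UNIV) z *\<^sub>R ((- f z) * ?D 1 0 z)
          + indicator ({0..1} \<times> UNIV) z *\<^sub>R ((\<beta>\<^sup>2 * f z) * ?D 0 2 z)
          + indicator ({0..1} \<times> UNIV) z *\<^sub>R ((\<beta>\<^sup>2 * \<alpha> (fst z) * (g z)\<^sup>2) * ?D 0 0 z)"
          by (simp add: algebra_simps)
        also have "\<dots> = - (f z * ?D 1 0 z) + (\<beta>\<^sup>2 * (f z * ?D 0 2 z) + \<beta>\<^sup>2 * (\<alpha> (fst z) * (g z)\<^sup>2 * ?D 0 0 z))"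
          unfolding strip by (simp add: algebra_simps)
        finally show "indicator ({0..1} \<times> UNIV) z *\<^sub>R (- f z * ?D 1 0 z + \<beta>\<^sup>2 * (f z * ?D 0 2 z + \<alpha> (fst z) * (g z)\<^sup>2 * ?D 0 0 z))
          = - (F z * ?D 1 0 z) + (\<beta>\<^sup>2 * (F z * ?D 0 2 z) + \<beta>\<^sup>2 * (a z * (g z)\<^sup>2 * ?D 0 0 z))"
          unfolding stripF stripa .
      qed simp
      moreover have "?D 0 0 (1, y) = 0" for y using e by (intro D0) auto
      ultimately show ?thesis using weak[OF test_jet_product_jet(2)[OF k e(2,3), of x]] by simp
    qed
    moreover have "(LINT z|lborel. - (F z * ?D 1 0 z) + (\<beta>\<^sup>2 * (F z * ?D 0 2 z) + \<beta>\<^sup>2 * (a z * (g z)\<^sup>2 * ?D 0 0 z)))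
        = - mollify k F 1 0 u x + (\<beta>\<^sup>2 * mollify k F 0 2 u x + \<beta>\<^sup>2 * (LINT z|lborel. a z * (g z)\<^sup>2 * ?D 0 0 z))"
      using iF[of 1 0] iF[of 0 2] ig2D by (simp add: mollify_def)
    ultimately have eq: "mollify k F 1 0 u x = \<beta>\<^sup>2 * (mollify k F 0 2 u x + (LINT z|lborel. a z * (g z)\<^sup>2 * ?D 0 0 z))"
      by (simp add: algebra_simps)
    have "\<alpha> (u - \<epsilon>) * (2 * c * (LINT z|lborel. g z * ?D 0 0 z) - c\<^sup>2) =
        (LINT z|lborel. \<alpha> (u - \<epsilon>) * (2 * c * (g z * ?D 0 0 z) - c\<^sup>2 * ?D 0 0 z))"
      using igD iD by (simp add: product_jet_integral[OF k])
    also have "\<dots> \<le> (LINT z|lborel. a z * (g z)\<^sup>2 * ?D 0 0 z)"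
    proof (rule integral_mono)
      fix z
      show "\<alpha> (u - \<epsilon>) * (2 * c * (g z * ?D 0 0 z) - c\<^sup>2 * ?D 0 0 z) \<le> a z * (g z)\<^sup>2 * ?D 0 0 z"
      proof (cases "z \<in> {u-\<epsilon>..u+\<epsilon>} \<times> {x-\<epsilon>..x+\<epsilon>}")
        case True
        have ue: "u - \<epsilon> \<in> {0..1}" using e by auto
        have \<alpha>0: "0 \<le> \<alpha> (u - \<epsilon>)" using cdf ue unfolding cdf_unit_interval_def by auto
        have "clamp_unit (u - \<epsilon>) \<le> clamp_unit (fst z)"
          using True by (intro clamp_unit_mono) auto
        hence "\<alpha> (u - \<epsilon>) \<le> a z"
          using cdf ue clamp_unit_bounds[of "fst z"] clamp_unit_id[OF ue]
          unfolding cdf_unit_interval_def mono_on_def a_def by auto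
        moreover have "2 * c * g z - c\<^sup>2 \<le> (g z)\<^sup>2"
          using zero_le_power2[of "g z - c"] by (simp add: power2_diff algebra_simps)
        ultimately have "\<alpha> (u - \<epsilon>) * (2 * c * g z - c\<^sup>2) \<le> a z * (g z)\<^sup>2"
          using \<alpha>0 by (meson mult_left_mono mult_right_mono order_trans zero_le_power2)
        from mult_right_mono[OF this Dnn[of z]] show ?thesis by (simp add: algebra_simps)
      next
        case False
        thus ?thesis using D0[of z 0 0] by simp
      qed
    qed (use igD iD ig2D in auto)
    finally have "\<alpha> (u - \<epsilon>) * (2 * c * (- mollify k F 0 1 u x) - c\<^sup>2) \<le> (LINT z|lborel. a z * (g z)\<^sup>2 * ?D 0 0 z)"
      by (simp add: gD del: One_nat_def)
    hence A: "\<beta>\<^sup>2 * (mollify k F 0 2 u x + \<alpha> (u - \<epsilon>) * (2 * c * (- mollify k F 0 1 u x) - c\<^sup>2))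
        \<le> mollify k F 1 0 u x"
      unfolding eq by (intro mult_left_mono add_left_mono) auto
    have "\<bar>LINT z|lborel. g z * ?D 0 0 z\<bar> \<le> (LINT z|lborel. \<bar>g z * ?D 0 0 z\<bar>)"
      by (rule integral_abs_bound)
    also have "\<dots> \<le> (LINT z|lborel. B * ?D 0 0 z)"
    proof (rule integral_mono_AE)
      show "AE z in lborel. \<bar>g z * ?D 0 0 z\<bar> \<le> B * ?D 0 0 z"
        using B by eventually_elim (use Dnn in \<open>auto simp: abs_mult intro!: mult_right_mono\<close>)
    qed (use igD iD in auto)
    also have "\<dots> = B" by (simp add: product_jet_integral[OF k])
    finally show ?thesis using A by (simp add: gD del: One_nat_def)
  qed
  show thesis
    by (rule that[OF cF Ff]) (use key in blast)+
qed


section \<open>Comparison with subsolutions\<close>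

lemma quadratic_dominates_linear:
  fixes A B \<delta> :: real
  assumes "0 < \<delta>"
  shows "\<exists>R>0. \<forall>x. R \<le> \<bar>x\<bar> \<longrightarrow> A + B * \<bar>x\<bar> \<le> \<delta> * (1 + x\<^sup>2)"
proof (intro exI conjI allI impI)
  let ?R = "1 + (\<bar>A\<bar> + \<bar>B\<bar>) / \<delta>"
  show "0 < ?R" using assms by (simp add: add_pos_nonneg)
  fix x :: real assume x: "?R \<le> \<bar>x\<bar>"
  have "(\<bar>A\<bar> + \<bar>B\<bar>) / \<delta> \<le> \<bar>x\<bar>" "1 \<le> \<bar>x\<bar>"
    using order_trans[OF _ x, of "(\<bar>A\<bar> + \<bar>B\<bar>) / \<delta>"] order_trans[OF _ x, of 1] assms by (auto intro: order_trans[rotated] simp: divide_nonneg_pos)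
  hence "\<bar>A\<bar> + \<bar>B\<bar> \<le> \<delta> * \<bar>x\<bar>" "1 \<le> \<bar>x\<bar>" using assms by (auto simp: field_simps)
  hence "(\<bar>A\<bar> + \<bar>B\<bar>) * \<bar>x\<bar> \<le> \<delta> * \<bar>x\<bar> * \<bar>x\<bar>" by (intro mult_right_mono) auto
  moreover have "\<bar>A\<bar> * 1 \<le> \<bar>A\<bar> * \<bar>x\<bar>" using \<open>1 \<le> \<bar>x\<bar>\<close> by (intro mult_left_mono) auto
  moreover have "B * \<bar>x\<bar> \<le> \<bar>B\<bar> * \<bar>x\<bar>" by (intro mult_right_mono) auto
  moreover have "A \<le> \<bar>A\<bar>" by simp
  ultimately have "A + B * \<bar>x\<bar> \<le> \<delta> * x\<^sup>2"
    unfolding power2_eq_square[of x] by (simp add: algebra_simps)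
  thus "A + B * \<bar>x\<bar> \<le> \<delta> * (1 + x\<^sup>2)" using assms by (simp add: algebra_simps)
qed

text \<open>
  The maximum principle is applied, on \<open>[2 \<epsilon>, 1 - 2 \<epsilon>]\<close>, to
  \<open>W u x = h (u - \<epsilon>) x - G u x - \<delta> * exp (\<rho> * (1 - u)) * (1 + x\<^sup>2)\<close>, where \<open>G\<close> is the mollified
  solution. The delay of \<open>h\<close> by \<open>\<epsilon>\<close> matches the delayed \<open>\<alpha>\<close> in the equation for \<open>G\<close>. The quadratic
  penalty beats the linear growth of \<open>h\<close> and \<open>G\<close>, so that only a compact set of \<open>x\<close> matters, on which
  \<open>F\<close> (the extension of \<open>f\<close>) and \<open>h\<close> are uniformly continuous. The rate \<open>\<rho>\<close> of the penalty makes it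
  a strict supersolution of the linearised equation, whose drift is bounded by \<open>2 \<beta>\<^sup>2\<close>. If
  \<open>\<theta> = h 0 0 - f (0, 0)\<close> were positive, the choices \<open>\<delta> exp \<rho> = \<theta> / 4\<close> and an
  oscillation of at most \<open>\<theta> / 8\<close> would contradict each other.
\<close>

lemma parisi_comparison:
  fixes h hx hxx hu :: "real \<Rightarrow> real \<Rightarrow> real"
  assumes sol: "parisi_solution \<alpha> \<beta> f" and cdf: "cdf_unit_interval \<alpha>" and \<beta>: "0 < \<beta>"
    and cont: "continuous_on ({0..1} \<times> UNIV) (\<lambda>z. h (fst z) (snd z))"
    and hx: "\<And>u x. 0 \<le> u \<Longrightarrow> u < 1 \<Longrightarrow> (h u has_real_derivative hx u x) (at x)"
    and hxx: "\<And>u x. 0 \<le> u \<Longrightarrow> u < 1 \<Longrightarrow> (hx u has_real_derivative hxx u x) (at x)"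
    and hu: "\<And>u x. 0 \<le> u \<Longrightarrow> u < 1 \<Longrightarrow> ((\<lambda>v. h v x) has_real_derivative hu u x) (at_right u)"
    and sub: "\<And>u x. 0 \<le> u \<Longrightarrow> u < 1 \<Longrightarrow> 0 \<le> hu u x + \<beta>\<^sup>2 * (hxx u x + \<alpha> u * (hx u x)\<^sup>2)"
    and hx1: "\<And>u x. 0 \<le> u \<Longrightarrow> u < 1 \<Longrightarrow> \<bar>hx u x\<bar> \<le> 1"
    and growth: "\<And>u x. u \<in> {0..1} \<Longrightarrow> h u x \<le> A + \<bar>x\<bar>"
    and terminal: "\<And>x. h 1 x \<le> ln (cosh x)"
  shows "h 0 0 \<le> f (0, 0)"
proof (rule ccontr)
  assume "\<not> h 0 0 \<le> f (0, 0)"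
  define \<theta> where "\<theta> = h 0 0 - f (0, 0)"
  have \<theta>: "0 < \<theta>" using \<open>\<not> _\<close> by (simp add: \<theta>_def)
  obtain F B where cF: "continuous_on UNIV F" and Ff: "\<And>u x. u \<in> {0..1} \<Longrightarrow> F (u, x) = f (u, x)"
    and super: "\<And>\<epsilon> k u x c. mollifier \<epsilon> k \<Longrightarrow> 0 < \<epsilon> \<Longrightarrow> \<epsilon> < u \<Longrightarrow> u < 1 - \<epsilon> \<Longrightarrow>
      \<beta>\<^sup>2 * (mollify k F 0 2 u x + \<alpha> (u - \<epsilon>) * (2 * c * (- mollify k F 0 1 u x) - c\<^sup>2))
        \<le> mollify k F 1 0 u x"
    and lip: "\<And>\<epsilon> k u x. mollifier \<epsilon> k \<Longrightarrow> 0 < \<epsilon> \<Longrightarrow> \<epsilon> < u \<Longrightarrow> u < 1 - \<epsilon> \<Longrightarrow>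
      \<bar>mollify k F 0 1 u x\<bar> \<le> B"
    using parisi_solution_mollified[OF sol cdf] by blast
  have f1: "F (1, x) = ln (cosh x)" for x
    using sol Ff[of 1 x] unfolding parisi_solution_def by auto
  \<comment> \<open>The factor \<open>7\<close> is chosen so that \<open>2 + 4 * \<bar>x\<bar> < 7 * (1 + x\<^sup>2)\<close>: the left-hand side bounds the
    diffusion and drift terms of the penalty.\<close>
  define \<rho> where "\<rho> = 7 * \<beta>\<^sup>2"
  define \<delta> where "\<delta> = \<theta> / (4 * exp \<rho>)"
  define \<eta> where "\<eta> = \<theta> / 8"
  have pos: "0 < \<rho>" "0 < \<delta>" "0 < \<eta>" using \<beta> \<theta> by (auto simp: \<rho>_def \<delta>_def \<eta>_def)
  have "bounded (F ` ({0..1} \<times> {-1..1}))"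
    by (intro compact_imp_bounded compact_continuous_image continuous_on_subset[OF cF] compact_Times) auto
  then obtain M where M: "\<And>z. z \<in> {0..1} \<times> {-1..1} \<Longrightarrow> \<bar>F z\<bar> \<le> M"
    unfolding bounded_iff by (auto simp del: atLeastAtMost_iff)
  obtain R where R: "0 < R" "\<And>x. R \<le> \<bar>x\<bar> \<Longrightarrow> (A + M) + (1 + B) * \<bar>x\<bar> \<le> \<delta> * (1 + x\<^sup>2)"
    using quadratic_dominates_linear[OF pos(2), of "A + M" "1 + B"] by blast
  let ?K = "{0..1::real} \<times> {-(R+1)..R+1}"
  have cK: "compact ?K" by (intro compact_Times) auto
  have "uniformly_continuous_on ?K F"
    by (rule compact_uniformly_continuous[OF continuous_on_subset[OF cF] cK]) simp
  from this[unfolded uniformly_continuous_on_def, rule_format, OF pos(3)]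
  obtain e1 where e1: "0 < e1" "\<And>z z'. z \<in> ?K \<Longrightarrow> z' \<in> ?K \<Longrightarrow> dist z' z < e1 \<Longrightarrow> dist (F z') (F z) < \<eta>"
    by metis
  have "continuous_on ?K (\<lambda>z. h (fst z) (snd z))" by (rule continuous_on_subset[OF cont]) auto
  from compact_uniformly_continuous[OF this cK, unfolded uniformly_continuous_on_def, rule_format, OF pos(3)]
  obtain e2 where e2: "0 < e2" "\<And>z z'. z \<in> ?K \<Longrightarrow> z' \<in> ?K \<Longrightarrow> dist z' z < e2 \<Longrightarrow>
      dist (h (fst z') (snd z')) (h (fst z) (snd z)) < \<eta>"
    by metis
  define \<epsilon> where "\<epsilon> = min (1/8) (min (e1/8) (e2/8))"
  have \<epsilon>: "0 < \<epsilon>" "\<epsilon> \<le> 1/8" "8 * \<epsilon> \<le> e1" "8 * \<epsilon> \<le> e2" using e1 e2 by (auto simp: \<epsilon>_def)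
  obtain k where k: "mollifier \<epsilon> k" using mollifier_exists[OF \<epsilon>(1)] by blast
  define a b where "a = 2 * \<epsilon>" and "b = 1 - 2 * \<epsilon>"
  have ab: "a < b" "\<epsilon> < a" "b < 1 - \<epsilon>" "0 < a" "b < 1" using \<epsilon> by (auto simp: a_def b_def)
  define G where "G = mollify k F 0 0"
  have Fclose: "\<bar>F (v, y) - F (u, x)\<bar> < \<eta>"
    if "u \<in> {0..1}" "v \<in> {0..1}" "\<bar>x\<bar> \<le> R" "\<bar>v - u\<bar> \<le> 3 * \<epsilon>" "\<bar>y - x\<bar> \<le> \<epsilon>" for u v x y
  proof -
    have "dist (v, y) (u, x) \<le> \<bar>v - u\<bar> + \<bar>y - x\<bar>"
      unfolding dist_prod_def dist_real_def using sqrt_sum_squares_le_sum_abs[of "\<bar>v - u\<bar>" "\<bar>y - x\<bar>"] by simp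
    also have "\<dots> < e1" using that \<epsilon> by linarith
    finally have "dist (v, y) (u, x) < e1" .
    moreover have "- (R + 1) \<le> x" "x \<le> R + 1" "- (R + 1) \<le> y" "y \<le> R + 1"
      using that \<epsilon> unfolding abs_le_iff by linarith+
    ultimately show ?thesis
      using e1(2)[of "(u, x)" "(v, y)"] that by (auto simp: dist_real_def)
  qed
  have hclose: "\<bar>h v x - h u x\<bar> < \<eta>"
    if "u \<in> {0..1}" "v \<in> {0..1}" "\<bar>x\<bar> \<le> R" "\<bar>v - u\<bar> \<le> 3 * \<epsilon>" for u v x
  proof -
    have "dist (v, x) (u, x) \<le> \<bar>v - u\<bar>"
      unfolding dist_prod_def dist_real_def by simp
    also have "\<dots> < e2" using that \<epsilon> by linarith
    finally have "dist (v, x) (u, x) < e2" .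
    moreover have "- (R + 1) \<le> x" "x \<le> R + 1"
      using that unfolding abs_le_iff by linarith+
    ultimately show ?thesis
      using e2(2)[of "(u, x)" "(v, x)"] that by (auto simp: dist_real_def)
  qed
  have Gclose: "\<bar>G u x - F (u', x)\<bar> \<le> \<eta>"
    if "u \<in> {\<epsilon>..1 - \<epsilon>}" "u' \<in> {0..1}" "\<bar>u - u'\<bar> \<le> 2 * \<epsilon>" "\<bar>x\<bar> \<le> R" for u u' x
    unfolding G_def
  proof (rule mollify_close[OF k cF])
    fix v y assume "\<bar>v - u\<bar> \<le> \<epsilon>" "\<bar>y - x\<bar> \<le> \<epsilon>"
    thus "\<bar>F (v, y) - F (u', x)\<bar> \<le> \<eta>"
      using that \<epsilon> by (intro less_imp_le[OF Fclose]) (auto simp: abs_le_iff)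
  qed
  have G0: "\<bar>G u 0\<bar> \<le> M" if "u \<in> {a..b}" for u
  proof -
    have "\<bar>G u 0 - 0\<bar> \<le> M"
      unfolding G_def
      by (rule mollify_close[OF k cF]) (use that ab \<epsilon> M in \<open>auto simp: abs_le_iff\<close>)
    thus ?thesis by simp
  qed
  have Gx: "(G u has_real_derivative - mollify k F 0 1 u x) (at x)" for u x
    unfolding G_def using mollify_dx[OF k cF, of 0 0 u x] by simp
  have Glin: "- (M + B * \<bar>x\<bar>) \<le> G u x" if "u \<in> {a..b}" for u x
  proof -
    have "norm (G u x - G u 0) \<le> B * norm (x - 0)"
      by (rule field_differentiable_bound[OF convex_UNIV, where f' = "\<lambda>x. - mollify k F 0 1 u x"])
        (use Gx lip[OF k \<epsilon>(1)] that ab in auto)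
    thus ?thesis using G0[OF that] by (simp add: abs_le_iff)
  qed
  define E where "E = (\<lambda>u. \<delta> * exp (\<rho> * (1 - u)))"
  have Epos: "0 < E u" for u using pos by (simp add: E_def)
  have Ege: "\<delta> \<le> E u" if "u \<le> 1" for u using pos that by (simp add: E_def)
  define W where "W = (\<lambda>u x. h (u - \<epsilon>) x - G u x - E u * (1 + x\<^sup>2))"
  define Wx where "Wx = (\<lambda>u x. hx (u - \<epsilon>) x - (- mollify k F 0 1 u x) - E u * (2 * x))"
  define Wxx where "Wxx = (\<lambda>u x. hxx (u - \<epsilon>) x - mollify k F 0 2 u x - E u * 2)"
  define Wu where "Wu = (\<lambda>u x. hu (u - \<epsilon>) x - (- mollify k F 1 0 u x) - (E u * (- \<rho>)) * (1 + x\<^sup>2))"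
  have far: "W u x \<le> 0" if "u \<in> {a..b}" "R \<le> \<bar>x\<bar>" for u x
  proof -
    have "h (u - \<epsilon>) x \<le> A + \<bar>x\<bar>" using that ab \<epsilon> by (intro growth) auto
    moreover have "\<delta> * (1 + x\<^sup>2) \<le> E u * (1 + x\<^sup>2)"
      using Ege[of u] that ab by (intro mult_right_mono) auto
    ultimately show ?thesis using Glin[OF that(1), of x] R(2)[OF that(2)]
      by (simp add: W_def algebra_simps)
  qed
  have "W a 0 \<le> 2 * \<eta>"
  proof (rule parabolic_maximum_principle[where a = a and b = b and W = W and Wx = Wx and Wxx = Wxx
        and Wu = Wu and R = R])
    show "continuous_on ({a..b} \<times> UNIV) (\<lambda>z. W (fst z) (snd z))"
    proof -
      have "continuous_on ({a..b} \<times> UNIV) (\<lambda>z. h (fst (fst z - \<epsilon>, snd z)) (snd (fst z - \<epsilon>, snd z :: real)))"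
        by (rule continuous_on_compose2[OF cont])
          (use ab \<epsilon> in \<open>auto intro!: continuous_intros\<close>)
      moreover have "continuous_on ({a..b} \<times> UNIV) (\<lambda>z. G (fst z) (snd z))"
        unfolding G_def by (rule continuous_on_subset[OF mollify_continuous[OF k cF]]) auto
      ultimately show ?thesis
        unfolding W_def E_def by (auto intro!: continuous_intros)
    qed
    show "W b x \<le> 2 * \<eta>" for x
    proof (cases "R \<le> \<bar>x\<bar>")
      case True
      thus ?thesis using far[of b x] ab pos by simp
    next
      case False
      have "\<bar>h (b - \<epsilon>) x - h 1 x\<bar> < \<eta>"
        using False \<epsilon> by (intro hclose) (auto simp: b_def)
      moreover have "\<bar>G b x - F (1, x)\<bar> \<le> \<eta>"
        using False \<epsilon> by (intro Gclose) (auto simp: b_def)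
      moreover have "0 \<le> E b * (1 + x\<^sup>2)" using Epos[of b] by simp
      ultimately show ?thesis using terminal[of x] f1[of x] by (simp add: W_def abs_le_iff abs_less_iff)
    qed
    show "W u x \<le> 2 * \<eta>" if "u \<in> {a..b}" "R \<le> \<bar>x\<bar>" for u x
      using far[OF that] pos by simp
    fix u x assume u: "a \<le> u" "u < b"
    have u': "0 \<le> u - \<epsilon>" "u - \<epsilon> < 1" using u ab \<epsilon> by auto
    have ue: "\<epsilon> < u" "u < 1 - \<epsilon>" using u ab by auto
    show "(W u has_real_derivative Wx u x) (at x)"
      unfolding W_def Wx_def
      by (intro DERIV_diff hx[OF u'] Gx) (auto intro!: derivative_eq_intros)
    show "(Wx u has_real_derivative Wxx u x) (at x)"
      unfolding Wx_def Wxx_def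
      using hxx[OF u', of x] mollify_dx[OF k cF, of 0 1 u x]
      by (auto intro!: derivative_eq_intros simp: numeral_2_eq_2)
    show "((\<lambda>v. W v x) has_real_derivative Wu u x) (at_right u)"
      unfolding W_def Wu_def
    proof (intro DERIV_diff)
      have "((\<lambda>v. h (v + (- \<epsilon>)) x) has_real_derivative hu (u - \<epsilon>) x) (at u within {u<..})"
      proof -
        have "(((\<lambda>w. h w x) \<circ> (\<lambda>v. v - \<epsilon>)) has_real_derivative hu (u - \<epsilon>) x * 1) (at u within {u<..})"
        proof (rule DERIV_image_chain)
          have "(\<lambda>v. v - \<epsilon>) ` {u<..} = {u - \<epsilon><..}"
            by (auto intro!: image_eqI[where x = "_ + \<epsilon>"])
          thus "((\<lambda>w. h w x) has_real_derivative hu (u - \<epsilon>) x) (at (u - \<epsilon>) within (\<lambda>v. v - \<epsilon>) ` {u<..})"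
            using hu[OF u', of x] by simp
        qed (auto intro!: derivative_eq_intros)
        thus ?thesis by (simp add: comp_def)
      qed
      thus "((\<lambda>v. h (v - \<epsilon>) x) has_real_derivative hu (u - \<epsilon>) x) (at u within {u<..})" by simp
      show "((\<lambda>v. G v x) has_real_derivative - mollify k F 1 0 u x) (at u within {u<..})"
        unfolding G_def using mollify_du[OF k cF, of 0 0 x u]
        by (auto intro: has_field_derivative_at_within)
      show "((\<lambda>v. E v * (1 + x\<^sup>2)) has_real_derivative E u * - \<rho> * (1 + x\<^sup>2)) (at u within {u<..})"
        unfolding E_def by (auto intro!: derivative_eq_intros)
    qed
    assume dx: "Wx u x = 0" and dxx: "Wxx u x \<le> 0"
    define p q where "p = hx (u - \<epsilon>) x" and "q = - mollify k F 0 1 u x"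
    define \<alpha>' where "\<alpha>' = \<alpha> (u - \<epsilon>)"
    have \<alpha>': "0 \<le> \<alpha>'" "\<alpha>' \<le> 1"
      using cdf u' unfolding cdf_unit_interval_def \<alpha>'_def by auto
    have pq: "p - q = E u * (2 * x)" using dx by (simp add: Wx_def p_def q_def)
    have p1: "\<bar>p\<bar> \<le> 1" unfolding p_def by (rule hx1[OF u'])
    have xx: "hxx (u - \<epsilon>) x \<le> mollify k F 0 2 u x + E u * 2" using dxx by (simp add: Wxx_def)
    have drift: "- (4 * (E u * \<bar>x\<bar>)) \<le> \<alpha>' * p * (2 * (q - p))"
    proof -
      have "\<bar>\<alpha>' * p\<bar> \<le> 1 * 1" unfolding abs_mult using \<alpha>' p1 by (intro mult_mono) auto
      hence "\<bar>\<alpha>' * p\<bar> * \<bar>2 * (q - p)\<bar> \<le> 1 * \<bar>2 * (q - p)\<bar>" by (intro mult_right_mono) auto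
      moreover have "\<bar>2 * (q - p)\<bar> = 4 * (E u * \<bar>x\<bar>)"
      proof -
        have "2 * (q - p) = - (4 * (E u * x))" using pq by (simp add: algebra_simps)
        thus ?thesis using Epos[of u] by (simp add: abs_mult)
      qed
      ultimately have "\<bar>\<alpha>' * p * (2 * (q - p))\<bar> \<le> 4 * (E u * \<bar>x\<bar>)"
        unfolding abs_mult[of "\<alpha>' * p"] by linarith
      thus ?thesis by linarith
    qed
    \<comment> \<open>The equation for the mollified solution is linearised at \<open>c = p\<close>, the gradient of the
      subsolution, so that the nonlinear terms combine to \<open>\<alpha>' * p * (2 * (q - p))\<close>.\<close>
    have "\<beta>\<^sup>2 * (- (2 * E u + 4 * (E u * \<bar>x\<bar>)))
        \<le> \<beta>\<^sup>2 * (mollify k F 0 2 u x - hxx (u - \<epsilon>) x + \<alpha>' * p * (2 * (q - p)))"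
      using xx drift by (intro mult_left_mono) auto
    also have "\<dots> = \<beta>\<^sup>2 * (mollify k F 0 2 u x + \<alpha>' * (2 * p * q - p\<^sup>2))
        - \<beta>\<^sup>2 * (hxx (u - \<epsilon>) x + \<alpha>' * p\<^sup>2)"
      by (simp add: algebra_simps power2_eq_square)
    also have "\<dots> \<le> mollify k F 1 0 u x + hu (u - \<epsilon>) x"
      using super[OF k \<epsilon>(1) ue, of x p] sub[OF u', of x]
      unfolding p_def[symmetric] q_def[symmetric] \<alpha>'_def[symmetric] by linarith
    finally have "\<beta>\<^sup>2 * (- (2 * E u + 4 * (E u * \<bar>x\<bar>))) \<le> mollify k F 1 0 u x + hu (u - \<epsilon>) x" .
    moreover have "0 < \<beta>\<^sup>2 * (- (2 * E u + 4 * (E u * \<bar>x\<bar>))) + E u * \<rho> * (1 + x\<^sup>2)"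
    proof -
      have "0 < 5 * x\<^sup>2 + (2 * (\<bar>x\<bar> - 1)\<^sup>2 + 3)" by (intro add_nonneg_pos) auto
      also have "\<dots> = 7 * (1 + x\<^sup>2) - (2 + 4 * \<bar>x\<bar>)" by (simp add: power2_diff)
      finally have "0 < \<beta>\<^sup>2 * E u * (7 * (1 + x\<^sup>2) - (2 + 4 * \<bar>x\<bar>))"
        using \<beta> Epos[of u] by (intro mult_pos_pos) auto
      thus ?thesis by (simp add: \<rho>_def algebra_simps)
    qed
    ultimately show "0 < Wu u x" by (simp add: Wu_def)
  qed (use ab in auto)
  moreover have "\<bar>h (a - \<epsilon>) 0 - h 0 0\<bar> < \<eta>"
    using R(1) \<epsilon> by (intro hclose) (auto simp: a_def)
  moreover have "\<bar>G a 0 - F (0, 0)\<bar> \<le> \<eta>"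
    using R(1) \<epsilon> by (intro Gclose) (auto simp: a_def)
  moreover have "E a \<le> \<theta> / 4"
  proof -
    have "E a \<le> \<delta> * exp \<rho>" using pos ab by (simp add: E_def)
    thus ?thesis by (simp add: \<delta>_def)
  qed
  ultimately show False
    using Ff[of 0 0] \<theta> unfolding W_def \<eta>_def \<theta>_def abs_le_iff abs_less_iff by simp
qed

section \<open>Lower bound for the Parisi functional\<close>

lemma cdf_integrable_on:
  assumes "cdf_unit_interval \<alpha>" "0 \<le> a" "b \<le> 1"
  shows "\<alpha> integrable_on {a..b}"
proof (rule integrable_on_subinterval[of \<alpha> "{0..1}"])
  show "\<alpha> integrable_on {0..1}"
    using assms(1) by (intro integrable_on_mono_on) (simp add: cdf_unit_interval_def)
qed (use assms in auto)

lemma cdf_times_id: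
  assumes cdf: "cdf_unit_interval \<alpha>"
  shows "(\<lambda>u. \<alpha> u * u) integrable_on {0..1}"
    and "(LINT u:{0..1}|lborel. \<alpha> u * u) = integral {0..1} (\<lambda>u. \<alpha> u * u)"
proof -
  have [measurable]: "(\<lambda>u. \<alpha> (clamp_unit u)) \<in> borel_measurable borel"
    by (rule clamped_cdf_measurable[OF cdf])
  have "integrable lborel (\<lambda>u. indicator {0..1} u *\<^sub>R (\<alpha> (clamp_unit u) * u))"
  proof (rule Bochner_Integration.integrable_bound)
    show "integrable lborel (\<lambda>u::real. indicator {0..1} u *\<^sub>R (1::real))"
      by (rule borel_integrable_compact) auto
    show "AE u in lborel. norm (indicator {0..1} u *\<^sub>R (\<alpha> (clamp_unit u) * u)) \<le> norm (indicator {0..1} u *\<^sub>R (1::real))"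
      using cdf by (intro AE_I2)
        (auto simp: indicator_def clamp_unit_id cdf_unit_interval_def abs_mult intro!: mult_le_one)
  qed measurable
  also have "(\<lambda>u. indicator {0..1} u *\<^sub>R (\<alpha> (clamp_unit u) * u)) = (\<lambda>u. indicator {0..1} u *\<^sub>R (\<alpha> u * u))"
    by (auto simp: indicator_def clamp_unit_id fun_eq_iff)
  finally have "set_integrable lborel {0..1} (\<lambda>u. \<alpha> u * u)"
    by (simp add: set_integrable_def)
  from set_borel_integral_eq_integral[OF this]
  show "(\<lambda>u. \<alpha> u * u) integrable_on {0..1}"
    "(LINT u:{0..1}|lborel. \<alpha> u * u) = integral {0..1} (\<lambda>u. \<alpha> u * u)" by auto
qed

text \<open>
  The subsolution is \<open>J(u, x) + \<beta>\<^sup>2 \<integral> \<alpha>\<close> with the integral over \<open>[max u \<tau>, 1]\<close>, where \<open>J\<close> is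
  \<open>ln (cosh x)\<close> for \<open>u \<ge> \<tau>\<close> and its heat flow for \<open>u < \<tau>\<close>. Up to time \<open>\<tau>\<close> the nonlinear term, which
  is nonnegative, is dropped; after time \<open>\<tau>\<close> the defect of the equation is
  \<open>\<beta>\<^sup>2 (1 - \<alpha>) (1 - tanh\<^sup>2)\<close>, again nonnegative.
\<close>

lemma parisi_solution_lower:
  assumes sol: "parisi_solution \<alpha> \<beta> f" and cdf: "cdf_unit_interval \<alpha>" and \<beta>: "0 < \<beta>"
    and \<tau>: "0 \<le> \<tau>" "\<tau> < 1"
  shows "heat_lncosh (\<beta> * sqrt (2 * \<tau>)) 0 + \<beta>\<^sup>2 * integral {\<tau>..1} \<alpha> \<le> f (0, 0)"
proof -
  define s where "s = (\<lambda>u. \<beta> * sqrt (2 * max (\<tau> - u) 0))"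
  define I where "I = (\<lambda>u. integral {u..1} \<alpha>)"
  have \<alpha>01: "0 \<le> \<alpha> u" "\<alpha> u \<le> 1" if "0 \<le> u" "u \<le> 1" for u
    using cdf that unfolding cdf_unit_interval_def by auto
  have contI: "continuous_on {0..1} I"
    unfolding I_def by (rule indefinite_integral_continuous_1'[OF cdf_integrable_on[OF cdf]]) auto
  have I_le: "I u \<le> 1" if "u \<in> {0..1}" for u
  proof -
    have "I u \<le> integral {u..1} (\<lambda>_. 1)"
      unfolding I_def by (rule integral_le) (use that cdf_integrable_on[OF cdf] \<alpha>01 in auto)
    also have "\<dots> \<le> 1" using that by simp
    finally show ?thesis .
  qed
  have s0: "s u = 0" if "\<tau> \<le> u" for u using that by (simp add: s_def)
  have "heat_lncosh (s 0) 0 + \<beta>\<^sup>2 * I (max 0 \<tau>) \<le> f (0, 0)"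
  proof (rule parisi_comparison[OF sol cdf \<beta>,
      where h = "\<lambda>u x. heat_lncosh (s u) x + \<beta>\<^sup>2 * I (max u \<tau>)"
        and hx = "\<lambda>u x. heat_tanh (s u) x" and hxx = "\<lambda>u x. heat_sech2 (s u) x"
        and hu = "\<lambda>u x. if u < \<tau> then - \<beta>\<^sup>2 * heat_sech2 (s u) x else - \<beta>\<^sup>2 * \<alpha> u"
        and A = "\<beta> * sqrt 2 + \<beta>\<^sup>2"])
    have "continuous_on ({0..1} \<times> UNIV) (\<lambda>z. heat_lncosh (fst (s (fst z), snd z)) (snd (s (fst z), snd z :: real)))"
      by (rule continuous_on_compose2[OF continuous_on_heat_lncosh])
        (auto simp: s_def intro!: continuous_intros)
    moreover have "continuous_on ({0..1} \<times> (UNIV :: real set)) (\<lambda>z. I (max (fst z) \<tau>))"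
      by (rule continuous_on_compose2[OF contI]) (use \<tau> in \<open>auto intro!: continuous_intros\<close>)
    ultimately show "continuous_on ({0..1} \<times> UNIV)
        (\<lambda>z. heat_lncosh (s (fst z)) (snd z) + \<beta>\<^sup>2 * I (max (fst z) \<tau>))"
      by (auto intro!: continuous_intros)
  next
    fix u x :: real assume u: "0 \<le> u" "u < 1"
    show "((\<lambda>x. heat_lncosh (s u) x + \<beta>\<^sup>2 * I (max u \<tau>)) has_real_derivative heat_tanh (s u) x) (at x)"
      by (auto intro!: derivative_eq_intros heat_lncosh_dx)
    show "(heat_tanh (s u) has_real_derivative heat_sech2 (s u) x) (at x)"
      by (rule heat_tanh_dx)
    show "\<bar>heat_tanh (s u) x\<bar> \<le> 1" by (rule abs_heat_tanh_le_1)
    show "((\<lambda>v. heat_lncosh (s v) x + \<beta>\<^sup>2 * I (max v \<tau>)) has_real_derivative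
        (if u < \<tau> then - \<beta>\<^sup>2 * heat_sech2 (s u) x else - \<beta>\<^sup>2 * \<alpha> u)) (at_right u)"
    proof (cases "u < \<tau>")
      case True
      have pos: "0 < sqrt (2 * (\<tau> - u))" using True by simp
      have "((\<lambda>v. heat_lncosh (\<beta> * sqrt (2 * (\<tau> - v))) x + \<beta>\<^sup>2 * I \<tau>) has_real_derivative
          - \<beta>\<^sup>2 * heat_sech2 (s u) x) (at u)"
      proof -
        have "((\<lambda>v. \<beta> * sqrt (2 * (\<tau> - v))) has_real_derivative - (\<beta> / sqrt (2 * (\<tau> - u)))) (at u)"
          using True by (auto intro!: derivative_eq_intros simp: field_simps)
        from DERIV_chain2[OF heat_lncosh_ds this]
        have "((\<lambda>v. heat_lncosh (\<beta> * sqrt (2 * (\<tau> - v))) x) has_real_derivative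
          (\<beta> * sqrt (2 * (\<tau> - u))) * heat_sech2 (\<beta> * sqrt (2 * (\<tau> - u))) x * - (\<beta> / sqrt (2 * (\<tau> - u)))) (at u)" .
        moreover have "s u = \<beta> * sqrt (2 * (\<tau> - u))" using True by (simp add: s_def)
        ultimately show ?thesis using pos
          by (auto intro!: derivative_eq_intros simp: power2_eq_square)
      qed
      hence "((\<lambda>v. heat_lncosh (s v) x + \<beta>\<^sup>2 * I (max v \<tau>)) has_real_derivative
          - \<beta>\<^sup>2 * heat_sech2 (s u) x) (at u)"
        by (rule has_field_derivative_transform_within_open[where S = "{..<\<tau>}"])
          (use True in \<open>auto simp: s_def max_def\<close>)
      thus ?thesis using True by (auto intro: has_field_derivative_at_within)
    next
      case False
      have cr: "continuous (at u within {u..1}) \<alpha>"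
        using cdf u unfolding cdf_unit_interval_def by (simp add: at_within_Icc_at_right)
      have "((\<lambda>v. integral {u..v} \<alpha>) has_real_derivative \<alpha> u) (at u within {u..1})"
        using integral_has_vector_derivative_continuous_at[OF cdf_integrable_on[OF cdf u(1) order_refl], of u "{}"]
          u cr by (simp add: has_real_derivative_iff_has_vector_derivative)
      hence "((\<lambda>v. ln (cosh x) + \<beta>\<^sup>2 * (I u - integral {u..v} \<alpha>)) has_real_derivative - \<beta>\<^sup>2 * \<alpha> u)
          (at u within {u..1})"
        by (auto intro!: derivative_eq_intros)
      hence "((\<lambda>v. heat_lncosh (s v) x + \<beta>\<^sup>2 * I (max v \<tau>)) has_real_derivative - \<beta>\<^sup>2 * \<alpha> u) (at u within {u..1})"
      proof (rule has_field_derivative_transform_within[where d = 1])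
        fix v assume v: "v \<in> {u..1}"
        have "integral {u..v} \<alpha> + integral {v..1} \<alpha> = integral {u..1} \<alpha>"
          by (rule Henstock_Kurzweil_Integration.integral_combine) (use u v cdf_integrable_on[OF cdf] in auto)
        thus "ln (cosh x) + \<beta>\<^sup>2 * (I u - integral {u..v} \<alpha>) = heat_lncosh (s v) x + \<beta>\<^sup>2 * I (max v \<tau>)"
          using False v max.absorb1[of \<tau> v] by (simp add: s0 heat_lncosh_0 I_def)
      qed (use u in auto)
      thus ?thesis using False u by (simp add: at_within_Icc_at_right)
    qed
    show "0 \<le> (if u < \<tau> then - \<beta>\<^sup>2 * heat_sech2 (s u) x else - \<beta>\<^sup>2 * \<alpha> u)
        + \<beta>\<^sup>2 * (heat_sech2 (s u) x + \<alpha> u * (heat_tanh (s u) x)\<^sup>2)"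
    proof (cases "u < \<tau>")
      case True
      thus ?thesis using \<alpha>01[of u] u by (simp add: algebra_simps)
    next
      case False
      have "0 \<le> \<beta>\<^sup>2 * ((1 - \<alpha> u) * (1 - (tanh x)\<^sup>2))"
        using \<alpha>01[of u] u sech2_bounds(1)[of x] by (intro mult_nonneg_nonneg) auto
      thus ?thesis using False by (simp add: s0 heat_tanh_0 heat_sech2_0 algebra_simps)
    qed
  next
    fix u x :: real assume u: "u \<in> {0..1}"
    have "heat_lncosh (s u) x \<le> \<bar>x\<bar> + \<bar>s u\<bar>" by (rule heat_lncosh_le_linear)
    moreover have "\<bar>s u\<bar> \<le> \<beta> * sqrt 2"
      using \<beta> u \<tau> by (auto simp: s_def abs_mult)
    moreover have "\<beta>\<^sup>2 * I (max u \<tau>) \<le> \<beta>\<^sup>2 * 1" using u \<tau> by (intro mult_left_mono I_le) auto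
    ultimately show "heat_lncosh (s u) x + \<beta>\<^sup>2 * I (max u \<tau>) \<le> \<beta> * sqrt 2 + \<beta>\<^sup>2 + \<bar>x\<bar>" by simp
  next
    fix x show "heat_lncosh (s 1) x + \<beta>\<^sup>2 * I (max 1 \<tau>) \<le> ln (cosh x)"
      using \<tau> by (simp add: s0 heat_lncosh_0 I_def max_def)
  qed
  thus ?thesis using \<tau> by (simp add: s_def I_def max.absorb1 max.absorb2)
qed

text \<open>
  The previous estimates for \<open>\<tau> = 0\<close> and \<open>\<tau> = 1/2\<close> are added. The first alone is useless if \<open>\<alpha>\<close> is
  concentrated near \<open>u = 1\<close>, the second alone if \<open>\<alpha>\<close> is large on \<open>[0, 1/2]\<close>.
\<close>

lemma parisi_functional_lower:
  assumes sol: "parisi_solution \<alpha> \<beta> f" and cdf: "cdf_unit_interval \<alpha>" and \<beta>: "0 < \<beta>"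
  shows "heat_lncosh \<beta> 0 / 2 \<le> parisi_functional \<alpha> \<beta> f"
proof -
  define J where "J = integral {0..1} (\<lambda>u. \<alpha> u * u)"
  define I0 where "I0 = integral {0..1/2} \<alpha>"
  define I1 where "I1 = integral {1/2..1} \<alpha>"
  have \<alpha>0: "0 \<le> \<alpha> u" if "0 \<le> u" "u \<le> 1" for u
    using cdf that unfolding cdf_unit_interval_def by auto
  note int = cdf_integrable_on[OF cdf] cdf_times_id(1)[OF cdf]
  have I01: "I0 + I1 = integral {0..1} \<alpha>"
    unfolding I0_def I1_def
    by (rule Henstock_Kurzweil_Integration.integral_combine) (use int in auto)
  have J01: "integral {0..1/2} (\<lambda>u. \<alpha> u * u) + integral {1/2..1} (\<lambda>u. \<alpha> u * u) = J"
    unfolding J_def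
    by (rule Henstock_Kurzweil_Integration.integral_combine) (use int in auto)
  have iu: "(\<lambda>u. \<alpha> u * u) integrable_on {0..1/2}" "(\<lambda>u. \<alpha> u * u) integrable_on {1/2..1}"
    by (rule integrable_on_subinterval[OF int(2)]; simp)+
  have "integral {0..1/2} (\<lambda>u. \<alpha> u * u) \<le> integral {0..1/2} (\<lambda>u. \<alpha> u * (1/2))"
  proof (rule integral_le[OF iu(1) integrable_on_mult_left[OF int(1)]])
    fix u :: real assume "u \<in> {0..1/2}"
    thus "\<alpha> u * u \<le> \<alpha> u * (1/2)" using \<alpha>0[of u] by (intro mult_left_mono) auto
  qed auto
  hence j0: "integral {0..1/2} (\<lambda>u. \<alpha> u * u) \<le> I0 / 2" by (simp add: I0_def)
  have "integral {1/2..1} (\<lambda>u. \<alpha> u * u) \<le> integral {1/2..1} \<alpha>"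
    by (rule integral_le) (use int iu \<alpha>0 in \<open>auto intro!: mult_left_le\<close>)
  hence j1: "integral {1/2..1} (\<lambda>u. \<alpha> u * u) \<le> I1" by (simp add: I1_def)
  have "2 * J \<le> (I0 + I1) + I1" using J01 j0 j1 by linarith
  hence "\<beta>\<^sup>2 * (2 * J) \<le> \<beta>\<^sup>2 * ((I0 + I1) + I1)" by (intro mult_left_mono) auto
  moreover have "\<beta>\<^sup>2 * (I0 + I1) \<le> f (0, 0)"
    using parisi_solution_lower[OF sol cdf \<beta>, of 0] by (simp add: heat_lncosh_0 I01)
  moreover have "heat_lncosh \<beta> 0 + \<beta>\<^sup>2 * I1 \<le> f (0, 0)"
    using parisi_solution_lower[OF sol cdf \<beta>, of "1/2"] by (simp add: I1_def)
  ultimately have "heat_lncosh \<beta> 0 \<le> 2 * (f (0, 0) - \<beta>\<^sup>2 * J)"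
    by (simp add: algebra_simps)
  thus ?thesis by (simp add: parisi_functional_def cdf_times_id(2)[OF cdf] J_def)
qed

section \<open>The explicit weak solution\<close>

lemma continuous_slices:
  fixes r :: "real \<times> real \<Rightarrow> real"
  assumes "continuous_on UNIV r"
  shows "continuous_on A (\<lambda>x. r (u, x))" "continuous_on A (\<lambda>u. r (u, x))"
  by (rule continuous_on_compose2[OF assms]; auto intro!: continuous_intros)+

lemma strip_integral_iterated:
  fixes r :: "real \<times> real \<Rightarrow> real"
  assumes r: "continuous_on UNIV r" and K: "compact K" "\<And>z. z \<notin> K \<Longrightarrow> r z = 0"
  shows "set_integrable lborel ({0..1} \<times> UNIV) r"
    and "(LINT z:{0..1} \<times> UNIV|lborel. r z) = (LINT u:{0..1}|lborel. (LINT x|lborel. r (u, x)))"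
    and "(LINT z:{0..1} \<times> UNIV|lborel. r z) = (LINT x|lborel. (LINT u:{0..1}|lborel. r (u, x)))"
proof -
  have ind: "indicator ({0..1} \<times> UNIV) z *\<^sub>R r z = indicator {0..1} (fst z) * r z" for z :: "real \<times> real"
    by (cases z) (auto simp: indicator_def)
  have "integrable lborel r" by (rule integrable_compact_support[OF r K])
  hence "integrable lborel (\<lambda>z. indicator ({0..1} \<times> UNIV) z *\<^sub>R r z)"
    by (intro integrable_mult_indicator) (auto intro!: borel_closed closed_Times)
  thus si: "set_integrable lborel ({0..1} \<times> UNIV) r" by (simp add: set_integrable_def)
  hence i: "integrable (lborel \<Otimes>\<^sub>M lborel) (\<lambda>z. indicator {0..1} (fst z) * r z)"
    unfolding set_integrable_def ind by (simp add: lborel_prod)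
  have "(LINT z:{0..1} \<times> UNIV|lborel. r z) = (LINT z|(lborel \<Otimes>\<^sub>M lborel). indicator {0..1} (fst z) * r z)"
    unfolding set_lebesgue_integral_def ind by (simp add: lborel_prod)
  moreover have "(LINT z|(lborel \<Otimes>\<^sub>M lborel). indicator {0..1} (fst z) * r z)
      = (LINT u|lborel. (LINT x|lborel. indicator {0..1} u * r (u, x)))"
    using lborel_pair.integral_fst'[OF i] by simp
  moreover have "(LINT z|(lborel \<Otimes>\<^sub>M lborel). indicator {0..1} (fst z) * r z)
      = (LINT x|lborel. (LINT u|lborel. indicator {0..1} u * r (u, x)))"
    using lborel_pair.integral_snd[of "\<lambda>u x. indicator {0..1} u * r (u, x)"] i
    unfolding case_prod_beta prod.collapse by simp
  ultimately show "(LINT z:{0..1} \<times> UNIV|lborel. r z) = (LINT u:{0..1}|lborel. (LINT x|lborel. r (u, x)))"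
    "(LINT z:{0..1} \<times> UNIV|lborel. r z) = (LINT x|lborel. (LINT u:{0..1}|lborel. r (u, x)))"
    by (simp_all add: set_lebesgue_integral_def)
qed

lemma integral_deriv_compact_support:
  fixes q q' :: "real \<Rightarrow> real"
  assumes deriv: "\<And>x. (q has_real_derivative q' x) (at x)" and cont: "continuous_on UNIV q'"
    and zero: "\<And>x. R < \<bar>x\<bar> \<Longrightarrow> q x = 0" "\<And>x. R < \<bar>x\<bar> \<Longrightarrow> q' x = 0"
  shows "(LINT x|lborel. q' x) = 0"
proof -
  let ?R = "\<bar>R\<bar> + 1"
  have "(LINT x|lborel. q' x) = (LINT x|lborel. indicator {-?R..?R} x *\<^sub>R q' x)"
  proof (rule Bochner_Integration.integral_cong)
    fix x show "q' x = indicator {-?R..?R} x *\<^sub>R q' x"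
      using zero(2)[of x] by (cases "R < \<bar>x\<bar>") (auto simp: indicator_def)
  qed simp
  also have "\<dots> = q ?R - q (-?R)"
  proof (rule integral_FTC_atLeastAtMost)
    show "(q has_vector_derivative q' x) (at x within {-?R..?R})" for x
      using deriv[of x] by (auto simp: has_real_derivative_iff_has_vector_derivative
          intro: has_vector_derivative_at_within)
  qed (use cont continuous_on_subset in auto)
  also have "\<dots> = 0" using zero(1)[of ?R] zero(1)[of "-?R"] by simp
  finally show ?thesis .
qed

text \<open>
  Integrate the derivative of the product \<open>p d\<close> first in \<open>x\<close>, where it has compact support.
\<close>

lemma strip_integration_by_parts_x:
  fixes p p' d d' :: "real \<times> real \<Rightarrow> real"
  assumes p: "continuous_on UNIV p" "continuous_on UNIV p'"
      "\<And>u x. ((\<lambda>y. p (u, y)) has_real_derivative p' (u, x)) (at x)"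
    and d: "continuous_on UNIV d" "continuous_on UNIV d'"
      "\<And>u x. ((\<lambda>y. d (u, y)) has_real_derivative d' (u, x)) (at x)"
    and K: "compact K" "\<And>z. z \<notin> K \<Longrightarrow> d z = 0" "\<And>z. z \<notin> K \<Longrightarrow> d' z = 0"
  shows "(LINT z:{0..1} \<times> UNIV|lborel. p z * d' z) = - (LINT z:{0..1} \<times> UNIV|lborel. p' z * d z)"
proof -
  have i1: "set_integrable lborel ({0..1} \<times> UNIV) (\<lambda>z. p z * d' z)"
    by (rule strip_integral_iterated(1)[OF _ K(1)]) (use p d K in \<open>auto intro!: continuous_intros\<close>)
  have i2: "set_integrable lborel ({0..1} \<times> UNIV) (\<lambda>z. p' z * d z)"
    by (rule strip_integral_iterated(1)[OF _ K(1)]) (use p d K in \<open>auto intro!: continuous_intros\<close>)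
  obtain R where R: "\<And>z. z \<in> K \<Longrightarrow> norm z \<le> R"
    using compact_imp_bounded[OF K(1)] by (auto simp: bounded_iff)
  have out: "(u, x) \<notin> K" if "R < \<bar>x\<bar>" for u x
    using R[of "(u, x)"] norm_snd_le[of x u] that by (auto simp: not_le[symmetric])
  have "(LINT z:{0..1} \<times> UNIV|lborel. p' z * d z + p z * d' z)
      = (LINT u:{0..1}|lborel. (LINT x|lborel. p' (u, x) * d (u, x) + p (u, x) * d' (u, x)))"
    by (rule strip_integral_iterated(2)[OF _ K(1)]) (use p d K in \<open>auto intro!: continuous_intros\<close>)
  also have "(LINT u:{0..1}|lborel. (LINT x|lborel. p' (u, x) * d (u, x) + p (u, x) * d' (u, x))) = 0"
  proof -
    have "(LINT x|lborel. p' (u, x) * d (u, x) + p (u, x) * d' (u, x)) = 0" for u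
    proof (rule integral_deriv_compact_support[where q = "\<lambda>x. p (u, x) * d (u, x)" and R = R])
      show "((\<lambda>x. p (u, x) * d (u, x)) has_real_derivative p' (u, x) * d (u, x) + p (u, x) * d' (u, x)) (at x)" for x
        using DERIV_mult[OF p(3)[of u x] d(3)[of u x]] by (simp add: algebra_simps)
      show "continuous_on UNIV (\<lambda>x. p' (u, x) * d (u, x) + p (u, x) * d' (u, x))"
        by (intro continuous_intros continuous_slices p d)
    qed (use out K in auto)
    thus ?thesis by simp
  qed
  finally have "(LINT z:{0..1} \<times> UNIV|lborel. p' z * d z) + (LINT z:{0..1} \<times> UNIV|lborel. p z * d' z) = 0"
    using set_integral_add(2)[OF i2 i1] by simp
  thus ?thesis by simp
qed

text \<open>
  Here \<open>\<alpha>\<close> is the distribution function of the point mass at \<open>1\<close>. The nonlinear term is then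
  supported on a null set, and \<open>f\<close>, the heat flow of \<open>ln cosh\<close>, is a classical solution for
  \<open>u < 1\<close>, continuous up to \<open>u = 1\<close> with a time derivative that extends continuously as well. Integrating
  \<open>\<partial>\<^sub>u (f D)\<close> over \<open>[0,1]\<close> leaves only the boundary term at \<open>u = 1\<close>, as the test function vanishes
  near \<open>u = 0\<close>.
\<close>

lemma parisi_solution_heat:
  "parisi_solution (\<lambda>u. if u < 1 then 0 else 1) \<beta>
    (\<lambda>z. heat_lncosh (\<beta> * sqrt (2 * (1 - fst z))) (snd z))"
proof -
  define s where "s = (\<lambda>u::real. \<beta> * sqrt (2 * (1 - u)))"
  define f where "f = (\<lambda>z. heat_lncosh (s (fst z)) (snd z))"
  define g where "g = (\<lambda>z. heat_tanh (s (fst z)) (snd z))"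
  define h where "h = (\<lambda>z. heat_sech2 (s (fst z)) (snd z))"
  have cs: "continuous_on UNIV (\<lambda>z::real\<times>real. (s (fst z), snd z))"
    unfolding s_def by (intro continuous_intros)
  have cf: "continuous_on UNIV f"
    using continuous_on_compose2[OF continuous_on_heat_lncosh cs] by (simp add: f_def)
  have cg: "continuous_on UNIV g"
    using continuous_on_compose2[OF continuous_on_heat_tanh cs] by (simp add: g_def)
  have ch: "continuous_on UNIV h"
    using continuous_on_compose2[OF continuous_on_heat_sech2 cs] by (simp add: h_def)
  have fg: "((\<lambda>y. f (u, y)) has_real_derivative g (u, x)) (at x)" for u x
    unfolding f_def g_def by (simp add: heat_lncosh_dx)
  have gh: "((\<lambda>y. g (u, y)) has_real_derivative h (u, x)) (at x)" for u x
    unfolding g_def h_def by (simp add: heat_tanh_dx)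
  have f1: "f (1, x) = ln (cosh x)" for x by (simp add: f_def s_def heat_lncosh_0)
  have fu: "((\<lambda>v. f (v, x)) has_real_derivative - \<beta>\<^sup>2 * h (u, x)) (at u)" if "u < 1" for u x
  proof -
    have pos: "0 < sqrt (2 * (1 - u))" using that by simp
    have "((\<lambda>v. \<beta> * sqrt (2 * (1 - v))) has_real_derivative - (\<beta> / sqrt (2 * (1 - u)))) (at u)"
      using that by (auto intro!: derivative_eq_intros simp: field_simps)
    from DERIV_chain2[OF heat_lncosh_ds this, of x]
    show ?thesis using pos by (simp add: f_def h_def s_def power2_eq_square mult_ac)
  qed
  have weak_dx: "(LINT z:{0..1} \<times> UNIV|lborel. f z * D 0 1 z) = - (LINT z:{0..1} \<times> UNIV|lborel. g z * D 0 0 z)"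
    if "test_jet {0<..<1} D" for D
  proof -
    from that obtain K where sm: "smooth_jet D" and K: "compact K" "\<And>z. z \<notin> K \<Longrightarrow> D 0 0 z = 0"
      unfolding test_jet_def by blast
    show ?thesis
      by (rule strip_integration_by_parts_x[OF cf cg fg _ _ _ K(1)])
        (use sm jet_vanish[OF sm compact_imp_closed[OF K(1)] K(2)] in \<open>auto simp: smooth_jet_def\<close>)
  qed
  have weak: "(LINT z:{0..1} \<times> UNIV|lborel. - f z * D 1 0 z
          + \<beta>\<^sup>2 * (f z * D 0 2 z + (if fst z < 1 then 0 else 1) * (g z)\<^sup>2 * D 0 0 z))
      + (LINT x|lborel. ln (cosh x) * D 0 0 (1, x)) = 0"
    if test: "test_jet {0<..} D" for D
  proof -
    from test obtain K where sm: "smooth_jet D" and K: "compact K" "K \<subseteq> {0<..} \<times> UNIV"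
        "\<And>z. z \<notin> K \<Longrightarrow> D 0 0 z = 0"
      unfolding test_jet_def by blast
    have D0: "D i j z = 0" if "z \<notin> K" for i j z
      by (rule jet_vanish[OF sm compact_imp_closed[OF K(1)] K(3) that])
    have cD: "continuous_on UNIV (D i j)" for i j using sm by (auto simp: smooth_jet_def)
    have Dx: "((\<lambda>y. D i j (u, y)) has_real_derivative D i (Suc j) (u, x)) (at x)" for i j u x
      using sm by (auto simp: smooth_jet_def)
    have Du: "((\<lambda>v. D i j (v, x)) has_real_derivative D (Suc i) j (u, x)) (at u)" for i j u x
      using sm by (auto simp: smooth_jet_def)
    let ?S = "{0..1} \<times> (UNIV :: real set)"
    have int: "set_integrable lborel ?S (\<lambda>z. p z * D i j z)" if "continuous_on UNIV p" for p i j
      by (rule strip_integral_iterated(1)[OF _ K(1)]) (use that cD D0 in \<open>auto intro!: continuous_intros\<close>)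
    \<comment> \<open>The nonlinear term lives on the null set \<open>u = 1\<close>.\<close>
    have "(LINT z:?S|lborel. - f z * D 1 0 z
          + \<beta>\<^sup>2 * (f z * D 0 2 z + (if fst z < 1 then 0 else 1) * (g z)\<^sup>2 * D 0 0 z))
        = (LINT z:?S|lborel. \<beta>\<^sup>2 * (f z * D 0 2 z) - f z * D 1 0 z)"
      unfolding set_lebesgue_integral_def
    proof (rule integral_cong_AE)
      have [measurable]: "f \<in> borel_measurable borel" "g \<in> borel_measurable borel" "D i j \<in> borel_measurable borel" for i j
        using cf cg cD by (auto intro: borel_measurable_continuous_onI)
      have [measurable]: "fst \<in> borel_measurable (borel :: (real \<times> real) measure)"
        by (intro borel_measurable_continuous_onI continuous_intros)
      have [measurable]: "{0..1::real} \<times> (UNIV :: real set) \<in> sets borel"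
        by (intro borel_closed closed_Times) auto
      show "(\<lambda>z. indicator ?S z *\<^sub>R (- f z * D 1 0 z
          + \<beta>\<^sup>2 * (f z * D 0 2 z + (if fst z < 1 then 0 else 1) * (g z)\<^sup>2 * D 0 0 z))) \<in> borel_measurable lborel"
        by measurable
      show "(\<lambda>z. indicator ?S z *\<^sub>R (\<beta>\<^sup>2 * (f z * D 0 2 z) - f z * D 1 0 z)) \<in> borel_measurable lborel"
        by measurable
      have "AE z in lborel. z \<bullet> (1::real, 0::real) \<noteq> 1"
        by (rule AE_lborel_inner_neq) (auto simp: Basis_prod_def)
      thus "AE z in lborel. indicator ?S z *\<^sub>R (- f z * D 1 0 z
          + \<beta>\<^sup>2 * (f z * D 0 2 z + (if fst z < 1 then 0 else 1) * (g z)\<^sup>2 * D 0 0 z))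
          = indicator ?S z *\<^sub>R (\<beta>\<^sup>2 * (f z * D 0 2 z) - f z * D 1 0 z)"
        by eventually_elim (auto simp: indicator_def inner_prod_def)
    qed
    also have "\<dots> = \<beta>\<^sup>2 * (LINT z:?S|lborel. f z * D 0 2 z) - (LINT z:?S|lborel. f z * D 1 0 z)"
      using int[OF cf] by simp
    also have "(LINT z:?S|lborel. f z * D 0 2 z) = - (LINT z:?S|lborel. g z * D 0 1 z)"
      by (rule strip_integration_by_parts_x[OF cf cg fg _ _ _ K(1)])
        (use cD D0 Dx[of 0 1] in \<open>auto simp: numeral_2_eq_2\<close>)
    also have "(LINT z:?S|lborel. g z * D 0 1 z) = - (LINT z:?S|lborel. h z * D 0 0 z)"
      by (rule strip_integration_by_parts_x[OF cg ch gh _ _ _ K(1)])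
        (use cD D0 Dx[of 0 0] in auto)
    finally have A: "(LINT z:?S|lborel. - f z * D 1 0 z
          + \<beta>\<^sup>2 * (f z * D 0 2 z + (if fst z < 1 then 0 else 1) * (g z)\<^sup>2 * D 0 0 z))
        = \<beta>\<^sup>2 * (LINT z:?S|lborel. h z * D 0 0 z) - (LINT z:?S|lborel. f z * D 1 0 z)" by simp
    have "(LINT z:?S|lborel. f z * D 1 0 z) - \<beta>\<^sup>2 * (LINT z:?S|lborel. h z * D 0 0 z)
        = (LINT z:?S|lborel. f z * D 1 0 z - \<beta>\<^sup>2 * (h z * D 0 0 z))"
      using int[OF cf] int[OF ch] by simp
    also have "\<dots> = (LINT x|lborel. (LINT u:{0..1}|lborel. f (u, x) * D 1 0 (u, x) - \<beta>\<^sup>2 * (h (u, x) * D 0 0 (u, x))))"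
      by (rule strip_integral_iterated(3)[OF _ K(1)]) (use cf ch cD D0 in \<open>auto intro!: continuous_intros\<close>)
    also have "\<dots> = (LINT x|lborel. ln (cosh x) * D 0 0 (1, x))"
    proof (rule Bochner_Integration.integral_cong)
      fix x :: real
      let ?r = "\<lambda>u. f (u, x) * D 1 0 (u, x) - \<beta>\<^sup>2 * (h (u, x) * D 0 0 (u, x))"
      have cr: "continuous_on {0..1} ?r"
        by (intro continuous_intros continuous_slices cf ch cD)
      have "set_integrable lborel {0..1} ?r"
        by (rule borel_integrable_atLeastAtMost'[OF cr])
      hence "(LINT u:{0..1}|lborel. ?r u) = integral {0..1} ?r"
        by (rule set_borel_integral_eq_integral(2))
      also have "\<dots> = f (1, x) * D 0 0 (1, x) - f (0, x) * D 0 0 (0, x)"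
      proof (rule integral_unique, rule fundamental_theorem_of_calculus_interior)
        show "continuous_on {0..1} (\<lambda>u. f (u, x) * D 0 0 (u, x))"
          by (intro continuous_intros continuous_slices cf cD)
        fix u :: real assume "u \<in> {0<..<1}"
        hence "((\<lambda>u. f (u, x) * D 0 0 (u, x)) has_real_derivative ?r u) (at u)"
          using DERIV_mult[OF fu[of u x] Du[of 0 0 x u]] by (simp add: algebra_simps)
        thus "((\<lambda>u. f (u, x) * D 0 0 (u, x)) has_vector_derivative ?r u) (at u)"
          by (simp add: has_real_derivative_iff_has_vector_derivative)
      qed simp
      also have "D 0 0 (0, x) = 0" using K(2) by (intro D0) auto
      finally show "(LINT u:{0..1}|lborel. ?r u) = ln (cosh x) * D 0 0 (1, x)"
        by (simp add: f1)
    qed simp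
    finally show ?thesis using A by simp
  qed
  have "bounded_weak_dx f g"
    unfolding bounded_weak_dx_def
    using weak_dx abs_heat_tanh_le_1 cg
    by (auto intro!: exI[of _ 1] borel_measurable_continuous_onI simp: g_def)
  hence "parisi_solution (\<lambda>u. if u < 1 then 0 else 1) \<beta> f"
    unfolding parisi_solution_def
    using weak f1 continuous_on_subset[OF cf] by (auto intro!: exI[of _ g])
  thus ?thesis by (simp add: f_def s_def)
qed

lemma cdf_point_mass_one: "cdf_unit_interval (\<lambda>u. if u < 1 then 0 else 1)"
  unfolding cdf_unit_interval_def
proof (intro conjI ballI)
  fix u :: real assume "u \<in> {0..<1}"
  hence "\<forall>\<^sub>F v in at_right u. (if v < 1 then 0 else 1) = (0::real)"
    by (auto simp: eventually_at_right_field intro!: exI[of _ 1])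
  thus "continuous (at_right u) (\<lambda>u. if u < 1 then 0 else 1 :: real)"
    using \<open>u \<in> {0..<1}\<close> by (auto simp: continuous_within intro!: tendsto_eventually)
qed (auto simp: mono_on_def)

lemma parisi_functional_heat:
  "parisi_functional (\<lambda>u. if u < 1 then 0 else 1) \<beta>
    (\<lambda>z. heat_lncosh (\<beta> * sqrt (2 * (1 - fst z))) (snd z)) = heat_lncosh (\<beta> * sqrt 2) 0"
proof -
  have "(LINT u:{0..1}|lborel. (if u < 1 then 0 else 1) * u) = (LINT u|lborel. (0::real) * (u::real))"
    unfolding set_lebesgue_integral_def
  proof (rule integral_cong_AE)
    have "AE u in lborel. u \<noteq> (1::real)" by (rule AE_lborel_singleton)
    thus "AE u in lborel. indicator {0..1} u *\<^sub>R ((if u < 1 then 0 else 1) * u) = (0::real) * u"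
      by eventually_elim (auto simp: indicator_def)
  qed auto
  thus ?thesis by (simp add: parisi_functional_def)
qed

section \<open>Linear functions of independent Gaussians\<close>

abbreviation gauss_product :: "'i set \<Rightarrow> ('i \<Rightarrow> real) measure" where
  "gauss_product I \<equiv> Pi\<^sub>M I (\<lambda>_. std_normal_distribution)"

lemma prob_space_gauss_product: "prob_space (gauss_product I)"
  by (intro prob_space_PiM std_normal_prob)

lemma coordinate_measurable:
  "p \<in> I \<Longrightarrow> (\<lambda>G. G p) \<in> borel_measurable (gauss_product I)"
  using measurable_component_singleton[of p I "\<lambda>_. std_normal_distribution"]
  by (simp cong: measurable_cong_sets)

lemma distr_coordinate:
  assumes "finite I" "p \<in> I"
  shows "distr (gauss_product I) borel (\<lambda>G. G p) = std_normal_distribution"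
proof -
  have "distr (gauss_product I) std_normal_distribution (\<lambda>G. G p) = std_normal_distribution"
    using distr_PiM_component[of I "\<lambda>_. std_normal_distribution" p] std_normal_prob assms by auto
  moreover have "distr (gauss_product I) std_normal_distribution (\<lambda>G. G p) = distr (gauss_product I) borel (\<lambda>G. G p)"
    by (rule distr_cong) auto
  ultimately show ?thesis by simp
qed

lemma coordinates_indep:
  assumes "finite I" "I \<noteq> {}"
  shows "prob_space.indep_vars (gauss_product I) (\<lambda>_. borel) (\<lambda>p G. G p) I"
proof -
  interpret prob_space "gauss_product I" by (rule prob_space_gauss_product)
  have "distr (gauss_product I) (Pi\<^sub>M I (\<lambda>_. borel)) (\<lambda>G. \<lambda>p\<in>I. G p) = gauss_product I"
  proof -
    have "distr (gauss_product I) (Pi\<^sub>M I (\<lambda>_. borel)) (\<lambda>G. \<lambda>p\<in>I. G p) =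
        distr (gauss_product I) (gauss_product I) (\<lambda>G. G)"
    proof (rule distr_cong)
      show "sets (Pi\<^sub>M I (\<lambda>_. borel)) = sets (gauss_product I)" by (intro sets_PiM_cong) auto
      fix G assume "G \<in> space (gauss_product I)"
      thus "(\<lambda>p\<in>I. G p) = G" by (auto simp: space_PiM PiE_def extensional_restrict)
    qed simp
    thus ?thesis by simp
  qed
  also have "gauss_product I = Pi\<^sub>M I (\<lambda>p. distr (gauss_product I) borel (\<lambda>G. G p))"
    by (rule PiM_cong) (simp_all add: distr_coordinate[OF assms(1)])
  finally show ?thesis
    by (subst indep_vars_iff_distr_eq_PiM'[OF assms(2)]) (simp_all add: coordinate_measurable)
qed

lemma coordinate_distributed:
  assumes "finite I" "p \<in> I"
  shows "distributed (gauss_product I) lborel (\<lambda>G. G p) (normal_density 0 1)"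
  unfolding distributed_def
  using distr_coordinate[OF assms] coordinate_measurable[OF assms(2)]
  by (simp cong: distr_cong)

lemma scaled_gauss_distributed:
  assumes "0 < \<sigma>"
  shows "distributed std_normal_distribution lborel (\<lambda>g. \<sigma> * g) (normal_density 0 \<sigma>)"
proof -
  have "distributed std_normal_distribution lborel (\<lambda>g. g) (normal_density 0 1)"
    unfolding distributed_def by (simp add: distr_id2 cong: distr_cong)
  from gauss.normal_density_affine[OF this, of \<sigma> 0] assms show ?thesis by simp
qed

lemma signed_sum_distributed:
  assumes I: "finite I" and J: "J \<subseteq> I" "J \<noteq> {}" and \<epsilon>: "\<And>p. p \<in> J \<Longrightarrow> \<bar>\<epsilon> p\<bar> = 1"
  shows "distributed (gauss_product I) lborel (\<lambda>G. \<Sum>p\<in>J. \<epsilon> p * G p) (normal_density 0 (sqrt (card J)))"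
proof -
  interpret prob_space "gauss_product I" by (rule prob_space_gauss_product)
  have fin: "finite J" using I J finite_subset by blast
  have "distributed (gauss_product I) lborel (\<lambda>G. \<Sum>p\<in>J. \<epsilon> p * G p)
      (normal_density (\<Sum>p\<in>J. 0) (sqrt (\<Sum>p\<in>J. 1\<^sup>2)))"
  proof (rule sum_indep_normal[OF fin J(2)])
    have "indep_vars (\<lambda>_. borel) (\<lambda>p G. G p) J"
      by (rule indep_vars_subset[OF coordinates_indep[OF I] J(1)]) (use J in auto)
    from indep_vars_compose2[OF this, of "\<lambda>p x. \<epsilon> p * x" "\<lambda>_. borel"]
    show "indep_vars (\<lambda>_. borel) (\<lambda>p G. \<epsilon> p * G p) J" by simp
    fix p assume p: "p \<in> J"
    have "\<epsilon> p \<noteq> 0" using \<epsilon>[OF p] by auto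
    from normal_density_affine[OF coordinate_distributed[OF I] _ this, of p 0] p J \<epsilon>[OF p]
    show "distributed (gauss_product I) lborel (\<lambda>G. \<epsilon> p * G p) (normal_density 0 1)" by auto
  qed simp
  thus ?thesis by simp
qed

text \<open>
  A sum of independent standard Gaussians with signs has the law of \<open>sqrt (card J) * g\<close>.
\<close>

lemma signed_sum_integral:
  fixes F :: "real \<Rightarrow> real"
  assumes I: "finite I" and J: "J \<subseteq> I" and \<epsilon>: "\<And>p. p \<in> J \<Longrightarrow> \<bar>\<epsilon> p\<bar> = 1"
    and F[measurable]: "F \<in> borel_measurable borel"
  shows "(LINT G|gauss_product I. F (\<Sum>p\<in>J. \<epsilon> p * G p)) =
      (LINT g|std_normal_distribution. F (sqrt (card J) * g))"
    and "integrable (gauss_product I) (\<lambda>G. F (\<Sum>p\<in>J. \<epsilon> p * G p)) \<longleftrightarrow>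
      integrable std_normal_distribution (\<lambda>g. F (sqrt (card J) * g))"
proof -
  interpret prob_space "gauss_product I" by (rule prob_space_gauss_product)
  have *: "(LINT G|gauss_product I. F (\<Sum>p\<in>J. \<epsilon> p * G p)) =
      (LINT g|std_normal_distribution. F (sqrt (card J) * g)) \<and>
      (integrable (gauss_product I) (\<lambda>G. F (\<Sum>p\<in>J. \<epsilon> p * G p)) \<longleftrightarrow>
      integrable std_normal_distribution (\<lambda>g. F (sqrt (card J) * g)))"
  proof (cases "J = {}")
    case True
    thus ?thesis using prob_space by simp
  next
    case False
    have "0 < card J" using False I J finite_subset card_gt_0_iff by blast
    hence pos: "0 < sqrt (card J)" by simp
    note d = signed_sum_distributed[OF I J False \<epsilon>] scaled_gauss_distributed[OF pos]
    have "(LINT G|gauss_product I. F (\<Sum>p\<in>J. \<epsilon> p * G p)) = (LINT x|lborel. normal_density 0 (sqrt (card J)) x * F x)"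
      "(LINT g|std_normal_distribution. F (sqrt (card J) * g)) = (LINT x|lborel. normal_density 0 (sqrt (card J)) x * F x)"
      using distributed_integral[OF d(1), where g = F] distributed_integral[OF d(2), where g = F] by simp_all
    moreover have "integrable (gauss_product I) (\<lambda>G. F (\<Sum>p\<in>J. \<epsilon> p * G p)) \<longleftrightarrow>
        integrable lborel (\<lambda>x. normal_density 0 (sqrt (card J)) x * F x)"
      "integrable std_normal_distribution (\<lambda>g. F (sqrt (card J) * g)) \<longleftrightarrow>
        integrable lborel (\<lambda>x. normal_density 0 (sqrt (card J)) x * F x)"
      using distributed_integrable[OF d(1), where g = F] distributed_integrable[OF d(2), where g = F] by simp_all
    ultimately show ?thesis by simp
  qed
  from * show "(LINT G|gauss_product I. F (\<Sum>p\<in>J. \<epsilon> p * G p)) =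
      (LINT g|std_normal_distribution. F (sqrt (card J) * g))"
    and "integrable (gauss_product I) (\<lambda>G. F (\<Sum>p\<in>J. \<epsilon> p * G p)) \<longleftrightarrow>
      integrable std_normal_distribution (\<lambda>g. F (sqrt (card J) * g))" by auto
qed

lemma coordinate_integrable:
  assumes "finite I" "p \<in> I"
  shows "integrable (gauss_product I) (\<lambda>G. G p)" "(LINT G|gauss_product I. G p) = 0"
    "integrable (gauss_product I) (\<lambda>G. \<bar>G p\<bar>)"
proof -
  have a: "integrable std_normal_distribution (\<lambda>g::real. g)"
  proof (rule Bochner_Integration.integrable_bound[OF gauss_integrable_abs])
    show "AE g in std_normal_distribution. norm g \<le> norm \<bar>g\<bar>" by (rule AE_I2) simp
  qed simp
  have b: "(LINT g|std_normal_distribution. g) = 0"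
    by (rule trans[OF gauss_integral])
      (use has_bochner_integral_integral_eq[OF std_normal_moment_odd[of 0]] in simp_all)
  have sub: "{p} \<subseteq> I" using assms(2) by simp
  note s = signed_sum_integral[OF assms(1) sub, of "\<lambda>_. 1" "\<lambda>x. x", simplified]
  show i: "integrable (gauss_product I) (\<lambda>G. G p)" using s(2) a by simp
  show "(LINT G|gauss_product I. G p) = 0" using s(1) b by simp
  show "integrable (gauss_product I) (\<lambda>G. \<bar>G p\<bar>)" by (rule integrable_abs[OF i])
qed

lemma gauss_exponential_moment:
  "integrable std_normal_distribution (\<lambda>g. exp (a * g))"
  "(LINT g|std_normal_distribution. exp (a * g)) = exp (a\<^sup>2 / 2)"
proof -
  have eq: "std_normal_density x * exp (a * x) = exp (a\<^sup>2 / 2) * normal_density a 1 x" for x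
  proof -
    have "- x\<^sup>2 / 2 + a * x = a\<^sup>2 / 2 + - (x - a)\<^sup>2 / 2"
      by (simp add: power2_eq_square field_simps)
    hence "exp (- x\<^sup>2 / 2) * exp (a * x) = exp (a\<^sup>2 / 2) * exp (- (x - a)\<^sup>2 / 2)"
      by (simp only: exp_add[symmetric])
    thus ?thesis by (simp add: normal_density_def)
  qed
  show "integrable std_normal_distribution (\<lambda>g. exp (a * g))"
    by (subst gauss_integrable_iff) (auto simp: eq)
  show "(LINT g|std_normal_distribution. exp (a * g)) = exp (a\<^sup>2 / 2)"
    by (subst gauss_integral) (auto simp: eq)
qed

text \<open>
  The conditions on restrictions say that \<open>p\<close> and \<open>q\<close> look only at the coordinates in \<open>A\<close> and \<open>B\<close>.
\<close>

lemma indep_blocks_integral: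
  fixes p q :: "('i \<Rightarrow> real) \<Rightarrow> real"
  assumes I: "finite I" "I \<noteq> {}" and AB: "A \<subseteq> I" "B \<subseteq> I" "A \<inter> B = {}"
    and p: "p \<in> borel_measurable (Pi\<^sub>M A (\<lambda>_. borel))" "\<And>G. p (restrict G A) = p G"
    and q: "q \<in> borel_measurable (Pi\<^sub>M B (\<lambda>_. borel))" "\<And>G. q (restrict G B) = q G"
    and int: "integrable (gauss_product I) p" "integrable (gauss_product I) q"
  shows "integrable (gauss_product I) (\<lambda>G. p G * q G)"
    "(LINT G|gauss_product I. p G * q G) = (LINT G|gauss_product I. p G) * (LINT G|gauss_product I. q G)"
proof -
  interpret prob_space "gauss_product I" by (rule prob_space_gauss_product)
  have "indep_var (Pi\<^sub>M A (\<lambda>_. borel)) (\<lambda>G. restrict (\<lambda>i. G i) A) (Pi\<^sub>M B (\<lambda>_. borel)) (\<lambda>G. restrict (\<lambda>i. G i) B)"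
    using indep_var_restrict[OF coordinates_indep[OF I] AB(3,1,2)] by simp
  from indep_var_compose[OF this p(1) q(1)]
  have "indep_var borel p borel q" by (simp add: comp_def p(2) q(2))
  from indep_var_integrable[OF this int] indep_var_lebesgue_integral[OF this int]
  show "integrable (gauss_product I) (\<lambda>G. p G * q G)"
    "(LINT G|gauss_product I. p G * q G) = (LINT G|gauss_product I. p G) * (LINT G|gauss_product I. q G)" .
qed

section \<open>Adding one spin\<close>

text \<open>
  The energy of the first \<open>n\<close> spins with a coupling strength \<open>\<gamma>\<close> that does not depend on \<open>n\<close>. For
  \<open>\<gamma> = \<beta> / sqrt N\<close> and \<open>n = N\<close> it is \<open>\<beta>\<close> times the Hamiltonian.
\<close>

definition partial_energy :: "real \<Rightarrow> nat \<Rightarrow> (nat \<times> nat \<Rightarrow> real) \<Rightarrow> (nat \<Rightarrow> real) \<Rightarrow> real" where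
  "partial_energy \<gamma> n G t = \<gamma> * (\<Sum>i = 1..n. \<Sum>j = 1..n. G (i, j) * t i * t j)"

definition partial_partition :: "real \<Rightarrow> nat \<Rightarrow> (nat \<times> nat \<Rightarrow> real) \<Rightarrow> real" where
  "partial_partition \<gamma> n G = (\<Sum>t\<in>sk_configs n. exp (partial_energy \<gamma> n G t))"

definition new_bonds :: "nat \<Rightarrow> (nat \<times> nat) set" where
  "new_bonds n = (\<lambda>i. (i, Suc n)) ` {1..n} \<union> (\<lambda>i. (Suc n, i)) ` {1..n}"

text \<open>
  The smaller index of a bond to the spin \<open>n + 1\<close> is that of the old spin.
\<close>

definition local_field :: "nat \<Rightarrow> (nat \<times> nat \<Rightarrow> real) \<Rightarrow> (nat \<Rightarrow> real) \<Rightarrow> real" where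
  "local_field n G t = (\<Sum>p\<in>new_bonds n. t (min (fst p) (snd p)) * G p)"

lemma sum_new_bonds:
  "(\<Sum>p\<in>new_bonds n. \<phi> p) = (\<Sum>i=1..n. \<phi> (i, Suc n)) + (\<Sum>i=1..n. \<phi> (Suc n, i))" for \<phi> :: "_ \<Rightarrow> real"
  unfolding new_bonds_def
  by (subst sum.union_disjoint) (auto simp: sum.reindex inj_on_def)

lemma card_new_bonds: "card (new_bonds n) = 2 * n"
  unfolding new_bonds_def
  by (subst card_Un_disjoint) (auto simp: card_image inj_on_def)

lemma finite_sk_configs: "finite (sk_configs n)"
  unfolding sk_configs_def by (intro finite_PiE) auto

lemma sk_configs_abs: "t \<in> sk_configs n \<Longrightarrow> i \<in> {1..n} \<Longrightarrow> \<bar>t i\<bar> = 1"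
  unfolding sk_configs_def using PiE_mem[of t "{1..n}" "\<lambda>_. {-1, 1}" i] by auto

lemma card_sk_configs: "card (sk_configs n) = 2 ^ n"
  unfolding sk_configs_def by (simp add: card_PiE) (simp add: numeral_2_eq_2)

lemma sum_sk_configs_Suc:
  "(\<Sum>t\<in>sk_configs (Suc n). \<phi> t) = (\<Sum>t\<in>sk_configs n. \<phi> (t(Suc n := 1)) + \<phi> (t(Suc n := -1)))"
  for \<phi> :: "_ \<Rightarrow> real"
proof -
  have ins: "{1..Suc n} = insert (Suc n) {1..n}" by auto
  have "sk_configs (Suc n) = (\<lambda>(y, g). g(Suc n := y)) ` ({-1, 1} \<times> sk_configs n)"
    unfolding sk_configs_def ins by (simp add: PiE_insert_eq)
  moreover have inj: "inj_on (\<lambda>(y, g). g(Suc n := y)) ({-1, 1} \<times> sk_configs n)"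
    unfolding sk_configs_def using inj_combinator[of "Suc n" "{1..n}" "\<lambda>_. {-1, 1::real}"] by simp
  ultimately have "(\<Sum>t\<in>sk_configs (Suc n). \<phi> t) = (\<Sum>(y, g)\<in>{-1, 1} \<times> sk_configs n. \<phi> (g(Suc n := y)))"
    by (simp only: sum.reindex[OF inj]) (simp add: case_prod_beta comp_def)
  also have "\<dots> = (\<Sum>y\<in>{-1, 1}. \<Sum>g\<in>sk_configs n. \<phi> (g(Suc n := y)))"
    by (simp add: sum.cartesian_product)
  finally show ?thesis by (simp add: sum.distrib)
qed

lemma partial_energy_Suc:
  assumes s: "s = 1 \<or> s = -1"
  shows "partial_energy \<gamma> (Suc n) G (t(Suc n := s)) =
    partial_energy \<gamma> n G t + \<gamma> * G (Suc n, Suc n) + s * (\<gamma> * local_field n G t)"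
proof -
  have "(\<Sum>i = 1..Suc n. \<Sum>j = 1..Suc n. G (i, j) * (t(Suc n := s)) i * (t(Suc n := s)) j) =
      (\<Sum>i = 1..n. (\<Sum>j = 1..n. G (i, j) * t i * t j) + G (i, Suc n) * t i * s)
      + ((\<Sum>j = 1..n. G (Suc n, j) * s * t j) + G (Suc n, Suc n) * s * s)"
    by (simp add: sum.cl_ivl_Suc)
  also have "\<dots> = (\<Sum>i = 1..n. \<Sum>j = 1..n. G (i, j) * t i * t j) + G (Suc n, Suc n)
      + s * local_field n G t"
  proof -
    have "s * s = 1" using s by auto
    moreover have "s * local_field n G t = (\<Sum>i=1..n. G (i, Suc n) * t i * s) + (\<Sum>j=1..n. G (Suc n, j) * s * t j)"
      unfolding local_field_def sum_new_bonds distrib_left sum_distrib_left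
      by (intro arg_cong2[of _ _ _ _ "(+)"] sum.cong) auto
    ultimately show ?thesis by (simp add: sum.distrib mult.assoc)
  qed
  finally show ?thesis by (simp add: partial_energy_def algebra_simps)
qed

lemma partial_partition_Suc:
  "partial_partition \<gamma> (Suc n) G =
    2 * exp (\<gamma> * G (Suc n, Suc n)) *
      (\<Sum>t\<in>sk_configs n. exp (partial_energy \<gamma> n G t) * cosh (\<gamma> * local_field n G t))"
proof -
  have "exp (E + g + c) + exp (E + g - c) = 2 * exp g * (exp E * cosh c)" for E g c :: real
    by (simp add: cosh_field_def exp_add exp_diff exp_minus field_simps)
  thus ?thesis
    unfolding partial_partition_def sum_sk_configs_Suc
    by (simp add: partial_energy_Suc sum_distrib_left)
qed

lemma partial_partition_pos: "0 < partial_partition \<gamma> n G"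
proof -
  have "sk_configs n \<noteq> {}" using card_sk_configs[of n] by fastforce
  thus ?thesis unfolding partial_partition_def
    by (intro sum_pos finite_sk_configs) auto
qed

text \<open>
  Jensen's inequality for the logarithm and the weights \<open>a t / sum a S\<close>. It follows from
  \<open>ln y \<le> y - 1\<close>, applied to \<open>c t\<close> divided by its weighted mean.
\<close>

lemma ln_weighted_sum_ge:
  fixes a c :: "'a \<Rightarrow> real"
  assumes S: "finite S" and a: "\<And>t. t \<in> S \<Longrightarrow> 0 < a t" and c: "\<And>t. t \<in> S \<Longrightarrow> 0 < c t" and ne: "S \<noteq> {}"
  shows "ln (sum a S) + (\<Sum>t\<in>S. a t / sum a S * ln (c t)) \<le> ln (\<Sum>t\<in>S. a t * c t)"
proof -
  define A where "A = sum a S"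
  define m where "m = (\<Sum>t\<in>S. a t * c t) / A"
  have A: "0 < A" unfolding A_def using a by (intro sum_pos S ne) auto
  have AC: "0 < (\<Sum>t\<in>S. a t * c t)" using a c by (intro sum_pos S ne) auto
  have m: "0 < m" using A AC by (simp add: m_def)
  have "(\<Sum>t\<in>S. a t / A * ln (c t)) \<le> (\<Sum>t\<in>S. a t / A * (ln m + c t / m - 1))"
  proof (rule sum_mono)
    fix t assume t: "t \<in> S"
    have "ln (c t / m) \<le> c t / m - 1" using c[OF t] m by (intro ln_le_minus_one) auto
    hence "ln (c t) \<le> ln m + c t / m - 1" using c[OF t] m by (simp add: ln_div)
    thus "a t / A * ln (c t) \<le> a t / A * (ln m + c t / m - 1)"
      using a[OF t] A by (intro mult_left_mono) auto
  qed
  also have "\<dots> = (\<Sum>t\<in>S. a t / A * (ln m - 1) + a t * c t / A / m)"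
    by (intro sum.cong) (simp_all add: algebra_simps diff_divide_distrib add_divide_distrib)
  also have "\<dots> = (\<Sum>t\<in>S. a t) / A * (ln m - 1) + (\<Sum>t\<in>S. a t * c t) / A / m"
    by (simp add: sum_divide_distrib sum_distrib_right sum.distrib)
  also have "\<dots> = ln m" using A m unfolding A_def[symmetric] m_def[symmetric] by simp
  also have "\<dots> = ln (\<Sum>t\<in>S. a t * c t) - ln A" using A AC by (simp add: m_def ln_div)
  finally show ?thesis by (simp add: A_def)
qed

text \<open>
  The last sum is the Gibbs average of \<open>ln cosh\<close> of the field on the new spin. Here the
  logarithm has been moved inside the Gibbs average of \<open>cosh\<close>.
\<close>

lemma partial_partition_Suc_lower:
  "\<gamma> * G (Suc n, Suc n) + ln (1 / 2 ^ n * partial_partition \<gamma> n G)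
    + (\<Sum>t\<in>sk_configs n. exp (partial_energy \<gamma> n G t) / partial_partition \<gamma> n G
        * ln (cosh (\<gamma> * local_field n G t)))
    \<le> ln (1 / 2 ^ Suc n * partial_partition \<gamma> (Suc n) G)"
proof -
  have ne: "sk_configs n \<noteq> {}" using card_sk_configs[of n] by fastforce
  let ?S = "\<Sum>t\<in>sk_configs n. exp (partial_energy \<gamma> n G t) * cosh (\<gamma> * local_field n G t)"
  have S: "0 < ?S" by (intro sum_pos finite_sk_configs ne) auto
  have "1 / 2 ^ Suc n * partial_partition \<gamma> (Suc n) G = exp (\<gamma> * G (Suc n, Suc n)) * (1 / 2 ^ n * ?S)"
    by (simp add: partial_partition_Suc)
  hence "ln (1 / 2 ^ Suc n * partial_partition \<gamma> (Suc n) G) = \<gamma> * G (Suc n, Suc n) + (ln (1 / 2 ^ n) + ln ?S)"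
    using S by (simp only: ln_mult ln_exp exp_gt_zero zero_less_mult_iff zero_less_divide_iff) 
      (simp add: ln_mult)
  moreover have "ln (1 / 2 ^ n * partial_partition \<gamma> n G) = ln (1 / 2 ^ n) + ln (partial_partition \<gamma> n G)"
    using partial_partition_pos[of \<gamma> n G] by (intro ln_mult_pos) auto
  moreover have "ln (partial_partition \<gamma> n G) + (\<Sum>t\<in>sk_configs n. exp (partial_energy \<gamma> n G t) / partial_partition \<gamma> n G
        * ln (cosh (\<gamma> * local_field n G t))) \<le> ln ?S"
    unfolding partial_partition_def by (rule ln_weighted_sum_ge[OF finite_sk_configs _ _ ne]) auto
  ultimately show ?thesis by simp
qed


section \<open>The free energy of the first spins\<close>

text \<open>
  All these energies are functions of the couplings of the full system of \<open>N\<close> spins, so that they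
  can be compared on a single probability space.
\<close>

definition partial_free_energy :: "real \<Rightarrow> nat \<Rightarrow> nat \<Rightarrow> real" where
  "partial_free_energy \<gamma> N n =
    (LINT G|gauss_product ({1..N} \<times> {1..N}). ln (1 / 2 ^ n * partial_partition \<gamma> n G))"

lemma partial_energy_measurable:
  assumes "\<And>p. p \<in> {1..n} \<times> {1..n} \<Longrightarrow> (\<lambda>G. G p) \<in> borel_measurable M"
  shows "(\<lambda>G. partial_energy \<gamma> n G t) \<in> borel_measurable M"
proof -
  have "(\<lambda>G. G (i, j) * t i * t j) \<in> borel_measurable M" if "i \<in> {1..n}" "j \<in> {1..n}" for i j
    by (rule borel_measurable_times[OF borel_measurable_times[OF assms borel_measurable_const] borel_measurable_const])
      (use that in auto)
  hence "(\<lambda>G. \<Sum>i = 1..n. \<Sum>j = 1..n. G (i, j) * t i * t j) \<in> borel_measurable M"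
    by (intro borel_measurable_sum)
  thus ?thesis
    unfolding partial_energy_def by (rule borel_measurable_times[OF borel_measurable_const])
qed

lemma partial_partition_measurable:
  assumes "\<And>p. p \<in> {1..n} \<times> {1..n} \<Longrightarrow> (\<lambda>G. G p) \<in> borel_measurable M"
  shows "(\<lambda>G. partial_partition \<gamma> n G) \<in> borel_measurable M"
  unfolding partial_partition_def
proof (rule borel_measurable_sum)
  fix t
  show "(\<lambda>G. exp (partial_energy \<gamma> n G t)) \<in> borel_measurable M"
    by (rule measurable_compose[OF partial_energy_measurable[OF assms] borel_measurable_exp])
qed

lemma partial_energy_bound:
  assumes "t \<in> sk_configs n"
  shows "\<bar>partial_energy \<gamma> n G t\<bar> \<le> \<bar>\<gamma>\<bar> * (\<Sum>i = 1..n. \<Sum>j = 1..n. \<bar>G (i, j)\<bar>)"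
proof -
  have "\<bar>\<Sum>i = 1..n. \<Sum>j = 1..n. G (i, j) * t i * t j\<bar> \<le> (\<Sum>i = 1..n. \<Sum>j = 1..n. \<bar>G (i, j) * t i * t j\<bar>)"
    by (intro order_trans[OF sum_abs] sum_mono order_refl)
  also have "\<dots> = (\<Sum>i = 1..n. \<Sum>j = 1..n. \<bar>G (i, j)\<bar>)"
    using sk_configs_abs[OF assms] by (intro sum.cong) (simp_all add: abs_mult)
  finally show ?thesis unfolding partial_energy_def abs_mult by (intro mult_left_mono) auto
qed

lemma partial_log_partition_integrable:
  assumes "n \<le> N"
  shows "integrable (gauss_product ({1..N} \<times> {1..N})) (\<lambda>G. ln (1 / 2 ^ n * partial_partition \<gamma> n G))"
proof (rule Bochner_Integration.integrable_bound)
  let ?M = "gauss_product ({1..N} \<times> {1..N})"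
  let ?S = "\<lambda>G. \<bar>\<gamma>\<bar> * (\<Sum>i = 1..n. \<Sum>j = 1..n. \<bar>G (i, j)\<bar>)"
  show "integrable ?M ?S"
    using assms by (intro integrable_mult_right Bochner_Integration.integrable_sum coordinate_integrable) auto
  show "(\<lambda>G. ln (1 / 2 ^ n * partial_partition \<gamma> n G)) \<in> borel_measurable ?M"
    using assms
    by (intro borel_measurable_ln borel_measurable_times borel_measurable_const
        partial_partition_measurable coordinate_measurable) auto
  show "AE G in ?M. norm (ln (1 / 2 ^ n * partial_partition \<gamma> n G)) \<le> norm (?S G)"
  proof (rule AE_I2)
    fix G
    have Z: "0 < 1 / 2 ^ n * partial_partition \<gamma> n G" using partial_partition_pos[of \<gamma> n G] by simp
    have b: "partial_energy \<gamma> n G t \<le> ?S G" "- ?S G \<le> partial_energy \<gamma> n G t" if "t \<in> sk_configs n" for t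
      using partial_energy_bound[OF that, of \<gamma> G] by linarith+
    have "partial_partition \<gamma> n G \<le> (\<Sum>t\<in>sk_configs n. exp (?S G))"
      unfolding partial_partition_def using b(1) by (intro sum_mono) simp
    hence "1 / 2 ^ n * partial_partition \<gamma> n G \<le> exp (?S G)" by (simp add: card_sk_configs field_simps)
    hence u: "ln (1 / 2 ^ n * partial_partition \<gamma> n G) \<le> ?S G"
      using ln_le_cancel_iff[OF Z exp_gt_zero, of "?S G"] by simp
    have "(\<Sum>t\<in>sk_configs n. exp (- ?S G)) \<le> partial_partition \<gamma> n G"
      unfolding partial_partition_def using b(2) by (intro sum_mono) simp
    hence "exp (- ?S G) \<le> 1 / 2 ^ n * partial_partition \<gamma> n G" by (simp add: card_sk_configs field_simps)
    hence l: "- ?S G \<le> ln (1 / 2 ^ n * partial_partition \<gamma> n G)"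
      using ln_le_cancel_iff[OF exp_gt_zero Z, of "- ?S G"] by simp
    show "norm (ln (1 / 2 ^ n * partial_partition \<gamma> n G)) \<le> norm (?S G)"
      using u l unfolding real_norm_def by linarith
  qed
qed

lemma partial_energy_restrict: "partial_energy \<gamma> n (restrict G ({1..n} \<times> {1..n})) t = partial_energy \<gamma> n G t"
proof -
  have "(\<Sum>i = 1..n. \<Sum>j = 1..n. restrict G ({1..n} \<times> {1..n}) (i, j) * t i * t j) =
      (\<Sum>i = 1..n. \<Sum>j = 1..n. G (i, j) * t i * t j)"
    by (intro sum.cong refl) simp
  thus ?thesis unfolding partial_energy_def by (simp only:)
qed

text \<open>
  The Gibbs weights \<open>w\<close> of the first \<open>n\<close> spins depend on the couplings among these spins, the local
  field on the other ones. So the expectation of each product \<open>w q\<close> factorises; the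
  second factor does not depend on the configuration, and the weights sum to one.
\<close>

lemma partial_free_energy_Suc:
  assumes "Suc n \<le> N"
  shows "partial_free_energy \<gamma> N n + heat_lncosh (\<gamma> * sqrt (2 * real n)) 0 \<le> partial_free_energy \<gamma> N (Suc n)"
proof -
  let ?I = "{1..N} \<times> {1..N}" and ?A = "{1..n} \<times> {1..n}" and ?B = "new_bonds n"
  let ?M = "gauss_product ?I"
  define w where "w = (\<lambda>t G. exp (partial_energy \<gamma> n G t) / partial_partition \<gamma> n G)"
  define q where "q = (\<lambda>t G. ln (cosh (\<gamma> * local_field n G t)))"
  define L where "L = heat_lncosh (\<gamma> * sqrt (2 * real n)) 0"
  interpret prob_space ?M by (rule prob_space_gauss_product)
  have I: "finite ?I" "?I \<noteq> {}" using assms by auto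
  have AB: "?A \<subseteq> ?I" "?B \<subseteq> ?I" "?A \<inter> ?B = {}" using assms by (auto simp: new_bonds_def)
  have wZ: "(\<Sum>t\<in>sk_configs n. w t G) = 1" for G
    using partial_partition_pos[of \<gamma> n G]
    by (simp add: w_def sum_divide_distrib[symmetric] partial_partition_def[symmetric])
  have w0: "0 \<le> w t G" for t G using partial_partition_pos[of \<gamma> n G] by (simp add: w_def)
  have w1: "w t G \<le> 1" if "t \<in> sk_configs n" for t G
    using member_le_sum[OF that, of "\<lambda>t. w t G"] w0 wZ[of G] finite_sk_configs by auto
  have wmeas: "w t \<in> borel_measurable M'" if "\<And>p. p \<in> ?A \<Longrightarrow> (\<lambda>G. G p) \<in> borel_measurable M'" for t M'
    unfolding w_def
    by (intro borel_measurable_divide measurable_compose[OF partial_energy_measurable borel_measurable_exp]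
        partial_partition_measurable that)
  have wint: "integrable ?M (w t)" if "t \<in> sk_configs n" for t
  proof (rule integrable_const_bound[where B = 1])
    show "w t \<in> borel_measurable ?M"
      by (rule wmeas, rule coordinate_measurable, erule subsetD[OF AB(1)])
  qed (use w0 w1[OF that] in auto)
  have qint: "integrable ?M (q t)" and qval: "(LINT G|?M. q t G) = L" if "t \<in> sk_configs n" for t
  proof -
    have s: "\<bar>t (min (fst p) (snd p))\<bar> = 1" if "p \<in> ?B" for p
      using that by (intro sk_configs_abs[OF \<open>t \<in> sk_configs n\<close>]) (auto simp: new_bonds_def)
    have "integrable std_normal_distribution (\<lambda>g. ln (cosh (\<gamma> * (sqrt (card ?B) * g))))"
      using integrable_lncosh[of 0 "\<gamma> * sqrt (card ?B)"] by (simp add: mult.assoc)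
    thus "integrable ?M (q t)"
      unfolding q_def local_field_def
      by (subst signed_sum_integral(2)[where F = "\<lambda>y. ln (cosh (\<gamma> * y))" and
            \<epsilon> = "\<lambda>p. t (min (fst p) (snd p))", OF I(1) AB(2) s]) auto
    show "(LINT G|?M. q t G) = L"
      unfolding q_def local_field_def
      by (subst signed_sum_integral(1)[where F = "\<lambda>y. ln (cosh (\<gamma> * y))" and
            \<epsilon> = "\<lambda>p. t (min (fst p) (snd p))", OF I(1) AB(2) s])
        (auto simp: L_def heat_lncosh_def card_new_bonds mult.assoc)
  qed
  have wq: "integrable ?M (\<lambda>G. w t G * q t G) \<and> (LINT G|?M. w t G * q t G) = (LINT G|?M. w t G) * L"
    if t: "t \<in> sk_configs n" for t
  proof -
    have comp: "(\<lambda>G. G p) \<in> borel_measurable (Pi\<^sub>M S (\<lambda>_. borel :: real measure))" if "p \<in> S" for p and S :: "(nat \<times> nat) set"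
      using measurable_component_singleton[OF that, of "\<lambda>_. borel"] by simp
    have wr: "w t (restrict G ?A) = w t G" for G
      unfolding w_def partial_partition_def partial_energy_restrict ..
    have qr: "q t (restrict G ?B) = q t G" for G
      by (simp add: q_def local_field_def)
    have qm: "q t \<in> borel_measurable (Pi\<^sub>M ?B (\<lambda>_. borel))"
    proof -
      have "(\<lambda>G. \<gamma> * local_field n G t) \<in> borel_measurable (Pi\<^sub>M ?B (\<lambda>_. borel))"
        unfolding local_field_def
        by (intro borel_measurable_times borel_measurable_const borel_measurable_sum comp)
      thus ?thesis unfolding q_def by measurable
    qed
    show ?thesis
      using indep_blocks_integral[OF I AB wmeas[OF comp] wr qm qr wint[OF t] qint[OF t]] qval[OF t] by auto
  qed
  have g: "integrable ?M (\<lambda>G. \<gamma> * G (Suc n, Suc n))" "(LINT G|?M. \<gamma> * G (Suc n, Suc n)) = 0"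
    using coordinate_integrable[OF I(1), of "(Suc n, Suc n)"] assms by auto
  have iz: "integrable ?M (\<lambda>G. ln (1 / 2 ^ n * partial_partition \<gamma> n G))"
    "integrable ?M (\<lambda>G. ln (1 / 2 ^ Suc n * partial_partition \<gamma> (Suc n) G))"
    using assms by (intro partial_log_partition_integrable; simp)+
  have isum: "integrable ?M (\<lambda>G. \<Sum>t\<in>sk_configs n. w t G * q t G)"
    using wq by (intro Bochner_Integration.integrable_sum) auto
  have "(LINT G|?M. (\<Sum>t\<in>sk_configs n. w t G * q t G)) = (\<Sum>t\<in>sk_configs n. (LINT G|?M. w t G) * L)"
    using wq by (subst Bochner_Integration.integral_sum) auto
  also have "\<dots> = (LINT G|?M. (\<Sum>t\<in>sk_configs n. w t G)) * L"
    using wint by (subst Bochner_Integration.integral_sum) (auto simp: sum_distrib_right)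
  also have "\<dots> = L" by (simp add: wZ prob_space del: One_nat_def)
  finally have S: "(LINT G|?M. (\<Sum>t\<in>sk_configs n. w t G * q t G)) = L" .
  have "partial_free_energy \<gamma> N n + L = (LINT G|?M. \<gamma> * G (Suc n, Suc n) + ln (1 / 2 ^ n * partial_partition \<gamma> n G)
      + (\<Sum>t\<in>sk_configs n. w t G * q t G))"
    using g iz(1) isum S by (simp add: partial_free_energy_def)
  also have "\<dots> \<le> partial_free_energy \<gamma> N (Suc n)"
    unfolding partial_free_energy_def
  proof (rule integral_mono)
    show "\<gamma> * G (Suc n, Suc n) + ln (1 / 2 ^ n * partial_partition \<gamma> n G) + (\<Sum>t\<in>sk_configs n. w t G * q t G)
        \<le> ln (1 / 2 ^ Suc n * partial_partition \<gamma> (Suc n) G)" for G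
      unfolding w_def q_def by (rule partial_partition_Suc_lower)
  qed (use g iz isum in \<open>auto simp del: power_Suc\<close>)
  finally show ?thesis by (simp add: L_def)
qed

lemma partial_free_energy_ge_sum:
  "n \<le> N \<Longrightarrow> (\<Sum>m<n. heat_lncosh (\<gamma> * sqrt (2 * real m)) 0) \<le> partial_free_energy \<gamma> N n"
proof (induction n)
  case 0
  have "sk_configs 0 = {\<lambda>_. undefined}" by (simp add: sk_configs_def)
  thus ?case by (simp add: partial_free_energy_def partial_partition_def partial_energy_def)
next
  case (Suc n)
  thus ?case using partial_free_energy_Suc[of n N \<gamma>] by simp
qed

lemma sk_energy_eq: "\<beta> * sk_hamiltonian N G t = partial_energy (\<beta> / sqrt (real N)) N G t"
  by (simp add: sk_hamiltonian_def partial_energy_def)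

lemma sk_free_energy_eq:
  assumes "0 < \<beta>"
  shows "\<beta> * sk_free_energy N \<beta> = partial_free_energy (\<beta> / sqrt (real N)) N N"
  using assms
  by (simp add: sk_free_energy_def sk_disorder_def partial_free_energy_def partial_partition_def sk_energy_eq)

text \<open>
  Adding the spin \<open>n + 1\<close> gains \<open>L(\<beta> * sqrt (2 * n / N)) \<ge> L(\<beta>)\<close> as soon as \<open>2 * n \<ge> N\<close>. There are
  \<open>N - (N + 1) div 2\<close> such \<open>n < N\<close>, at least \<open>N / 3\<close> of them because \<open>N \<ge> 2\<close>.
\<close>

lemma sk_free_energy_lower:
  assumes \<beta>: "0 < \<beta>" and N: "2 \<le> N"
  shows "heat_lncosh \<beta> 0 / 3 \<le> \<beta> / real N * sk_free_energy N \<beta>"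
proof -
  let ?\<gamma> = "\<beta> / sqrt (real N)"
  have "real N / 3 * heat_lncosh \<beta> 0 \<le> real (card {(N + 1) div 2..<N}) * heat_lncosh \<beta> 0"
  proof (rule mult_right_mono[OF _ heat_lncosh_nonneg])
    have "N \<le> 3 * (N - (N + 1) div 2)" using N by presburger
    hence "real N \<le> real (3 * (N - (N + 1) div 2))" by (rule of_nat_mono)
    thus "real N / 3 \<le> real (card {(N + 1) div 2..<N})" by simp
  qed
  also have "\<dots> = (\<Sum>m\<in>{(N + 1) div 2..<N}. heat_lncosh \<beta> 0)" by simp
  also have "\<dots> \<le> (\<Sum>m\<in>{(N + 1) div 2..<N}. heat_lncosh (?\<gamma> * sqrt (2 * real m)) 0)"
  proof (rule sum_mono)
    fix m assume "m \<in> {(N + 1) div 2..<N}"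
    hence "N \<le> 2 * m" by auto
    hence "real N \<le> 2 * real m" by linarith
    hence "sqrt (real N) \<le> sqrt (2 * real m)" by simp
    hence "?\<gamma> * sqrt (real N) \<le> ?\<gamma> * sqrt (2 * real m)" using \<beta> by (intro mult_left_mono) auto
    thus "heat_lncosh \<beta> 0 \<le> heat_lncosh (?\<gamma> * sqrt (2 * real m)) 0"
      using \<beta> N by (intro heat_lncosh_mono) auto
  qed
  also have "\<dots> \<le> (\<Sum>m<N. heat_lncosh (?\<gamma> * sqrt (2 * real m)) 0)"
    by (rule sum_mono2) (auto simp: heat_lncosh_nonneg)
  also have "\<dots> \<le> \<beta> * sk_free_energy N \<beta>"
    unfolding sk_free_energy_eq[OF \<beta>] by (rule partial_free_energy_ge_sum) simp
  finally show ?thesis using N by (simp add: field_simps)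
qed

section \<open>Upper bounds for the free energy\<close>

text \<open>
  The inequality \<open>ln y \<le> y / c - 1 + ln c\<close>, with \<open>c\<close> the mean of \<open>y\<close>, is Jensen's inequality after
  taking expectations. Every energy is Gaussian with variance \<open>\<gamma>\<^sup>2 * N\<^sup>2\<close>.
\<close>

lemma partial_free_energy_annealed: "partial_free_energy \<gamma> N N \<le> \<gamma>\<^sup>2 * (real N)\<^sup>2 / 2"
proof -
  let ?I = "{1..N} \<times> {1..N}"
  let ?M = "gauss_product ?I"
  interpret prob_space ?M by (rule prob_space_gauss_product)
  define c where "c = exp (\<gamma>\<^sup>2 * (real N)\<^sup>2 / 2)"
  have moment: "integrable ?M (\<lambda>G. exp (partial_energy \<gamma> N G t)) \<and> (LINT G|?M. exp (partial_energy \<gamma> N G t)) = c"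
    if t: "t \<in> sk_configs N" for t
  proof -
    have s: "\<bar>t (fst p) * t (snd p)\<bar> = 1" if "p \<in> ?I" for p
      using that sk_configs_abs[OF t] by (auto simp: abs_mult)
    have e: "partial_energy \<gamma> N G t = \<gamma> * (\<Sum>p\<in>?I. (t (fst p) * t (snd p)) * G p)" for G
      unfolding partial_energy_def sum.cartesian_product by (simp add: case_prod_beta mult_ac)
    have "sqrt (real (card ?I)) = real N" by (simp add: real_sqrt_mult)
    hence m: "integrable std_normal_distribution (\<lambda>g. exp (\<gamma> * (sqrt (card ?I) * g)))"
      "(LINT g|std_normal_distribution. exp (\<gamma> * (sqrt (card ?I) * g))) = c"
      using gauss_exponential_moment[of "\<gamma> * real N"]
      by (simp_all add: mult.assoc c_def power_mult_distrib)
    show ?thesis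
      unfolding e using m signed_sum_integral[where F = "\<lambda>y. exp (\<gamma> * y)" and I = ?I and J = ?I and
          \<epsilon> = "\<lambda>p. t (fst p) * t (snd p)", OF _ order_refl s] by simp
  qed
  have Z: "integrable ?M (partial_partition \<gamma> N)" "(LINT G|?M. partial_partition \<gamma> N G) = 2 ^ N * c"
    unfolding partial_partition_def using moment by (auto simp: card_sk_configs)
  have "partial_free_energy \<gamma> N N \<le> (LINT G|?M. partial_partition \<gamma> N G * (1 / (2 ^ N * c)) + (ln c - 1))"
    unfolding partial_free_energy_def
  proof (rule integral_mono)
    fix G
    have "ln (1 / 2 ^ N * partial_partition \<gamma> N G / c) \<le> 1 / 2 ^ N * partial_partition \<gamma> N G / c - 1"
      using partial_partition_pos[of \<gamma> N G] by (intro ln_le_minus_one) (auto simp: c_def)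
    moreover have "ln (1 / 2 ^ N * partial_partition \<gamma> N G / c) = ln (1 / 2 ^ N * partial_partition \<gamma> N G) - ln c"
      using partial_partition_pos[of \<gamma> N G] by (subst ln_div) (auto simp: c_def)
    ultimately show "ln (1 / 2 ^ N * partial_partition \<gamma> N G) \<le> partial_partition \<gamma> N G * (1 / (2 ^ N * c)) + (ln c - 1)"
      by simp
  next
    show "integrable ?M (\<lambda>G. ln (1 / 2 ^ N * partial_partition \<gamma> N G))"
      by (rule partial_log_partition_integrable) simp
    show "integrable ?M (\<lambda>G. partial_partition \<gamma> N G * (1 / (2 ^ N * c)) + (ln c - 1))"
      by (intro Bochner_Integration.integrable_add integrable_mult_left Z(1) integrable_const)
  qed
  also have "\<dots> = (LINT G|?M. partial_partition \<gamma> N G) * (1 / (2 ^ N * c)) + (ln c - 1)"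
    using Bochner_Integration.integral_add[OF integrable_mult_left[OF Z(1), of "1 / (2 ^ N * c)"]
        integrable_const[of "ln c - 1"]]
    by (simp add: prob_space del: One_nat_def)
  also have "\<dots> = ln c" unfolding Z(2) by (simp add: c_def)
  finally show ?thesis by (simp add: c_def)
qed

text \<open>
  Each Boltzmann factor for the coupling \<open>\<gamma>\<close> is at most the partition function \<open>Z\<close>. Its power with
  exponent \<open>b\<close>, the Boltzmann factor for \<open>b * \<gamma>\<close>, is therefore at most that power of \<open>Z\<close>, and so is the
  average of these factors over all configurations. The term \<open>N * ln 2\<close> undoes the normalisation of \<open>Z\<close>.
\<close>

lemma partial_free_energy_linear:
  assumes "0 < b"
  shows "partial_free_energy (b * \<gamma>) N N \<le> b * (real N * ln 2 + partial_free_energy \<gamma> N N)"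
proof -
  let ?M = "gauss_product ({1..N} \<times> {1..N})"
  interpret prob_space ?M by (rule prob_space_gauss_product)
  have i: "integrable ?M (\<lambda>G. ln (1 / 2 ^ N * partial_partition \<gamma> N G))" for \<gamma>
    by (rule partial_log_partition_integrable) simp
  have "partial_free_energy (b * \<gamma>) N N
      \<le> (LINT G|?M. b * (real N * ln 2 + ln (1 / 2 ^ N * partial_partition \<gamma> N G)))"
    unfolding partial_free_energy_def
  proof (rule integral_mono)
    fix G
    let ?Z = "partial_partition \<gamma> N G"
    have Z: "0 < ?Z" "0 < partial_partition (b * \<gamma>) N G" by (rule partial_partition_pos)+
    have "partial_partition (b * \<gamma>) N G \<le> (\<Sum>t\<in>sk_configs N. exp (b * ln ?Z))"
      unfolding partial_partition_def[of "b * \<gamma>"]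
    proof (rule sum_mono)
      fix t assume t: "t \<in> sk_configs N"
      have "exp (partial_energy \<gamma> N G t) \<le> ?Z"
        unfolding partial_partition_def by (rule member_le_sum[OF t]) (auto simp: finite_sk_configs)
      hence "partial_energy \<gamma> N G t \<le> ln ?Z" using Z by (simp add: ln_ge_iff)
      hence "b * partial_energy \<gamma> N G t \<le> b * ln ?Z" using assms by simp
      thus "exp (partial_energy (b * \<gamma>) N G t) \<le> exp (b * ln ?Z)"
        by (simp add: partial_energy_def mult.assoc)
    qed
    hence "1 / 2 ^ N * partial_partition (b * \<gamma>) N G \<le> exp (b * ln ?Z)"
      by (simp add: card_sk_configs field_simps)
    hence "ln (1 / 2 ^ N * partial_partition (b * \<gamma>) N G) \<le> ln (exp (b * ln ?Z))"
      using Z by (subst ln_le_cancel_iff) auto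
    also have "\<dots> = b * (real N * ln 2 + ln (1 / 2 ^ N * ?Z))"
      using Z by (simp add: ln_div ln_realpow)
    finally show "ln (1 / 2 ^ N * partial_partition (b * \<gamma>) N G) \<le> b * (real N * ln 2 + ln (1 / 2 ^ N * ?Z))" .
  qed (intro i integrable_mult_right Bochner_Integration.integrable_add integrable_const)+
  also have "\<dots> = b * (real N * ln 2 + partial_free_energy \<gamma> N N)"
    using Bochner_Integration.integral_add[OF integrable_const[of "real N * ln 2"] i[of \<gamma>]]
    by (simp add: partial_free_energy_def prob_space del: One_nat_def)
  finally show ?thesis .
qed

lemma sk_free_energy_upper:
  assumes \<beta>: "0 < \<beta>" and N: "2 \<le> N"
  shows "\<beta> / real N * sk_free_energy N \<beta> \<le> 2 * min \<beta> (\<beta>\<^sup>2)"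
proof -
  have quad: "partial_free_energy (b / sqrt (real N)) N N \<le> b\<^sup>2 * real N / 2" for b
    using partial_free_energy_annealed[of "b / sqrt (real N)" N] N
    by (simp add: power_divide power2_eq_square)
  have "\<beta> * sk_free_energy N \<beta> \<le> \<beta>\<^sup>2 * real N / 2"
    unfolding sk_free_energy_eq[OF \<beta>] by (rule quad)
  also have "\<dots> \<le> real N * (2 * \<beta>\<^sup>2)" by simp
  finally have 1: "\<beta> / real N * sk_free_energy N \<beta> \<le> 2 * \<beta>\<^sup>2" using N by (simp add: field_simps)
  have "\<beta> * sk_free_energy N \<beta> \<le> \<beta> * (real N * ln 2 + partial_free_energy (1 / sqrt (real N)) N N)"
    unfolding sk_free_energy_eq[OF \<beta>] using partial_free_energy_linear[OF \<beta>, of "1 / sqrt (real N)" N] by simp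
  also have "\<dots> \<le> \<beta> * (real N * 1 + real N / 2)"
    using \<beta> quad[of 1] ln2_le_25_over_36
    by (intro mult_left_mono add_mono) auto
  also have "\<dots> \<le> real N * (2 * \<beta>)" using \<beta> by (simp add: field_simps)
  finally have 2: "\<beta> / real N * sk_free_energy N \<beta> \<le> 2 * \<beta>" using N by (simp add: field_simps)
  from 1 2 show ?thesis by simp
qed

section \<open>The two quantities are comparable\<close>

lemma parisi_min_bounds:
  assumes \<beta>: "0 < \<beta>"
  shows "heat_lncosh \<beta> 0 / 2 \<le> parisi_min \<beta>" "parisi_min \<beta> \<le> 2 * min \<beta> (\<beta>\<^sup>2)"
proof -
  define S where "S = {parisi_functional \<alpha> \<beta> f | \<alpha> f. cdf_unit_interval \<alpha> \<and> parisi_solution \<alpha> \<beta> f}"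
  have lower: "heat_lncosh \<beta> 0 / 2 \<le> y" if "y \<in> S" for y
    using that parisi_functional_lower[OF _ _ \<beta>] by (auto simp: S_def)
  have mem: "heat_lncosh (\<beta> * sqrt 2) 0 \<in> S"
    unfolding S_def mem_Collect_eq
    using cdf_point_mass_one parisi_solution_heat[of \<beta>] parisi_functional_heat[of \<beta>] by metis
  have min_eq: "parisi_min \<beta> = Inf S" by (simp add: parisi_min_def S_def)
  show "heat_lncosh \<beta> 0 / 2 \<le> parisi_min \<beta>"
    unfolding min_eq using mem lower by (intro cInf_greatest) auto
  have "parisi_min \<beta> \<le> heat_lncosh (\<beta> * sqrt 2) 0"
    unfolding min_eq using lower by (intro cInf_lower[OF mem] bdd_belowI)
  moreover have "heat_lncosh (\<beta> * sqrt 2) 0 \<le> 2 * \<beta>\<^sup>2"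
    using heat_lncosh_le_square[of "\<beta> * sqrt 2"] by (simp add: power_mult_distrib)
  moreover have "heat_lncosh (\<beta> * sqrt 2) 0 \<le> \<beta> * 2"
  proof -
    have "sqrt 2 \<le> (2::real)" by (rule real_le_lsqrt) auto
    hence "\<beta> * sqrt 2 \<le> \<beta> * 2" using \<beta> by (intro mult_left_mono) auto
    moreover have "heat_lncosh (\<beta> * sqrt 2) 0 \<le> \<beta> * sqrt 2"
      using heat_lncosh_le_linear[of "\<beta> * sqrt 2" 0] \<beta> by simp
    ultimately show ?thesis by (rule order_trans[rotated])
  qed
  ultimately show "parisi_min \<beta> \<le> 2 * min \<beta> (\<beta>\<^sup>2)" by simp
qed

theorem theorem10:
  shows "\<exists>c C :: real. 0 < c \<and> c \<le> C \<and>
    (\<forall>(N :: nat) (\<beta> :: real). N \<ge> 2 \<longrightarrow> \<beta> > 0 \<longrightarrow>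
      c * parisi_min \<beta> \<le> \<beta> / real N * sk_free_energy N \<beta> \<and>
      \<beta> / real N * sk_free_energy N \<beta> \<le> C * parisi_min \<beta>)"
proof (intro exI conjI allI impI)
  let ?c = "gauss_min_moment / 6"
  let ?C = "max ?c (4 / gauss_min_moment)"
  note pos = gauss_min_moment_pos
  show "0 < ?c" using pos by simp
  show "?c \<le> ?C" by simp
  fix N :: nat and \<beta> :: real assume N: "2 \<le> N" and \<beta>: "0 < \<beta>"
  define m where "m = min \<beta> (\<beta>\<^sup>2)"
  have m: "0 < m" using \<beta> by (simp add: m_def)
  have L: "gauss_min_moment * m \<le> heat_lncosh \<beta> 0"
    unfolding m_def using \<beta> by (intro heat_lncosh_lower) simp
  have P: "gauss_min_moment * m / 2 \<le> parisi_min \<beta>" "parisi_min \<beta> \<le> 2 * m"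
    using parisi_min_bounds[OF \<beta>] L unfolding m_def by linarith+
  have F: "gauss_min_moment * m / 3 \<le> \<beta> / real N * sk_free_energy N \<beta>"
      "\<beta> / real N * sk_free_energy N \<beta> \<le> 2 * m"
    using sk_free_energy_lower[OF \<beta> N] sk_free_energy_upper[OF \<beta> N] L unfolding m_def by linarith+
  have "?c * parisi_min \<beta> \<le> ?c * (2 * m)" using P(2) pos by (intro mult_left_mono) auto
  also have "\<dots> = gauss_min_moment * m / 3" by simp
  finally show "?c * parisi_min \<beta> \<le> \<beta> / real N * sk_free_energy N \<beta>" using F(1) by linarith
  have "2 * m = 4 / gauss_min_moment * (gauss_min_moment * m / 2)" using pos by simp
  also have "\<dots> \<le> 4 / gauss_min_moment * parisi_min \<beta>" using P(1) pos by (intro mult_left_mono) auto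
  also have "\<dots> \<le> ?C * parisi_min \<beta>"
  proof (rule mult_right_mono)
    have "0 \<le> gauss_min_moment * m / 2" using pos m by simp
    thus "0 \<le> parisi_min \<beta>" using P(1) by linarith
  qed simp
  finally show "\<beta> / real N * sk_free_energy N \<beta> \<le> ?C * parisi_min \<beta>" using F(2) by linarith
qed

end
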